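(* Assume that $a_{r,s}+\dot a_{r,s}\in\mathcal O(r+s)$, i.e. there is a constant $C<\infty$ with $a_{r,s}+\dot a_{r,s}\le C(r+s)$ for all $(r,s)\in\Omega$, and let $c^0\in X^+$. Then: (1) There exists a solution of the two-component Becker--Döring equations with initial data $c^0$ on $[0,\infty)$. (2) Any solution $c$ with initial data $c^0$ on an interval $[0,T)$, $0<T\le\infty$, conserves Type I and Type II mass for all times, i.e. for all $t\in[0,T)$ $$\sum_{(r,s)\in\Omega} r\,c_{r,s}(t)=\sum_{(r,s)\in\Omega} r\,c^0_{r,s}\quad\text{and}\quad \sum_{(r,s)\in\Omega} s\,c_{r,s}(t)=\sum_{(r,s)\in\Omega} s\,c^0_{r,s}.$$ (3) If additionally $\sum_{(r,s)\in\Omega}(r+s)^2c^0_{r,s}<\infty$, then the solution with initial data $c^0$ is unique.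
   Context: Let $\Omega=\{(r,s)\in\mathbb N_0^2 : r+s\ge1\}$. The coefficients $a_{r,s}\ge0$, $\dot a_{r,s}\ge0$, $b_{r+1,s}\ge0$, $\dot b_{r,s+1}\ge0$, $(r,s)\in\Omega$, are given real numbers. (Dots are part of the symbol names, not time derivatives.) Let $X$ be the Banach space of real sequences $c=(c_{r,s})_{(r,s)\in\Omega}$ with $\|c\|:=\sum_{(r,s)\in\Omega}(r+s)|c_{r,s}|<\infty$, and $X^+=\{c\in X: c_{r,s}\ge0\ \text{for all }(r,s)\in\Omega\}$. Fluxes: for $(r,s)\in\Omega$, $$J_{r,s}(c)=a_{r,s}c_{1,0}c_{r,s}-b_{r+1,s}c_{r+1,s},\qquad \dot J_{r,s}(c)=\dot a_{r,s}c_{0,1}c_{r,s}-\dot b_{r,s+1}c_{r,s+1}.$$ For a sequence $f$ on $\Omega$ (set to $0$ outside $\Omega$) put $\Delta_r f_{r,s}=f_{r,s}-f_{r-1,s}$ and $\Delta_s f_{r,s}=f_{r,s}-f_{r,s-1}$. Solution: for $0<T\le\infty$, a function $c:[0,T)\to X^+$ is a solution of the two-component Becker--Döring equations on $[0,T)$ with initial data $c^0\in X^+$ if (i) each $c_{r,s}:[0,T)\to\mathbb R_{\ge0}$ is continuous and $\sup_{t\in[0,T)}\|c(t)\|<\infty$; (ii) for all $t\in[0,T)$, $\int_0^t\sum_{(r,s)\in\Omega}\big((a_{r,s}+\dot a_{r,s})c_{r,s}+b_{r+1,s}c_{r+1,s}+\dot b_{r,s+1}c_{r,s+1}\big)(\tau)\,d\tau<\infty$;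 (iii) for all $t\in[0,T)$, $$c_{1,0}(t)=c^0_{1,0}-\int_0^t\Big(J_{1,0}+\dot J_{1,0}+\sum_{(r,s)\in\Omega}J_{r,s}\Big)(c(\tau))\,d\tau,$$ $$c_{0,1}(t)=c^0_{0,1}-\int_0^t\Big(J_{0,1}+\dot J_{0,1}+\sum_{(r,s)\in\Omega}\dot J_{r,s}\Big)(c(\tau))\,d\tau,$$ $$c_{r,s}(t)=c^0_{r,s}-\int_0^t\big(\Delta_rJ_{r,s}+\Delta_s\dot J_{r,s}\big)(c(\tau))\,d\tau\quad\text{for all } r+s\ge2.$$ *)

theory Defs
  imports "HOL-Analysis.Analysis"
begin

text \<open>
  A sequence on \<open>\<Omega>\<close> is a function of type \<open>nat \<Rightarrow> nat \<Rightarrow> real\<close>. Its value at \<open>(0,0)\<close>,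
  the only point outside \<open>\<Omega>\<close>, is junk and never used; equality of sequences therefore means
  equality on \<open>\<Omega>\<close>. The coefficients \<open>b\<close> and \<open>bdot\<close> are used only at the indices
  \<open>(r+1,s)\<close> and \<open>(r,s+1)\<close>, respectively, with \<open>(r,s) \<in> \<Omega>\<close>.
\<close>

type_synonym bd_seq = "nat \<Rightarrow> nat \<Rightarrow> real"

definition Omega :: "(nat \<times> nat) set" where
  "Omega = {(r, s). r + s \<ge> 1}"

text \<open>An infinite real sum that does not converge has the value \<open>0\<close>, so \<open>bd_norm\<close> is meaningful
  only on \<open>bd_X\<close>.\<close>

definition bd_norm :: "bd_seq \<Rightarrow> real" where
  "bd_norm c = (\<Sum>\<^sub>\<infinity>(r, s)\<in>Omega. real (r + s) * \<bar>c r s\<bar>)"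

definition bd_X :: "bd_seq set" where
  "bd_X = {c. (\<lambda>(r, s). real (r + s) * \<bar>c r s\<bar>) summable_on Omega}"

definition bd_Xplus :: "bd_seq set" where
  "bd_Xplus = {c \<in> bd_X. \<forall>(r, s)\<in>Omega. c r s \<ge> 0}"

definition flux :: "bd_seq \<Rightarrow> bd_seq \<Rightarrow> bd_seq \<Rightarrow> bd_seq" where
  "flux a b c r s = a r s * c 1 0 * c r s - b (r + 1) s * c (r + 1) s"

definition fluxdot :: "bd_seq \<Rightarrow> bd_seq \<Rightarrow> bd_seq \<Rightarrow> bd_seq" where
  "fluxdot adot bdot c r s = adot r s * c 0 1 * c r s - bdot r (s + 1) * c r (s + 1)"

definition zero_ext :: "bd_seq \<Rightarrow> bd_seq" where
  "zero_ext f r s = (if (r, s) \<in> Omega then f r s else 0)"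

text \<open>The cases \<open>r = 0\<close> and \<open>s = 0\<close> are separate because subtraction on \<open>nat\<close> truncates;
  there the shifted index lies outside \<open>\<Omega>\<close>.\<close>

definition Delta_r :: "bd_seq \<Rightarrow> bd_seq" where
  "Delta_r f r s = zero_ext f r s - (if r = 0 then 0 else zero_ext f (r - 1) s)"

definition Delta_s :: "bd_seq \<Rightarrow> bd_seq" where
  "Delta_s f r s = zero_ext f r s - (if s = 0 then 0 else zero_ext f r (s - 1))"

definition time_interval :: "ereal \<Rightarrow> real set" where
  "time_interval T = {t. 0 \<le> t \<and> ereal t < T}"

text \<open>
  The series in the second integral condition has nonnegative terms but may diverge for some times,
  so that condition is stated in \<open>ennreal\<close>. Together with the uniform bound on the norm
  it makes all series in the integral equations converge absolutely for almost every time and all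
  integrands Lebesgue integrable, so no default value for divergent sums or for integrals
  of nonintegrable functions enters.
\<close>

definition bd_solution ::
  "bd_seq \<Rightarrow> bd_seq \<Rightarrow> bd_seq \<Rightarrow> bd_seq \<Rightarrow> bd_seq \<Rightarrow> ereal \<Rightarrow> (real \<Rightarrow> bd_seq) \<Rightarrow> bool" where
  "bd_solution a adot b bdot c0 T c \<longleftrightarrow>
     0 < T \<and> c0 \<in> bd_Xplus \<and>
     (\<forall>t\<in>time_interval T. c t \<in> bd_Xplus) \<and>
     (\<forall>(r, s)\<in>Omega. continuous_on (time_interval T) (\<lambda>t. c t r s)) \<and>
     bdd_above ((\<lambda>t. bd_norm (c t)) ` time_interval T) \<and>
     (\<forall>t\<in>time_interval T.
        (\<integral>\<^sup>+\<tau>\<in>{0..t}. (\<Sum>\<^sub>\<infinity>(r, s)\<in>Omega.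
            ennreal ((a r s + adot r s) * c \<tau> r s + b (r + 1) s * c \<tau> (r + 1) s
                     + bdot r (s + 1) * c \<tau> r (s + 1))) \<partial>lborel) < \<infinity>) \<and>
     (\<forall>t\<in>time_interval T.
        c t 1 0 = c0 1 0 - (LBINT \<tau>:{0..t}.
            flux a b (c \<tau>) 1 0 + fluxdot adot bdot (c \<tau>) 1 0
            + (\<Sum>\<^sub>\<infinity>(r, s)\<in>Omega. flux a b (c \<tau>) r s)) \<and>
        c t 0 1 = c0 0 1 - (LBINT \<tau>:{0..t}.
            flux a b (c \<tau>) 0 1 + fluxdot adot bdot (c \<tau>) 0 1
            + (\<Sum>\<^sub>\<infinity>(r, s)\<in>Omega. fluxdot adot bdot (c \<tau>) r s)) \<and>
        (\<forall>r s. r + s \<ge> 2 \<longrightarrow>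
          c t r s = c0 r s - (LBINT \<tau>:{0..t}.
            Delta_r (flux a b (c \<tau>)) r s + Delta_s (fluxdot adot bdot (c \<tau>)) r s)))"

end

theory Submission
  imports Defs "HOL-Complex_Analysis.Great_Picard"
begin

text \<open>
  Testing the equations for \<open>r + s \<ge> 2\<close> against a weight \<open>w\<close> with bounded increments moves the
  differences from the fluxes to \<open>w\<close>: truncate \<open>w\<close> with bounded increments and pass to the limit by
  dominated convergence, since the time-integrated fluxes are summable. For \<open>w = \<alpha> r + \<beta> s\<close> this shows
  that the monomer equations are equivalent to conservation of both masses. This is part (2), and it
  makes the monomer equations automatic in the construction of a solution.

  Uniqueness: weights close to \<open>(r + s)\<^sup>2\<close> show that the second moment stays bounded (fragmentation
  has the good sign). The modulus of the difference \<open>e\<close> of two solutions is a subsolution of a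
  similar system, the monomer differences are controlled by conservation of mass, and Gronwall's
  lemma applies to the sum of \<open>(r + s) \<bar>e r s\<bar>\<close>.

  Existence: the explicit Euler scheme for the system truncated at size \<open>n\<close>, with a time step depending
  on \<open>n\<close>, preserves positivity and both masses exactly. A superlinear weight that is summable against
  the initial data gives uniformly small mass tails, hence compactness without loss of mass.
\<close>

subsection \<open>Summation over the index set\<close>

text \<open>The obstacle is that \<open>b\<close> and \<open>bdot\<close> have no growth bound.
  Fragmentation is controlled only after integration in time, through the finite gross rate, so the
  right-hand side admits no Lipschitz estimate. The moment and uniqueness estimates therefore use
  weights that are nondecreasing in the size: fragmentation can then be discarded, and only the
  linear growth of \<open>a + adot\<close> enters. The monomer equations contain the full flux sums
  and resist this treatment. Hence solutions are compared in a norm that ignores monomers, and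
  equicontinuity of the monomers is read off from the masses. The second moment is needed because
  the difference of two solutions contains \<open>a r s * e 1 0 * d r s\<close>: the weight r + s
  and the growth of \<open>a\<close> contribute one factor r + s each. Euler steps replace the flow
  of the truncated system. Positivity then reduces to a one-sided linear bound on the right-hand
  side, and conservation is a finite identity in every step.\<close>

definition Omega_upto :: "nat \<Rightarrow> (nat \<times> nat) set" where
  "Omega_upto n = {(r, s). 1 \<le> r + s \<and> r + s \<le> n}"

lemma mem_Omega [simp]: "(r, s) \<in> Omega \<longleftrightarrow> 1 \<le> r + s"
  by (auto simp: Omega_def)

lemma mem_Omega_upto [simp]: "(r, s) \<in> Omega_upto n \<longleftrightarrow> 1 \<le> r + s \<and> r + s \<le> n"
  by (simp add: Omega_upto_def)

lemma finite_Omega_upto [simp, intro]: "finite (Omega_upto n)"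
  by (rule finite_subset[of _ "{..n} \<times> {..n}"]) auto

lemma Omega_upto_subset: "Omega_upto n \<subseteq> Omega"
  by auto

lemma Omega_upto_mono: "m \<le> n \<Longrightarrow> Omega_upto m \<subseteq> Omega_upto n"
  by auto

lemma finite_subset_Omega_upto:
  assumes "finite F" "F \<subseteq> Omega"
  obtains n where "F \<subseteq> Omega_upto n"
proof
  \<comment> \<open>The sum of all sizes bounds each of them and, unlike a maximum, needs no
    separate treatment of the empty set.\<close>
  define n where "n = (\<Sum>(r, s)\<in>F. r + s)"
  show "F \<subseteq> Omega_upto n"
  proof
    fix p assume p: "p \<in> F"
    obtain r s where rs: "p = (r, s)" by fastforce
    have "r + s \<le> n"
      unfolding n_def using member_le_sum[OF p, of "\<lambda>(r, s). r + s"] assms rs by auto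
    then show "p \<in> Omega_upto n" using p rs assms by auto
  qed
qed

text \<open>The triangles exhaust \<open>Omega\<close>, so unordered sums become sequential limits,
  and bounds for infinite sums follow from bounds on triangles.\<close>

lemma filterlim_Omega_upto: "filterlim Omega_upto (finite_subsets_at_top Omega) sequentially"
  unfolding filterlim_finite_subsets_at_top
proof (intro allI impI)
  fix X assume X: "finite X \<and> X \<subseteq> Omega"
  then obtain N where "X \<subseteq> Omega_upto N" using finite_subset_Omega_upto by blast
  then show "\<forall>\<^sub>F n in sequentially.
      finite (Omega_upto n) \<and> X \<subseteq> Omega_upto n \<and> Omega_upto n \<subseteq> Omega"
    unfolding eventually_sequentially
    by (metis Omega_upto_mono Omega_upto_subset finite_Omega_upto order_trans)
qed

lemma sum_Omega_upto_tendsto: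
  fixes f :: "nat \<times> nat \<Rightarrow> 'a :: {comm_monoid_add, t2_space}"
  assumes "f summable_on Omega"
  shows "(\<lambda>n. sum f (Omega_upto n)) \<longlonglongrightarrow> infsum f Omega"
  using filterlim_compose[OF infsum_tendsto[OF assms] filterlim_Omega_upto] .

lemma infsum_eq_sum_Omega_upto:
  fixes f :: "nat \<times> nat \<Rightarrow> 'a :: {comm_monoid_add, t2_space}"
  assumes "\<And>r s. r + s > n \<Longrightarrow> f (r, s) = 0"
  shows "infsum f Omega = sum f (Omega_upto n)"
proof -
  have "infsum f Omega = infsum f (Omega_upto n)"
    by (rule infsum_cong_neutral) (use assms in auto)
  then show ?thesis by simp
qed

lemma summable_onI_Omega_upto:
  fixes f :: "nat \<times> nat \<Rightarrow> real"
  assumes "\<And>r s. 1 \<le> r + s \<Longrightarrow> 0 \<le> f (r, s)" "\<And>n. sum f (Omega_upto n) \<le> K"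
  shows "f summable_on Omega"
proof -
  have nn: "0 \<le> f p" if "p \<in> Omega" for p
    using assms(1) that by (cases p) auto
  have F: "sum f F \<le> K" if F: "finite F" "F \<subseteq> Omega" for F
  proof -
    obtain n where "F \<subseteq> Omega_upto n" using finite_subset_Omega_upto F by blast
    then have "sum f F \<le> sum f (Omega_upto n)"
      by (intro sum_mono2) (auto intro: nn assms)
    then show ?thesis using assms(2)[of n] by simp
  qed
  show "f summable_on Omega"
    by (rule nonneg_bdd_above_summable_on) (use nn F in \<open>auto intro!: bdd_aboveI\<close>)
qed

section \<open>Absolute summability and dominated convergence for unordered sums\<close>

lemma summable_on_abs:
  fixes f :: "'a \<Rightarrow> real"
  shows "f summable_on A \<Longrightarrow> (\<lambda>x. \<bar>f x\<bar>) summable_on A"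
  using summable_on_iff_abs_summable_on_real[of f A] by simp

lemma summable_on_bounded_by:
  fixes f g :: "'a \<Rightarrow> real"
  assumes "g summable_on A" "\<And>x. x \<in> A \<Longrightarrow> \<bar>f x\<bar> \<le> g x"
  shows "f summable_on A"
proof -
  have "(\<lambda>x. norm (f x)) summable_on A"
  proof (rule Infinite_Sum.abs_summable_on_comparison_test)
    show "(\<lambda>x. norm (g x)) summable_on A"
      using summable_on_abs[OF assms(1)] by simp
    show "norm (f x) \<le> norm (g x)" if "x \<in> A" for x
      using assms(2)[OF that] by simp
  qed
  then show ?thesis by (rule abs_summable_summable)
qed

text \<open>Identifying sums with integrals for counting measure makes dominated convergence and
  Fubini available. The first claim holds without summability, since both sides then have the
  default value 0.\<close>

lemma infsum_eq_integral_count_space: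
  fixes f :: "'a \<Rightarrow> real"
  shows "infsum f A = integral\<^sup>L (count_space A) f"
    and "integrable (count_space A) f \<longleftrightarrow> f summable_on A"
proof -
  show iff: "integrable (count_space A) f \<longleftrightarrow> f summable_on A"
    using abs_summable_equivalent[of f A] summable_on_iff_abs_summable_on_real[of f A]
    by (simp only: Infinite_Set_Sum.abs_summable_on_def)
  show "infsum f A = integral\<^sup>L (count_space A) f"
  proof (cases "f summable_on A")
    case True
    then have "Infinite_Set_Sum.abs_summable_on f A"
      by (simp only: Infinite_Set_Sum.abs_summable_on_def iff)
    from infsetsum_infsum[OF this] show ?thesis by (simp only: infsetsum_def)
  next
    case False
    then show ?thesis using iff
      by (simp add: infsum_not_exists not_integrable_integral_eq)
  qed
qed

lemma infsum_dominated_convergence: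
  fixes f :: "nat \<Rightarrow> 'a \<Rightarrow> real"
  assumes g: "g summable_on A" and le: "\<And>n x. x \<in> A \<Longrightarrow> \<bar>f n x\<bar> \<le> g x"
    and lim: "\<And>x. x \<in> A \<Longrightarrow> (\<lambda>n. f n x) \<longlonglongrightarrow> h x"
  shows "h summable_on A" "(\<lambda>n. infsum (f n) A) \<longlonglongrightarrow> infsum h A"
proof -
  have hle: "\<bar>h x\<bar> \<le> g x" if "x \<in> A" for x
    by (rule LIMSEQ_le_const2[OF tendsto_rabs[OF lim[OF that]]]) (use le that in auto)
  show h: "h summable_on A" using summable_on_bounded_by[OF g hle] .
  have int: "integrable (count_space A) k" "integral\<^sup>L (count_space A) k = infsum k A"
    if "k summable_on A" for k :: "'a \<Rightarrow> real"
    using that by (simp_all only: infsum_eq_integral_count_space)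
  have fs: "f n summable_on A" for n using summable_on_bounded_by[OF g le] .
  have "(\<lambda>n. integral\<^sup>L (count_space A) (f n)) \<longlonglongrightarrow> integral\<^sup>L (count_space A) h"
    by (rule integral_dominated_convergence[where w = g])
      (use int[OF g] int[OF h] fs le lim in \<open>auto simp: AE_count_space\<close>)
  then show "(\<lambda>n. infsum (f n) A) \<longlonglongrightarrow> infsum h A"
    using int(2)[OF fs] int(2)[OF h] by simp
qed

section \<open>Summation by parts and the weak form\<close>

text \<open>Shifting r by one matches the two sums except at the boundary: at the top size
  \<open>w (r + 1) s\<close> vanishes, and for r = 0 or size 1 the shifted flux lies outside
  \<open>Omega\<close>.\<close>

lemma sum_Delta_r_parts:
  fixes J w :: bd_seq
  assumes "w 1 0 = 0" "w 0 1 = 0" "\<And>r s. r + s > n \<Longrightarrow> w r s = 0"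
  shows "(\<Sum>(r, s)\<in>Omega_upto n. w r s * Delta_r J r s)
    = - (\<Sum>(r, s)\<in>Omega_upto n. J r s * (w (r + 1) s - w r s))"
proof -
  let ?B = "Omega_upto n"
  have "(\<Sum>(r, s)\<in>?B. if r = 0 then 0 else w r s * zero_ext J (r - 1) s)
      = (\<Sum>(r, s)\<in>?B. w (r + 1) s * J r s)"
    \<comment> \<open>The rule compares terms also at the neutral indices. These are sent to (n + 1,
      0), a dummy at which the other summand contains \<open>w (n + 2) 0 = 0\<close>.\<close>
    by (rule sum.reindex_bij_witness_not_neutral
        [where S' = "{(r, s). (r, s) \<in> ?B \<and> (r = 0 \<or> r + s = 1)}"
         and T' = "{(r, s). (r, s) \<in> ?B \<and> r + s = n}"
         and i = "\<lambda>(r, s). (r + 1, s)" and j = "\<lambda>(r, s). if r = 0 \<or> r + s = 1 then (n + 1, 0) else (r - 1, s)"])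
      (use assms in \<open>auto simp: zero_ext_def intro: finite_subset[OF _ finite_Omega_upto[of n]]
        split: if_splits\<close>)
  moreover have "(\<Sum>(r, s)\<in>?B. w r s * Delta_r J r s) = (\<Sum>(r, s)\<in>?B. w r s * J r s)
      - (\<Sum>(r, s)\<in>?B. if r = 0 then 0 else w r s * zero_ext J (r - 1) s)"
    unfolding sum_subtractf[symmetric]
    by (rule sum.cong) (auto simp: Delta_r_def zero_ext_def algebra_simps)
  ultimately show ?thesis
    by (simp add: sum_subtractf[symmetric] sum_negf[symmetric] split_def algebra_simps)
qed

lemma sum_Delta_s_parts:
  fixes J w :: bd_seq
  assumes "w 1 0 = 0" "w 0 1 = 0" "\<And>r s. r + s > n \<Longrightarrow> w r s = 0"
  shows "(\<Sum>(r, s)\<in>Omega_upto n. w r s * Delta_s J r s)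
    = - (\<Sum>(r, s)\<in>Omega_upto n. J r s * (w r (s + 1) - w r s))"
proof -
  let ?f = "\<lambda>x. \<lambda>r s :: nat. x s r :: real"
  have swap: "(\<Sum>(r, s)\<in>Omega_upto n. h r s) = (\<Sum>(r, s)\<in>Omega_upto n. h s r)" for h :: bd_seq
    by (rule sum.reindex_bij_witness[where i = prod.swap and j = prod.swap]) auto
  have D: "Delta_s J r s = Delta_r (?f J) s r" for r s
    by (auto simp: Delta_s_def Delta_r_def zero_ext_def add.commute)
  have "(\<Sum>(r, s)\<in>Omega_upto n. ?f w r s * Delta_r (?f J) r s)
    = - (\<Sum>(r, s)\<in>Omega_upto n. ?f J r s * (?f w (r + 1) s - ?f w r s))"
    by (rule sum_Delta_r_parts) (use assms in \<open>auto simp: add.commute\<close>)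
  then show ?thesis
    by (subst (1 2) swap) (simp add: D)
qed

text \<open>The cutoff \<open>min w (K (n - r - s)\<^sup>+)\<close> of a nonnegative weight \<open>w\<close> has finite support and
  keeps the increments bounded by \<open>K\<close>.\<close>

lemma infsum_weight_le:
  fixes J Jd w v :: bd_seq
  assumes v: "\<And>r s. 2 \<le> r + s \<Longrightarrow> v r s \<le> - (Delta_r J r s + Delta_s Jd r s)"
    and J: "(\<lambda>(r, s). J r s) summable_on Omega" and Jd: "(\<lambda>(r, s). Jd r s) summable_on Omega"
    and w0: "w 1 0 = 0" "w 0 1 = 0" "\<And>r s. 0 \<le> w r s" and K0: "0 < K"
    and wr: "\<And>r s. 1 \<le> r + s \<Longrightarrow> \<bar>w (r + 1) s - w r s\<bar> \<le> K"
    and ws: "\<And>r s. 1 \<le> r + s \<Longrightarrow> \<bar>w r (s + 1) - w r s\<bar> \<le> K"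
    and wv: "(\<lambda>(r, s). w r s * v r s) summable_on Omega"
  shows "(\<lambda>(r, s). J r s * (w (r + 1) s - w r s) + Jd r s * (w r (s + 1) - w r s)) summable_on Omega"
      (is ?sm)
    and "(\<Sum>\<^sub>\<infinity>(r, s)\<in>Omega. w r s * v r s)
      \<le> (\<Sum>\<^sub>\<infinity>(r, s)\<in>Omega. J r s * (w (r + 1) s - w r s) + Jd r s * (w r (s + 1) - w r s))"
proof -
  define W where "W n r s = min (w r s) (K * real (n - (r + s)))" for n r s
  define d where "d w = (\<lambda>(r, s). J r s * (w (r + 1) s - w r s) + Jd r s * (w r (s + 1) - w r s))"
    for w :: bd_seq
  have W: "W n 1 0 = 0" "W n 0 1 = 0" "\<And>r s. r + s > n \<Longrightarrow> W n r s = 0" "\<And>r s. W n r s \<ge> 0"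
    "\<And>r s. W n r s \<le> w r s" for n
    using w0 K0 by (auto simp: W_def)
  have step: "\<bar>K * real (n - Suc m) - K * real (n - m)\<bar> \<le> K" for n m
  proof (cases "m < n")
    case True
    then have "real (n - m) = real (n - Suc m) + 1" by auto
    then show ?thesis using K0 by (simp add: algebra_simps)
  qed (use K0 in auto)
  have min_diff: "\<bar>min x y - min x' y'\<bar> \<le> K" if "\<bar>x - x'\<bar> \<le> K" "\<bar>y - y'\<bar> \<le> K" for x y x' y'
    using that by linarith
  have Wr: "\<bar>W n (r + 1) s - W n r s\<bar> \<le> K" "\<bar>W n r (s + 1) - W n r s\<bar> \<le> K"
    if "1 \<le> r + s" for n r s
    using min_diff[OF wr[OF that] step[of n "r + s"]] min_diff[OF ws[OF that] step[of n "r + s"]]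
    by (simp_all add: W_def)
  have Wlim: "(\<lambda>n. W n r s) \<longlonglongrightarrow> w r s" for r s
  proof (rule tendsto_eventually)
    obtain N where N: "w r s / K \<le> real N" using real_arch_simple by blast
    have "W n r s = w r s" if "n \<ge> N + (r + s)" for n
    proof -
      have "w r s \<le> K * real N" using N K0 by (simp add: field_simps)
      also have "\<dots> \<le> K * real (n - (r + s))" using that K0 by (intro mult_left_mono) auto
      finally show ?thesis by (simp add: W_def)
    qed
    then show "\<forall>\<^sub>F n in sequentially. W n r s = w r s"
      unfolding eventually_sequentially by blast
  qed
  have J': "(\<lambda>(r, s). K * (\<bar>J r s\<bar> + \<bar>Jd r s\<bar>)) summable_on Omega"
    using summable_on_cmult_right[OF summable_on_add[OF summable_on_abs[OF J] summable_on_abs[OF Jd]], of K]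
    by (simp add: split_def)
  have dle: "\<bar>d (W n) x\<bar> \<le> (\<lambda>(r, s). K * (\<bar>J r s\<bar> + \<bar>Jd r s\<bar>)) x" if "x \<in> Omega" for n x
  proof -
    obtain r s where x: "x = (r, s)" by fastforce
    then have rs: "1 \<le> r + s" using that by simp
    have "\<bar>d (W n) x\<bar> \<le> \<bar>J r s\<bar> * \<bar>W n (r + 1) s - W n r s\<bar> + \<bar>Jd r s\<bar> * \<bar>W n r (s + 1) - W n r s\<bar>"
      unfolding d_def x by (simp add: abs_mult[symmetric] abs_triangle_ineq)
    also have "\<dots> \<le> \<bar>J r s\<bar> * K + \<bar>Jd r s\<bar> * K"
      by (intro add_mono mult_left_mono Wr rs) auto
    finally show ?thesis by (simp add: x algebra_simps)
  qed
  have dlim: "(\<lambda>n. d (W n) x) \<longlonglongrightarrow> d w x" if "x \<in> Omega" for x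
    unfolding d_def by (cases x) (auto intro!: tendsto_intros Wlim)
  have lim1: "(\<lambda>n. infsum (d (W n)) Omega) \<longlonglongrightarrow> infsum (d w) Omega" and sm: "d w summable_on Omega"
    using infsum_dominated_convergence[where f = "\<lambda>n. d (W n)", OF J' dle dlim] by auto
  show ?sm using sm by (simp add: d_def)
  have lim2: "(\<lambda>n. \<Sum>\<^sub>\<infinity>(r, s)\<in>Omega. W n r s * v r s) \<longlonglongrightarrow> (\<Sum>\<^sub>\<infinity>(r, s)\<in>Omega. w r s * v r s)"
  proof (rule infsum_dominated_convergence(2))
    show "(\<lambda>p. \<bar>(\<lambda>(r, s). w r s * v r s) p\<bar>) summable_on Omega"
      using wv by (rule summable_on_abs)
  next
    fix n x assume "x \<in> Omega"
    then show "\<bar>case x of (r, s) \<Rightarrow> W n r s * v r s\<bar> \<le> \<bar>case x of (r, s) \<Rightarrow> w r s * v r s\<bar>"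
      using W(4,5) w0(3) by (cases x) (auto simp: abs_mult abs_of_nonneg intro!: mult_right_mono)
  next
    fix x :: "nat \<times> nat" assume "x \<in> Omega"
    show "(\<lambda>n. case x of (r, s) \<Rightarrow> W n r s * v r s) \<longlonglongrightarrow> (case x of (r, s) \<Rightarrow> w r s * v r s)"
      by (cases x) (auto intro!: tendsto_intros Wlim)
  qed
  have "(\<Sum>\<^sub>\<infinity>(r, s)\<in>Omega. W n r s * v r s) \<le> infsum (d (W n)) Omega" for n
  proof -
    have "(\<Sum>\<^sub>\<infinity>(r, s)\<in>Omega. W n r s * v r s) = (\<Sum>(r, s)\<in>Omega_upto n. W n r s * v r s)"
      by (rule infsum_eq_sum_Omega_upto) (use W in auto)
    \<comment> \<open>For the cutoff weight all sums are finite and summation by parts is exact. The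
      inequality for \<open>v\<close> is known from size 2 on; at size 1 the weight
      vanishes.\<close>
    also have "\<dots> \<le> (\<Sum>(r, s)\<in>Omega_upto n. - (W n r s * Delta_r J r s) - W n r s * Delta_s Jd r s)"
    proof (rule sum_mono, clarify)
      fix r s assume rs: "(r, s) \<in> Omega_upto n"
      show "W n r s * v r s \<le> - (W n r s * Delta_r J r s) - W n r s * Delta_s Jd r s"
      proof (cases "2 \<le> r + s")
        case True
        then show ?thesis using mult_left_mono[OF v[OF True] W(4)[of n r s]]
          by (simp add: algebra_simps)
      next
        case False
        then have "(r, s) = (1, 0) \<or> (r, s) = (0, 1)" using rs by auto
        then show ?thesis using W(1,2) by auto
      qed
    qed
    also have "\<dots> = - (\<Sum>(r, s)\<in>Omega_upto n. W n r s * Delta_r J r s)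
        - (\<Sum>(r, s)\<in>Omega_upto n. W n r s * Delta_s Jd r s)"
      by (simp add: split_def sum_subtractf sum_negf)
    also have "\<dots> = (\<Sum>p\<in>Omega_upto n. d (W n) p)"
      using sum_Delta_r_parts[of "W n", OF W(1,2,3)] sum_Delta_s_parts[of "W n", OF W(1,2,3)]
      by (simp add: d_def split_def sum.distrib)
    also have "\<dots> = infsum (d (W n)) Omega"
      by (rule infsum_eq_sum_Omega_upto[symmetric]) (use W in \<open>auto simp: d_def\<close>)
    finally show ?thesis .
  qed
  then have "(\<Sum>\<^sub>\<infinity>(r, s)\<in>Omega. w r s * v r s) \<le> infsum (d w) Omega"
    using LIMSEQ_le[OF lim2 lim1] by blast
  then show "(\<Sum>\<^sub>\<infinity>(r, s)\<in>Omega. w r s * v r s)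
      \<le> (\<Sum>\<^sub>\<infinity>(r, s)\<in>Omega. J r s * (w (r + 1) s - w r s) + Jd r s * (w r (s + 1) - w r s))"
    by (simp add: d_def)
qed

text \<open>Two one-sided estimates with the same weight: one for \<open>v\<close>,
  \<open>J\<close>, \<open>Jd\<close>, the other for their negatives.\<close>

lemma infsum_weight_eq:
  fixes J Jd w v :: bd_seq
  assumes v: "\<And>r s. 2 \<le> r + s \<Longrightarrow> v r s = - (Delta_r J r s + Delta_s Jd r s)"
    and J: "(\<lambda>(r, s). J r s) summable_on Omega" and Jd: "(\<lambda>(r, s). Jd r s) summable_on Omega"
    and w0: "w 1 0 = 0" "w 0 1 = 0" "\<And>r s. 0 \<le> w r s" and K0: "0 < K"
    and wr: "\<And>r s. 1 \<le> r + s \<Longrightarrow> \<bar>w (r + 1) s - w r s\<bar> \<le> K"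
    and ws: "\<And>r s. 1 \<le> r + s \<Longrightarrow> \<bar>w r (s + 1) - w r s\<bar> \<le> K"
    and wv: "(\<lambda>(r, s). w r s * v r s) summable_on Omega"
  shows "(\<lambda>(r, s). J r s * (w (r + 1) s - w r s) + Jd r s * (w r (s + 1) - w r s)) summable_on Omega"
    and "(\<Sum>\<^sub>\<infinity>(r, s)\<in>Omega. w r s * v r s)
      = (\<Sum>\<^sub>\<infinity>(r, s)\<in>Omega. J r s * (w (r + 1) s - w r s) + Jd r s * (w r (s + 1) - w r s))"
proof -
  note le = infsum_weight_le[of v J Jd w K, OF _ J Jd w0 K0 wr ws wv]
  show "(\<lambda>(r, s). J r s * (w (r + 1) s - w r s) + Jd r s * (w r (s + 1) - w r s)) summable_on Omega"
    by (rule le(1)) (use v in auto)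
  have neg: "(\<lambda>(r, s). - f r s) summable_on Omega" if "(\<lambda>(r, s). f r s) summable_on Omega" for f :: bd_seq
    using that summable_on_uminus[of "\<lambda>(r, s). f r s" Omega] by (simp add: split_def)
  have "(\<Sum>\<^sub>\<infinity>(r, s)\<in>Omega. w r s * - v r s) \<le>
    (\<Sum>\<^sub>\<infinity>(r, s)\<in>Omega. - J r s * (w (r + 1) s - w r s) + - Jd r s * (w r (s + 1) - w r s))"
  proof (rule infsum_weight_le(2)[OF _ neg[OF J] neg[OF Jd] w0 K0 wr ws])
    show "(\<lambda>(r, s). w r s * - v r s) summable_on Omega" using neg[OF wv] by simp
  qed (use v in \<open>auto simp: Delta_r_def Delta_s_def zero_ext_def\<close>)
  also have "\<dots> = (\<Sum>\<^sub>\<infinity>p\<in>Omega. - (\<lambda>(r, s). J r s * (w (r + 1) s - w r s) + Jd r s * (w r (s + 1) - w r s)) p)"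
    by (rule infsum_cong) (auto simp: algebra_simps)
  also have "\<dots> = - (\<Sum>\<^sub>\<infinity>(r, s)\<in>Omega. J r s * (w (r + 1) s - w r s) + Jd r s * (w r (s + 1) - w r s))"
    by (rule infsum_uminus)
  also have "(\<Sum>\<^sub>\<infinity>(r, s)\<in>Omega. w r s * - v r s) = (\<Sum>\<^sub>\<infinity>p\<in>Omega. - (\<lambda>(r, s). w r s * v r s) p)"
    by (rule infsum_cong) auto
  also have "\<dots> = - (\<Sum>\<^sub>\<infinity>(r, s)\<in>Omega. w r s * v r s)"
    by (rule infsum_uminus)
  finally show "(\<Sum>\<^sub>\<infinity>(r, s)\<in>Omega. w r s * v r s)
      = (\<Sum>\<^sub>\<infinity>(r, s)\<in>Omega. J r s * (w (r + 1) s - w r s) + Jd r s * (w r (s + 1) - w r s))"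
    using le(2) v by force
qed

subsection \<open>The weak form and conservation of mass\<close>

lemma cont_set_integrable:
  fixes f :: "real \<Rightarrow> real"
  shows "t \<in> {0..T} \<Longrightarrow> continuous_on {0..T} f \<Longrightarrow> set_integrable lborel {0..t} f"
  by (rule borel_integrable_atLeastAtMost') (auto elim: continuous_on_subset)

lemma LBINT_nonneg:
  fixes f :: "'a :: euclidean_space \<Rightarrow> real"
  assumes "\<And>x. x \<in> A \<Longrightarrow> 0 \<le> f x"
  shows "0 \<le> (LBINT x:A. f x)"
  unfolding set_lebesgue_integral_def
  by (rule Bochner_Integration.integral_nonneg) (use assms in \<open>auto simp: indicator_def\<close>)

lemma summable_on_diff:
  fixes f g :: "'a \<Rightarrow> real"
  assumes "f summable_on A" "g summable_on A"
  shows "(\<lambda>x. f x - g x) summable_on A" and "(\<Sum>\<^sub>\<infinity>x\<in>A. f x - g x) = infsum f A - infsum g A"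
  using summable_on_add[OF assms(1) summable_on_uminus[THEN iffD2, OF assms(2)]]
    infsum_add[OF assms(1) summable_on_uminus[THEN iffD2, OF assms(2)]]
  by (simp_all add: infsum_uminus)

text \<open>Fubini for counting measure times Lebesgue measure. Countability of the index type
  reduces joint measurability to measurability of each section, and the second hypothesis is
  integrability on the product.\<close>

lemma infsum_set_integral_swap:
  fixes f :: "'a :: countable \<Rightarrow> 'b :: euclidean_space \<Rightarrow> real"
  assumes f: "\<And>p. p \<in> \<Omega> \<Longrightarrow> set_integrable lborel A (f p)"
    and abs: "(\<lambda>p. LBINT x:A. \<bar>f p x\<bar>) summable_on \<Omega>"
  shows "set_integrable lborel A (\<lambda>x. \<Sum>\<^sub>\<infinity>p\<in>\<Omega>. f p x)"
    and "(LBINT x:A. \<Sum>\<^sub>\<infinity>p\<in>\<Omega>. f p x) = (\<Sum>\<^sub>\<infinity>p\<in>\<Omega>. LBINT x:A. f p x)"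
proof -
  let ?F = "\<lambda>(p, x). indicator A x * f p x :: real"
  interpret C: sigma_finite_measure "count_space \<Omega>"
    by (rule sigma_finite_measure_count_space_countable) simp
  interpret pair_sigma_finite "count_space \<Omega>" "lborel :: 'b measure" ..
  have int: "integrable lborel (\<lambda>x. ?F (p, x))" if "p \<in> \<Omega>" for p
    using f[OF that] by (simp add: set_integrable_def)
  have "integrable (count_space \<Omega> \<Otimes>\<^sub>M lborel) ?F"
  proof (rule Fubini_integrable)
    show "?F \<in> borel_measurable (count_space \<Omega> \<Otimes>\<^sub>M lborel)"
      by (rule measurable_pair_measure_countable1) (use int in auto)
    have "(\<integral>x. norm (?F (p, x)) \<partial>lborel) = (LBINT x:A. \<bar>f p x\<bar>)" for p
      unfolding set_lebesgue_integral_def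
      by (rule Bochner_Integration.integral_cong) (auto simp: abs_mult indicator_def)
    then show "integrable (count_space \<Omega>) (\<lambda>p. \<integral>x. norm (?F (p, x)) \<partial>lborel)"
      using abs by (simp only: infsum_eq_integral_count_space)
    show "AE p in count_space \<Omega>. integrable lborel (\<lambda>x. ?F (p, x))"
      using int by (simp add: AE_count_space)
  qed
  then have F: "integrable (count_space \<Omega> \<Otimes>\<^sub>M lborel) (\<lambda>(p, x). indicator A x * f p x)"
    by simp
  have eq: "(\<integral>p. indicator A x * f p x \<partial>count_space \<Omega>) = indicator A x *\<^sub>R (\<Sum>\<^sub>\<infinity>p\<in>\<Omega>. f p x)" for x
    by (simp add: infsum_eq_integral_count_space indicator_def)
  show "set_integrable lborel A (\<lambda>x. \<Sum>\<^sub>\<infinity>p\<in>\<Omega>. f p x)"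
    using integrable_snd[OF F] unfolding set_integrable_def eq .
  show "(LBINT x:A. \<Sum>\<^sub>\<infinity>p\<in>\<Omega>. f p x) = (\<Sum>\<^sub>\<infinity>p\<in>\<Omega>. LBINT x:A. f p x)"
    using Fubini_integral[OF F] unfolding set_lebesgue_integral_def eq
    by (simp add: infsum_eq_integral_count_space)
qed

text \<open>Monotone convergence along the triangles. It turns the \<open>ennreal\<close> condition
  of a solution into a uniform bound on finite sums of real integrals; it serves both to exploit
  that condition and to verify it for the constructed solution.\<close>

lemma nn_integral_infsum_Omega:
  fixes g :: "nat \<times> nat \<Rightarrow> real \<Rightarrow> real"
  assumes g: "\<And>p. p \<in> Omega \<Longrightarrow> set_integrable lborel A (g p)"
    and nn: "\<And>p x. p \<in> Omega \<Longrightarrow> x \<in> A \<Longrightarrow> 0 \<le> g p x"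
    and [measurable]: "A \<in> sets borel"
  shows "(\<integral>\<^sup>+x\<in>A. (\<Sum>\<^sub>\<infinity>p\<in>Omega. ennreal (g p x)) \<partial>lborel)
    = (SUP n. ennreal (\<Sum>p\<in>Omega_upto n. LBINT x:A. g p x))"
proof -
  let ?S = "\<lambda>n x. ennreal (indicator A x * (\<Sum>p\<in>Omega_upto n. g p x))"
  have nnO: "0 \<le> g p x" if "p \<in> Omega_upto n" "x \<in> A" for p x n
    using nn that Omega_upto_subset by blast
  have S: "?S n x = indicator A x * (\<Sum>p\<in>Omega_upto n. ennreal (g p x))" for n x
    using nnO by (auto simp: indicator_def sum_ennreal)
  have inc: "incseq (\<lambda>n. \<Sum>p\<in>Omega_upto n. h p)" for h :: "nat \<times> nat \<Rightarrow> ennreal"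
    by (intro monoI sum_mono2 Omega_upto_mono) auto
  have sup: "(\<Sum>\<^sub>\<infinity>p\<in>Omega. h p) = (SUP n. \<Sum>p\<in>Omega_upto n. h p)" for h :: "nat \<times> nat \<Rightarrow> ennreal"
    by (rule LIMSEQ_unique[OF sum_Omega_upto_tendsto[of h, OF nonneg_summable_on_complete] LIMSEQ_SUP[OF inc[of h]]])
      (rule zero_le)
  have int: "integrable lborel (\<lambda>x. indicator A x * g p x)" if "p \<in> Omega" for p
    using g[OF that] by (simp add: set_integrable_def)
  have int2: "integrable lborel (\<lambda>x. indicator A x * (\<Sum>p\<in>Omega_upto n. g p x))" for n
    unfolding sum_distrib_left
    by (intro Bochner_Integration.integrable_sum int) (use Omega_upto_subset in auto)
  have each: "(\<integral>\<^sup>+x. ?S n x \<partial>lborel) = ennreal (\<Sum>p\<in>Omega_upto n. LBINT x:A. g p x)" for n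
  proof -
    have "(\<integral>\<^sup>+x. ?S n x \<partial>lborel) = ennreal (\<integral>x. indicator A x * (\<Sum>p\<in>Omega_upto n. g p x) \<partial>lborel)"
      by (rule nn_integral_eq_integral[OF int2])
        (use nnO in \<open>auto intro!: AE_I2 sum_nonneg simp: indicator_def\<close>)
    also have "(\<integral>x. indicator A x * (\<Sum>p\<in>Omega_upto n. g p x) \<partial>lborel)
        = (\<Sum>p\<in>Omega_upto n. LBINT x:A. g p x)"
      unfolding sum_distrib_left set_lebesgue_integral_def real_scaleR_def
      by (intro Bochner_Integration.integral_sum int) (use Omega_upto_subset in auto)
    finally show ?thesis .
  qed
  have "(\<integral>\<^sup>+x\<in>A. (\<Sum>\<^sub>\<infinity>p\<in>Omega. ennreal (g p x)) \<partial>lborel) = (\<integral>\<^sup>+x. (SUP n. ?S n x) \<partial>lborel)"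
  proof (rule nn_integral_cong)
    fix x
    show "(\<Sum>\<^sub>\<infinity>p\<in>Omega. ennreal (g p x)) * indicator A x = (SUP n. ?S n x)"
    proof (cases "x \<in> A")
      case True
      have "(\<Sum>p\<in>Omega_upto n. ennreal (g p x)) = ennreal (\<Sum>p\<in>Omega_upto n. g p x)" for n
        by (rule sum_ennreal) (rule nnO[OF _ True])
      with True show ?thesis by (simp add: sup)
    qed simp
  qed
  also have "\<dots> = (SUP n. \<integral>\<^sup>+x. ?S n x \<partial>lborel)"
  proof (rule nn_integral_monotone_convergence_SUP)
    show "incseq ?S"
      unfolding S incseq_def le_fun_def using inc by (auto simp: incseq_def intro!: mult_left_mono)
    show "?S n \<in> borel_measurable lborel" for n
      using int2[of n] by auto
  qed
  finally show ?thesis unfolding each .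
qed

lemma Omega_upto_1: "Omega_upto 1 = {(1, 0), (0, 1)}"
proof (rule set_eqI)
  fix p :: "nat \<times> nat"
  obtain r s where p: "p = (r, s)" by fastforce
  have "1 \<le> r + s \<and> r + s \<le> 1 \<longleftrightarrow> r = 1 \<and> s = 0 \<or> r = 0 \<and> s = 1" by arith
  then show "p \<in> Omega_upto 1 \<longleftrightarrow> p \<in> {(1, 0), (0, 1)}"
    by (simp add: p)
qed

lemma
  fixes F :: "real \<Rightarrow> bd_seq"
  assumes F: "\<And>r s. 1 \<le> r + s \<Longrightarrow> set_integrable lborel A (\<lambda>\<tau>. F \<tau> r s)"
  shows set_integrable_Delta_r: "set_integrable lborel A (\<lambda>\<tau>. Delta_r (F \<tau>) r s)"
    and LBINT_Delta_r: "(LBINT \<tau>:A. Delta_r (F \<tau>) r s) = Delta_r (\<lambda>r s. LBINT \<tau>:A. F \<tau> r s) r s"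
    and set_integrable_Delta_s: "set_integrable lborel A (\<lambda>\<tau>. Delta_s (F \<tau>) r s)"
    and LBINT_Delta_s: "(LBINT \<tau>:A. Delta_s (F \<tau>) r s) = Delta_s (\<lambda>r s. LBINT \<tau>:A. F \<tau> r s) r s"
proof -
  have z: "set_integrable lborel A (\<lambda>\<tau>. zero_ext (F \<tau>) r s)"
    "(LBINT \<tau>:A. zero_ext (F \<tau>) r s) = zero_ext (\<lambda>r s. LBINT \<tau>:A. F \<tau> r s) r s" for r s
    using F[of r s]
    by (cases "1 \<le> r + s"; simp add: zero_ext_def set_integrable_def set_lebesgue_integral_def)+
  show "set_integrable lborel A (\<lambda>\<tau>. Delta_r (F \<tau>) r s)"
    "(LBINT \<tau>:A. Delta_r (F \<tau>) r s) = Delta_r (\<lambda>r s. LBINT \<tau>:A. F \<tau> r s) r s"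
    unfolding Delta_r_def by (cases "r = 0"; simp add: z)+
  show "set_integrable lborel A (\<lambda>\<tau>. Delta_s (F \<tau>) r s)"
    "(LBINT \<tau>:A. Delta_s (F \<tau>) r s) = Delta_s (\<lambda>r s. LBINT \<tau>:A. F \<tau> r s) r s"
    unfolding Delta_s_def by (cases "s = 0"; simp add: z)+
qed

section \<open>Elementary estimates in the positive cone\<close>

lemma Xplus_nonneg: "c \<in> bd_Xplus \<Longrightarrow> 1 \<le> r + s \<Longrightarrow> 0 \<le> c r s"
  by (auto simp: bd_Xplus_def)

lemma Xplus_summable:
  assumes c: "c \<in> bd_Xplus" and w: "\<And>r s. 1 \<le> r + s \<Longrightarrow> \<bar>w r s\<bar> \<le> K * real (r + s)"
  shows "(\<lambda>(r, s). w r s * c r s) summable_on Omega"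
proof (rule summable_on_bounded_by)
  show "(\<lambda>p. K * (\<lambda>(r, s). real (r + s) * \<bar>c r s\<bar>) p) summable_on Omega"
    using c by (intro summable_on_cmult_right) (simp add: bd_Xplus_def bd_X_def)
  fix p assume "p \<in> Omega"
  then obtain r s where p: "p = (r, s)" "1 \<le> r + s" by (cases p) auto
  show "\<bar>(\<lambda>(r, s). w r s * c r s) p\<bar> \<le> K * (\<lambda>(r, s). real (r + s) * \<bar>c r s\<bar>) p"
    using mult_right_mono[OF w[OF p(2)], of "\<bar>c r s\<bar>"] by (simp add: p abs_mult mult.assoc)
qed

lemma Xplus_norm:
  assumes "c \<in> bd_Xplus"
  shows "bd_norm c = (\<Sum>\<^sub>\<infinity>(r, s)\<in>Omega. real (r + s) * c r s)"
  unfolding bd_norm_def by (rule infsum_cong) (use assms in \<open>auto simp: Xplus_nonneg\<close>)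

lemma Xplus_finite_sum_le:
  assumes c: "c \<in> bd_Xplus" and F: "finite F" "F \<subseteq> Omega"
  shows "(\<Sum>(r, s)\<in>F. real (r + s) * c r s) \<le> bd_norm c"
  unfolding Xplus_norm[OF c]
  by (rule finite_sum_le_infsum[OF Xplus_summable[OF c, of _ 1] F])
    (auto simp: Xplus_nonneg[OF c])

lemma Xplus_le_norm:
  assumes c: "c \<in> bd_Xplus" and "1 \<le> r + s"
  shows "c r s \<le> bd_norm c"
proof -
  have "1 * c r s \<le> real (r + s) * c r s"
    by (rule mult_right_mono) (use Xplus_nonneg[OF assms] assms in auto)
  also have "\<dots> \<le> bd_norm c"
    using Xplus_finite_sum_le[OF c, of "{(r, s)}"] assms by auto
  finally show ?thesis by simp
qed

section \<open>Integrated fluxes and the balance of masses\<close>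

locale bd_coefficients =
  fixes a adot b bdot :: bd_seq and C :: real
  assumes a_nonneg: "1 \<le> r + s \<Longrightarrow> 0 \<le> a r s"
    and adot_nonneg: "1 \<le> r + s \<Longrightarrow> 0 \<le> adot r s"
    and b_nonneg: "1 \<le> r + s \<Longrightarrow> 0 \<le> b (r + 1) s"
    and bdot_nonneg: "1 \<le> r + s \<Longrightarrow> 0 \<le> bdot r (s + 1)"
    and growth: "1 \<le> r + s \<Longrightarrow> a r s + adot r s \<le> C * real (r + s)"
begin

lemma C_nonneg: "0 \<le> C"
  using growth[of 1 0] a_nonneg[of 1 0] adot_nonneg[of 1 0] by simp

text \<open>The integrand of the finiteness condition of a solution. The growth terms lack their
  monomer factor; since that factor is bounded, the gross rate still dominates both fluxes.\<close>

definition gross_rate :: "bd_seq \<Rightarrow> bd_seq" where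
  "gross_rate c r s = (a r s + adot r s) * c r s + b (r + 1) s * c (r + 1) s
    + bdot r (s + 1) * c r (s + 1)"

text \<open>The infinite sum counts the monomer as the attached particle, the two separate fluxes
  count it as the cluster that grows.\<close>

definition loss10 :: "bd_seq \<Rightarrow> real" where
  "loss10 c = flux a b c 1 0 + fluxdot adot bdot c 1 0 + (\<Sum>\<^sub>\<infinity>(r, s)\<in>Omega. flux a b c r s)"

definition loss01 :: "bd_seq \<Rightarrow> real" where
  "loss01 c = flux a b c 0 1 + fluxdot adot bdot c 0 1 + (\<Sum>\<^sub>\<infinity>(r, s)\<in>Omega. fluxdot adot bdot c r s)"

end

text \<open>The monomer equations are left out: they are equivalent to conservation of mass.\<close>

locale bd_cluster_solution = bd_coefficients +
  fixes c0 :: bd_seq and c :: "real \<Rightarrow> bd_seq" and T M :: real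
  assumes T_nonneg: "0 \<le> T"
    and c0_Xplus: "c0 \<in> bd_Xplus"
    and c_Xplus: "t \<in> {0..T} \<Longrightarrow> c t \<in> bd_Xplus" and c_norm: "t \<in> {0..T} \<Longrightarrow> bd_norm (c t) \<le> M"
    and c_cont: "1 \<le> r + s \<Longrightarrow> continuous_on {0..T} (\<lambda>t. c t r s)"
    and rate_finite: "(\<integral>\<^sup>+\<tau>\<in>{0..T}. (\<Sum>\<^sub>\<infinity>(r, s)\<in>Omega. ennreal (gross_rate (c \<tau>) r s)) \<partial>lborel) < \<infinity>"
    and cluster_eq: "t \<in> {0..T} \<Longrightarrow> 2 \<le> r + s \<Longrightarrow> c t r s = c0 r s - (LBINT \<tau>:{0..t}.
            Delta_r (flux a b (c \<tau>)) r s + Delta_s (fluxdot adot bdot (c \<tau>)) r s)"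
begin

lemma c_nonneg: "t \<in> {0..T} \<Longrightarrow> 1 \<le> r + s \<Longrightarrow> 0 \<le> c t r s"
  using c_Xplus Xplus_nonneg by blast

lemma c_le: "t \<in> {0..T} \<Longrightarrow> 1 \<le> r + s \<Longrightarrow> c t r s \<le> M"
  using Xplus_le_norm[OF c_Xplus] c_norm by (meson order_trans)

lemma M_nonneg: "0 \<le> M"
  using c_nonneg[of 0 1 0] c_le[of 0 1 0] T_nonneg by auto

lemma flux_cont:
  assumes "1 \<le> r + s"
  shows "continuous_on {0..T} (\<lambda>t. flux a b (c t) r s)"
    and "continuous_on {0..T} (\<lambda>t. fluxdot adot bdot (c t) r s)"
  using assms unfolding flux_def fluxdot_def by (auto intro!: continuous_intros c_cont)

lemma gross_rate_cont:
  assumes "1 \<le> r + s"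
  shows "continuous_on {0..T} (\<lambda>t. gross_rate (c t) r s)"
  using assms unfolding gross_rate_def by (auto intro!: continuous_intros c_cont)

lemma gross_rate_nonneg:
  assumes "1 \<le> r + s" "t \<in> {0..T}"
  shows "0 \<le> gross_rate (c t) r s"
  unfolding gross_rate_def using assms
  by (intro add_nonneg_nonneg mult_nonneg_nonneg c_nonneg a_nonneg adot_nonneg b_nonneg bdot_nonneg) auto

lemma gross_rate_summable:
  assumes t: "t \<in> {0..T}"
  shows "(\<lambda>(r, s). LBINT \<tau>:{0..t}. gross_rate (c \<tau>) r s) summable_on Omega"
proof -
  let ?g = "\<lambda>p \<tau>. case p of (r, s) \<Rightarrow> gross_rate (c \<tau>) r s"
  have tt: "{0..t} \<subseteq> {0..T}" using t by auto
  let ?K = "\<integral>\<^sup>+\<tau>\<in>{0..T}. (\<Sum>\<^sub>\<infinity>p\<in>Omega. ennreal (?g p \<tau>)) \<partial>lborel"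
  have fin: "?K < \<infinity>" using rate_finite by (simp add: split_def)
  have "(SUP n. ennreal (\<Sum>p\<in>Omega_upto n. LBINT x:{0..t}. ?g p x))
      = (\<integral>\<^sup>+\<tau>\<in>{0..t}. (\<Sum>\<^sub>\<infinity>p\<in>Omega. ennreal (?g p \<tau>)) \<partial>lborel)"
    by (rule nn_integral_infsum_Omega[symmetric])
      (use t tt in \<open>auto intro!: cont_set_integrable gross_rate_cont gross_rate_nonneg\<close>)
  also have "\<dots> \<le> ?K"
    by (intro nn_integral_mono mult_left_mono)
      (use tt in \<open>auto simp: indicator_def\<close>)
  finally have le: "ennreal (\<Sum>p\<in>Omega_upto n. LBINT x:{0..t}. ?g p x) \<le> ?K" for n
    by (simp add: SUP_le_iff)
  have "(\<Sum>p\<in>Omega_upto n. LBINT x:{0..t}. ?g p x) \<le> enn2real ?K" for n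
  proof -
    have "?K = ennreal (enn2real ?K)" using fin by simp
    then have "ennreal (\<Sum>p\<in>Omega_upto n. LBINT x:{0..t}. ?g p x) \<le> ennreal (enn2real ?K)"
      using le[of n] by simp
    then show ?thesis using ennreal_le_iff[OF enn2real_nonneg] by blast
  qed
  then have "(\<lambda>p. LBINT x:{0..t}. ?g p x) summable_on Omega"
    by (intro summable_onI_Omega_upto)
      (use tt in \<open>auto intro!: LBINT_nonneg gross_rate_nonneg\<close>)
  then show ?thesis by (simp add: split_def)
qed

text \<open>The growth part carries a monomer concentration, which is at most \<open>M\<close>, the
  fragmentation part carries the factor 1.\<close>

lemma flux_abs_le:
  assumes t: "t \<in> {0..T}" and rs: "1 \<le> r + s"
  shows "\<bar>flux a b (c t) r s\<bar> \<le> (M + 1) * gross_rate (c t) r s"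
    and "\<bar>fluxdot adot bdot (c t) r s\<bar> \<le> (M + 1) * gross_rate (c t) r s"
proof -
  have nn: "0 \<le> a r s * c t r s" "0 \<le> adot r s * c t r s"
    "0 \<le> b (r + 1) s * c t (r + 1) s" "0 \<le> bdot r (s + 1) * c t r (s + 1)"
    using t rs by (auto intro!: mult_nonneg_nonneg c_nonneg a_nonneg adot_nonneg
        b_nonneg[simplified] bdot_nonneg[simplified])
  have "c t 1 0 * (a r s * c t r s) \<le> M * (a r s * c t r s)" "0 \<le> c t 1 0 * (a r s * c t r s)"
    "c t 0 1 * (adot r s * c t r s) \<le> M * (adot r s * c t r s)" "0 \<le> c t 0 1 * (adot r s * c t r s)"
    using nn c_le[OF t, of 1 0] c_le[OF t, of 0 1] c_nonneg[OF t, of 1 0] c_nonneg[OF t, of 0 1]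
    by (auto intro!: mult_right_mono mult_nonneg_nonneg)
  moreover have "0 \<le> M * (a r s * c t r s)" "0 \<le> M * (adot r s * c t r s)"
    "0 \<le> M * (b (r + 1) s * c t (r + 1) s)" "0 \<le> M * (bdot r (s + 1) * c t r (s + 1))"
    using nn M_nonneg by (auto intro: mult_nonneg_nonneg)
  ultimately show "\<bar>flux a b (c t) r s\<bar> \<le> (M + 1) * gross_rate (c t) r s"
    and "\<bar>fluxdot adot bdot (c t) r s\<bar> \<le> (M + 1) * gross_rate (c t) r s"
    using nn unfolding flux_def fluxdot_def gross_rate_def
    by (simp_all add: algebra_simps abs_le_iff)
qed

text \<open>Summability of the fluxes themselves is available only at almost every time, whereas
  their time integrals are summable for every \<open>t\<close>. The weak form is therefore applied
  to these integrals.\<close>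

definition "Jint t r s = (LBINT \<tau>:{0..t}. flux a b (c \<tau>) r s)"
definition "Jdint t r s = (LBINT \<tau>:{0..t}. fluxdot adot bdot (c \<tau>) r s)"

text \<open>Domination by the gross rate passes its integrated summability on to \<open>h\<close>.
  It is applied to both fluxes, whose infinite sums in the monomer equations can then be integrated
  termwise.\<close>

lemma
  assumes t: "t \<in> {0..T}" and h: "\<And>r s. 1 \<le> r + s \<Longrightarrow> continuous_on {0..T} (h r s)"
    and le: "\<And>r s \<tau>. 1 \<le> r + s \<Longrightarrow> \<tau> \<in> {0..T} \<Longrightarrow> \<bar>h r s \<tau>\<bar> \<le> (M + 1) * gross_rate (c \<tau>) r s"
  shows rate_dominated_summable: "(\<lambda>(r, s). LBINT \<tau>:{0..t}. h r s \<tau>) summable_on Omega"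
    and rate_dominated_integrable: "set_integrable lborel {0..t} (\<lambda>\<tau>. \<Sum>\<^sub>\<infinity>(r, s)\<in>Omega. h r s \<tau>)"
    and rate_dominated_swap: "(LBINT \<tau>:{0..t}. \<Sum>\<^sub>\<infinity>(r, s)\<in>Omega. h r s \<tau>)
      = (\<Sum>\<^sub>\<infinity>(r, s)\<in>Omega. LBINT \<tau>:{0..t}. h r s \<tau>)"
proof -
  have tt: "{0..t} \<subseteq> {0..T}" using t by auto
  let ?h = "\<lambda>p \<tau>. case p of (r, s) \<Rightarrow> h r s \<tau>"
  have int: "set_integrable lborel {0..t} (?h p)" if "p \<in> Omega" for p
    using that by (cases p) (auto intro!: cont_set_integrable t h)
  have sm: "(\<lambda>p. LBINT \<tau>:{0..t}. \<bar>?h p \<tau>\<bar>) summable_on Omega"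
  proof (rule summable_on_bounded_by)
    show "(\<lambda>p. (M + 1) * (\<lambda>(r, s). LBINT \<tau>:{0..t}. gross_rate (c \<tau>) r s) p) summable_on Omega"
      by (intro summable_on_cmult_right gross_rate_summable t)
    fix p assume "p \<in> Omega"
    then obtain r s where p: "p = (r, s)" "1 \<le> r + s" by (cases p) auto
    have "(LBINT \<tau>:{0..t}. \<bar>h r s \<tau>\<bar>) \<le> (LBINT \<tau>:{0..t}. (M + 1) * gross_rate (c \<tau>) r s)"
      by (rule set_integral_mono)
        (use tt p le in \<open>auto intro!: cont_set_integrable t continuous_intros h gross_rate_cont\<close>)
    then show "\<bar>LBINT \<tau>:{0..t}. \<bar>?h p \<tau>\<bar>\<bar>
        \<le> (M + 1) * (\<lambda>(r, s). LBINT \<tau>:{0..t}. gross_rate (c \<tau>) r s) p"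
      by (subst abs_of_nonneg) (auto simp: p intro!: LBINT_nonneg)
  qed
  have "(\<lambda>p. LBINT \<tau>:{0..t}. ?h p \<tau>) summable_on Omega"
  proof (rule summable_on_bounded_by[OF sm])
    fix p assume "p \<in> Omega"
    then show "\<bar>LBINT \<tau>:{0..t}. ?h p \<tau>\<bar> \<le> (LBINT \<tau>:{0..t}. \<bar>?h p \<tau>\<bar>)"
      using set_integral_norm_bound[OF int] by simp
  qed
  then show "(\<lambda>(r, s). LBINT \<tau>:{0..t}. h r s \<tau>) summable_on Omega"
    by (simp add: split_def)
  show "set_integrable lborel {0..t} (\<lambda>\<tau>. \<Sum>\<^sub>\<infinity>(r, s)\<in>Omega. h r s \<tau>)"
    using infsum_set_integral_swap(1)[of Omega "{0..t}" ?h, OF int sm] by (simp add: split_def)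
  show "(LBINT \<tau>:{0..t}. \<Sum>\<^sub>\<infinity>(r, s)\<in>Omega. h r s \<tau>)
      = (\<Sum>\<^sub>\<infinity>(r, s)\<in>Omega. LBINT \<tau>:{0..t}. h r s \<tau>)"
    using infsum_set_integral_swap(2)[of Omega "{0..t}" ?h, OF int sm] by (simp add: split_def)
qed

lemmas Jint_summable = rate_dominated_summable[OF _ flux_cont(1) flux_abs_le(1), folded Jint_def]
lemmas Jdint_summable = rate_dominated_summable[OF _ flux_cont(2) flux_abs_le(2), folded Jdint_def]

lemma cluster_eq_int:
  assumes t: "t \<in> {0..T}" and rs: "2 \<le> r + s"
  shows "c t r s - c0 r s = - (Delta_r (Jint t) r s + Delta_s (Jdint t) r s)"
proof -
  note i = LBINT_Delta_r LBINT_Delta_s set_integrable_Delta_r set_integrable_Delta_s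
  note i' = i(1,3)[where F = "\<lambda>\<tau>. flux a b (c \<tau>)", OF cont_set_integrable[OF t flux_cont(1)]]
    i(2,4)[where F = "\<lambda>\<tau>. fluxdot adot bdot (c \<tau>)", OF cont_set_integrable[OF t flux_cont(2)]]
  show ?thesis
    using set_integral_add(2)[OF i'(2,4)] unfolding cluster_eq[OF t rs]
    by (simp add: i'(1,3) Jint_def[abs_def] Jdint_def[abs_def])
qed

lemma loss_int:
  assumes t: "t \<in> {0..T}"
  shows "(LBINT \<tau>:{0..t}. loss10 (c \<tau>)) = Jint t 1 0 + Jdint t 1 0 + (\<Sum>\<^sub>\<infinity>(r, s)\<in>Omega. Jint t r s)"
    and "(LBINT \<tau>:{0..t}. loss01 (c \<tau>)) = Jint t 0 1 + Jdint t 0 1 + (\<Sum>\<^sub>\<infinity>(r, s)\<in>Omega. Jdint t r s)"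
proof -
  note i = cont_set_integrable[OF t flux_cont(1)] cont_set_integrable[OF t flux_cont(2)]
    rate_dominated_integrable[OF t flux_cont(1) flux_abs_le(1)]
    rate_dominated_integrable[OF t flux_cont(2) flux_abs_le(2)]
  note s = rate_dominated_swap[OF t flux_cont(1) flux_abs_le(1)]
    rate_dominated_swap[OF t flux_cont(2) flux_abs_le(2)]
  show "(LBINT \<tau>:{0..t}. loss10 (c \<tau>)) = Jint t 1 0 + Jdint t 1 0 + (\<Sum>\<^sub>\<infinity>(r, s)\<in>Omega. Jint t r s)"
    and "(LBINT \<tau>:{0..t}. loss01 (c \<tau>)) = Jint t 0 1 + Jdint t 0 1 + (\<Sum>\<^sub>\<infinity>(r, s)\<in>Omega. Jdint t r s)"
    unfolding loss10_def loss01_def Jint_def Jdint_def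
    using i(1)[of 1 0] i(1)[of 0 1] i(2)[of 1 0] i(2)[of 0 1] i(3,4) s
    by (simp_all add: set_integral_add)
qed

lemma weight_summable:
  assumes "t \<in> {0..T}" and w: "\<And>r s. 1 \<le> r + s \<Longrightarrow> \<bar>w r s\<bar> \<le> K * real (r + s)"
  shows "(\<lambda>(r, s). w r s * (c t r s - c0 r s)) summable_on Omega"
    and "(\<Sum>\<^sub>\<infinity>(r, s)\<in>Omega. w r s * (c t r s - c0 r s))
      = (\<Sum>\<^sub>\<infinity>(r, s)\<in>Omega. w r s * c t r s) - (\<Sum>\<^sub>\<infinity>(r, s)\<in>Omega. w r s * c0 r s)"
proof -
  note s = Xplus_summable[OF c_Xplus[OF assms(1)], of w K, OF w] Xplus_summable[OF c0_Xplus, of w K, OF w]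
  have eq: "(\<lambda>(r, s). w r s * (c t r s - c0 r s))
      = (\<lambda>p. (\<lambda>(r, s). w r s * c t r s) p - (\<lambda>(r, s). w r s * c0 r s) p)"
    by (auto simp: algebra_simps)
  show "(\<lambda>(r, s). w r s * (c t r s - c0 r s)) summable_on Omega"
    unfolding eq by (intro summable_on_diff(1) s)
  show "(\<Sum>\<^sub>\<infinity>(r, s)\<in>Omega. w r s * (c t r s - c0 r s))
      = (\<Sum>\<^sub>\<infinity>(r, s)\<in>Omega. w r s * c t r s) - (\<Sum>\<^sub>\<infinity>(r, s)\<in>Omega. w r s * c0 r s)"
    unfolding eq by (intro summable_on_diff(2) s)
qed

text \<open>A linear weight has constant increments, so testing leaves just the total fluxes, and
  these are the infinite sums in \<open>loss10\<close> and \<open>loss01\<close>. The brackets are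
  the defects of the two monomer equations. With (1, 0) and (0, 1) for the coefficients the formula
  is read in both directions: from the equations to the masses for a given solution, from the masses
  to the equations for the constructed one.\<close>

lemma mass_balance:
  assumes t: "t \<in> {0..T}" and nn: "0 \<le> \<alpha>" "0 \<le> \<beta>"
  shows "(\<Sum>\<^sub>\<infinity>(r, s)\<in>Omega. (\<alpha> * real r + \<beta> * real s) * c t r s)
    = (\<Sum>\<^sub>\<infinity>(r, s)\<in>Omega. (\<alpha> * real r + \<beta> * real s) * c0 r s)
      + \<alpha> * (c t 1 0 - c0 1 0 + (LBINT \<tau>:{0..t}. loss10 (c \<tau>)))
      + \<beta> * (c t 0 1 - c0 0 1 + (LBINT \<tau>:{0..t}. loss01 (c \<tau>)))"
proof -
  define l where "l r s = \<alpha> * real r + \<beta> * real s" for r s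
  \<comment> \<open>Test weights must vanish on monomers, so \<open>l\<close> is split into
    \<open>w\<close> and its monomer part \<open>m\<close>. Cutting off the monomers enlarges the
    increment of \<open>w\<close> at size 1 by \<open>m\<close>, and this produces the separate
    monomer fluxes in \<open>loss10\<close> and \<open>loss01\<close>.\<close>
  define m where "m r s = (if r + s = 1 then l r s else 0)" for r s
  define w where "w r s = (if r + s \<le> 1 then 0 else l r s)" for r s
  define v where "v r s = c t r s - c0 r s" for r s
  have l_le: "\<bar>l r s\<bar> \<le> (\<alpha> + \<beta>) * real (r + s)" for r s
    using nn by (simp add: l_def algebra_simps)
  have w_le: "\<bar>w r s\<bar> \<le> (\<alpha> + \<beta>) * real (r + s)" for r s
    using l_le[of r s] nn by (auto simp: w_def)
  have wr: "w (r + 1) s - w r s = \<alpha> + m r s" if "1 \<le> r + s" for r s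
    using that by (auto simp: w_def m_def l_def algebra_simps)
  have ws: "w r (s + 1) - w r s = \<beta> + m r s" if "1 \<le> r + s" for r s
    using that by (auto simp: w_def m_def l_def algebra_simps)
  have m_le: "\<bar>m r s\<bar> \<le> \<alpha> + \<beta>" for r s
    using l_le[of r s] nn by (auto simp: m_def simp del: of_nat_add)
  have "(\<Sum>\<^sub>\<infinity>(r, s)\<in>Omega. w r s * v r s)
    = (\<Sum>\<^sub>\<infinity>(r, s)\<in>Omega. Jint t r s * (w (r + 1) s - w r s) + Jdint t r s * (w r (s + 1) - w r s))"
  proof (rule infsum_weight_eq(2))
    \<comment> \<open>An increment is at most one coefficient plus the value of \<open>m\<close>,
      which is at most \<open>\<alpha> + \<beta>\<close>. The summand 1 keeps the bound positive if
      both coefficients are 0.\<close>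
    show "0 < 2 * \<alpha> + 2 * \<beta> + 1" using nn by simp
    show "v r s = - (Delta_r (Jint t) r s + Delta_s (Jdint t) r s)" if "2 \<le> r + s" for r s
      unfolding v_def using cluster_eq_int[OF t that] .
    show "\<bar>w (r + 1) s - w r s\<bar> \<le> 2 * \<alpha> + 2 * \<beta> + 1" "\<bar>w r (s + 1) - w r s\<bar> \<le> 2 * \<alpha> + 2 * \<beta> + 1"
      if "1 \<le> r + s" for r s
      using wr[OF that] ws[OF that] m_le[of r s] nn by linarith+
    show "(\<lambda>(r, s). w r s * v r s) summable_on Omega"
      unfolding v_def by (rule weight_summable(1)[OF t w_le])
    show "0 \<le> w r s" for r s using nn by (simp add: w_def l_def)
  qed (use Jint_summable[OF t] Jdint_summable[OF t] in \<open>auto simp: w_def\<close>)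
  also have "\<dots> = (\<Sum>\<^sub>\<infinity>p\<in>Omega. (\<alpha> * (\<lambda>(r, s). Jint t r s) p + \<beta> * (\<lambda>(r, s). Jdint t r s) p)
      + (\<lambda>(r, s). m r s * (Jint t r s + Jdint t r s)) p)"
    by (rule infsum_cong) (use wr ws in \<open>auto simp: algebra_simps\<close>)
  also have "\<dots> = \<alpha> * (\<Sum>\<^sub>\<infinity>(r, s)\<in>Omega. Jint t r s) + \<beta> * (\<Sum>\<^sub>\<infinity>(r, s)\<in>Omega. Jdint t r s)
      + (\<Sum>\<^sub>\<infinity>(r, s)\<in>Omega. m r s * (Jint t r s + Jdint t r s))"
  proof -
    have ms: "(\<lambda>(r, s). m r s * (Jint t r s + Jdint t r s)) summable_on Omega"
      by (rule finite_nonzero_values_imp_summable_on, rule finite_subset[of _ "Omega_upto 1"])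
        (auto simp: m_def split: if_splits)
    note a = summable_on_cmult_right[OF Jint_summable[OF t], of \<alpha>]
      summable_on_cmult_right[OF Jdint_summable[OF t], of \<beta>]
    show ?thesis
      using infsum_add[OF summable_on_add[OF a] ms] infsum_add[OF a]
        infsum_cmult_right[OF Jint_summable[OF t], of \<alpha>]
        infsum_cmult_right[OF Jdint_summable[OF t], of \<beta>]
      by simp
  qed
  also have "(\<Sum>\<^sub>\<infinity>(r, s)\<in>Omega. m r s * (Jint t r s + Jdint t r s))
      = \<alpha> * (Jint t 1 0 + Jdint t 1 0) + \<beta> * (Jint t 0 1 + Jdint t 0 1)"
    by (subst infsum_eq_sum_Omega_upto[of 1]) (simp_all add: m_def Omega_upto_1[simplified] l_def)
  also have "(\<Sum>\<^sub>\<infinity>(r, s)\<in>Omega. w r s * v r s)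
      = (\<Sum>\<^sub>\<infinity>p\<in>Omega. (\<lambda>(r, s). l r s * v r s) p - (\<lambda>(r, s). m r s * v r s) p)"
    by (rule infsum_cong) (auto simp: w_def m_def l_def algebra_simps)
  also have "\<dots> = (\<Sum>\<^sub>\<infinity>(r, s)\<in>Omega. l r s * v r s) - (\<Sum>\<^sub>\<infinity>(r, s)\<in>Omega. m r s * v r s)"
  proof (rule summable_on_diff(2))
    show "(\<lambda>(r, s). l r s * v r s) summable_on Omega"
      unfolding v_def by (rule weight_summable(1)[OF t l_le])
    show "(\<lambda>(r, s). m r s * v r s) summable_on Omega"
      by (rule finite_nonzero_values_imp_summable_on, rule finite_subset[of _ "Omega_upto 1"])
        (auto simp: m_def split: if_splits)
  qed
  also have "(\<Sum>\<^sub>\<infinity>(r, s)\<in>Omega. m r s * v r s) = \<alpha> * v 1 0 + \<beta> * v 0 1"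
    by (subst infsum_eq_sum_Omega_upto[of 1]) (simp_all add: m_def Omega_upto_1[simplified] l_def)
  also have "(\<Sum>\<^sub>\<infinity>(r, s)\<in>Omega. l r s * v r s)
      = (\<Sum>\<^sub>\<infinity>(r, s)\<in>Omega. l r s * c t r s) - (\<Sum>\<^sub>\<infinity>(r, s)\<in>Omega. l r s * c0 r s)"
    unfolding v_def by (rule weight_summable(2)[OF t l_le])
  finally show ?thesis
    using loss_int[OF t] by (simp add: l_def v_def algebra_simps)
qed

end

subsection \<open>Gronwall estimates and the second moment\<close>

lemma LBINT_eq_integral:
  fixes f :: "real \<Rightarrow> real"
  assumes "continuous_on {0..t} f"
  shows "(LBINT x:{0..t}. f x) = integral {0..t} f"
  by (rule set_borel_integral_eq_integral(2)[OF borel_integrable_atLeastAtMost'[OF assms]])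

lemma LBINT_sum:
  fixes f :: "'i \<Rightarrow> 'a :: euclidean_space \<Rightarrow> real"
  assumes "\<And>i. i \<in> I \<Longrightarrow> set_integrable lborel A (f i)"
  shows "(LBINT x:A. \<Sum>i\<in>I. f i x) = (\<Sum>i\<in>I. LBINT x:A. f i x)"
  using assms unfolding set_lebesgue_integral_def set_integrable_def scaleR_sum_right
  by (intro Bochner_Integration.integral_sum) auto

lemma infsum_le_Omega_upto:
  fixes f :: "nat \<times> nat \<Rightarrow> real"
  assumes "f summable_on Omega" "\<And>n. sum f (Omega_upto n) \<le> K"
  shows "infsum f Omega \<le> K"
  by (rule LIMSEQ_le_const2[OF sum_Omega_upto_tendsto[OF assms(1)]]) (use assms(2) in auto)

text \<open>Comparing \<open>Y\<close> with \<open>S exp (2 K t)\<close> for the least admissible \<open>S\<close> makes measurability of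
  \<open>Y\<close> superfluous.\<close>

lemma gronwall_bounded:
  fixes Y :: "real \<Rightarrow> real"
  assumes K: "0 < K" and Y: "\<And>t. t \<in> {0..T} \<Longrightarrow> 0 \<le> Y t" "\<And>t. t \<in> {0..T} \<Longrightarrow> Y t \<le> B"
    and step: "\<And>t S. t \<in> {0..T} \<Longrightarrow> 0 \<le> S \<Longrightarrow> (\<And>\<tau>. \<tau> \<in> {0..t} \<Longrightarrow> Y \<tau> \<le> S * exp (2 * K * \<tau>))
      \<Longrightarrow> Y t \<le> A + K * (LBINT \<tau>:{0..t}. S * exp (2 * K * \<tau>))"
    and A: "0 \<le> A" and t: "t \<in> {0..T}"
  shows "Y t \<le> 2 * A * exp (2 * K * t)"
proof -
  define S where "S = (SUP t\<in>{0..T}. Y t * exp (- (2 * K * t)))"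
  have bdd: "bdd_above ((\<lambda>t. Y t * exp (- (2 * K * t))) ` {0..T})"
  proof (rule bdd_aboveI2)
    fix t assume t: "t \<in> {0..T}"
    have "Y t * exp (- (2 * K * t)) \<le> Y t * 1"
      by (rule mult_left_mono) (use Y t K in auto)
    then show "Y t * exp (- (2 * K * t)) \<le> B" using Y(2)[OF t] by simp
  qed
  have le: "Y t * exp (- (2 * K * t)) \<le> S" if "t \<in> {0..T}" for t
    unfolding S_def by (rule cSUP_upper[OF that bdd])
  have S0: "0 \<le> S"
    using le[OF t] Y(1)[OF t] by (meson exp_ge_zero mult_nonneg_nonneg order_trans)
  have le': "Y t \<le> S * exp (2 * K * t)" if "t \<in> {0..T}" for t
    using le[OF that] by (simp add: exp_minus field_simps)
  have int: "(LBINT \<tau>:{0..t}. S * exp (2 * K * \<tau>)) = S * (exp (2 * K * t) - 1) / (2 * K)"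
    if "t \<in> {0..T}" for t
  proof -
    have "((\<lambda>\<tau>. S * exp (2 * K * \<tau>)) has_integral
        S * exp (2 * K * t) / (2 * K) - S * exp (2 * K * 0) / (2 * K)) {0..t}"
    proof (rule fundamental_theorem_of_calculus)
      fix x assume "x \<in> {0..t}"
      show "((\<lambda>t. S * exp (2 * K * t) / (2 * K)) has_vector_derivative S * exp (2 * K * x)) (at x within {0..t})"
        unfolding has_real_derivative_iff_has_vector_derivative[symmetric]
        using K by (auto intro!: derivative_eq_intros)
    qed (use that in auto)
    then have "integral {0..t} (\<lambda>\<tau>. S * exp (2 * K * \<tau>))
        = S * exp (2 * K * t) / (2 * K) - S * exp (2 * K * 0) / (2 * K)"
      by (rule integral_unique)
    moreover have "(LBINT \<tau>:{0..t}. S * exp (2 * K * \<tau>)) = integral {0..t} (\<lambda>\<tau>. S * exp (2 * K * \<tau>))"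
      by (intro LBINT_eq_integral continuous_intros)
    ultimately show ?thesis by (simp add: diff_divide_distrib right_diff_distrib)
  qed
  \<comment> \<open>The exponent is twice the constant \<open>K\<close> of the integral inequality,
    so integration returns only half of \<open>S\<close>, which can be absorbed because the supremum
    \<open>S\<close> is finite.\<close>
  have "S \<le> A + S / 2"
    unfolding S_def
  proof (rule cSUP_least, use t in force)
    fix t assume t: "t \<in> {0..T}"
    have "Y t \<le> A + K * (LBINT \<tau>:{0..t}. S * exp (2 * K * \<tau>))"
      by (rule step[OF t S0]) (use t le' in auto)
    also have "\<dots> = A + S / 2 * (exp (2 * K * t) - 1)"
      unfolding int[OF t] using K by simp
    also have "\<dots> \<le> A * exp (2 * K * t) + S / 2 * exp (2 * K * t)"
      using t K A S0 mult_left_mono[of 1 "exp (2 * K * t)" A] by (auto simp: algebra_simps)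
    finally have "Y t \<le> (A + S / 2) * exp (2 * K * t)" by (simp add: algebra_simps)
    then show "Y t * exp (- (2 * K * t)) \<le> A + (SUP t\<in>{0..T}. Y t * exp (- (2 * K * t))) / 2"
      unfolding S_def[symmetric] by (simp add: exp_minus field_simps)
  qed
  then have "S \<le> 2 * A" by simp
  then have "S * exp (2 * K * t) \<le> 2 * A * exp (2 * K * t)" by simp
  with le'[OF t] show ?thesis by linarith
qed

text \<open>Differentiating \<open>sqrt (e\<^sup>2 + \<epsilon>\<^sup>2)\<close> keeps the sign of the loss term \<open>- L e\<close>.\<close>

lemma abs_le_integral_loss_gain:
  fixes e L g :: "real \<Rightarrow> real"
  assumes cont: "continuous_on {0..T} e" "continuous_on {0..T} L" "continuous_on {0..T} g"
    and L: "\<And>t. t \<in> {0..T} \<Longrightarrow> 0 \<le> L t"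
    and e: "\<And>t. t \<in> {0..T} \<Longrightarrow> e t = (LBINT \<tau>:{0..t}. - L \<tau> * e \<tau> + g \<tau>)"
    and t: "t \<in> {0..T}"
  shows "\<bar>e t\<bar> \<le> (LBINT \<tau>:{0..t}. - L \<tau> * \<bar>e \<tau>\<bar> + \<bar>g \<tau>\<bar>)"
proof -
  define F where "F \<tau> = - L \<tau> * e \<tau> + g \<tau>" for \<tau>
  have contF: "continuous_on {0..T} F"
    unfolding F_def by (intro continuous_intros cont)
  have sub: "{0..t} \<subseteq> {0..T}" if "t \<in> {0..T}" for t :: real using that by auto
  note cont' = cont[THEN continuous_on_subset, OF sub[OF t]]
  have e': "e t = integral {0..t} F" if "t \<in> {0..T}" for t
    unfolding e[OF that] F_def[symmetric]
    by (rule LBINT_eq_integral[OF continuous_on_subset[OF contF sub[OF that]]])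
  have de: "(e has_real_derivative F x) (at x within {0..t})" if x: "x \<in> {0..t}" for x
  proof -
    have "((\<lambda>u. integral {0..u} F) has_real_derivative F x) (at x within {0..t})"
      by (rule integral_has_real_derivative[OF continuous_on_subset[OF contF sub[OF t]] x])
    then show ?thesis
      by (rule has_field_derivative_transform_within[where d = 1]) (use x t e' in auto)
  qed
  define R where "R \<tau> = - L \<tau> * \<bar>e \<tau>\<bar> + \<bar>g \<tau>\<bar>" for \<tau>
  have contR: "continuous_on {0..t} R"
    unfolding R_def by (intro continuous_intros cont')
  have main: "\<bar>e t\<bar> \<le> integral {0..t} R + \<epsilon> * (1 + integral {0..t} L)" if \<epsilon>: "0 < \<epsilon>" for \<epsilon>
  proof -
    define \<eta> where "\<eta> x = sqrt ((e x)\<^sup>2 + \<epsilon>\<^sup>2)" for x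
    have \<eta>: "0 < \<eta> x" "\<bar>e x\<bar> \<le> \<eta> x" "\<eta> x \<le> \<bar>e x\<bar> + \<epsilon>" for x
    proof -
      show "0 < \<eta> x" using \<epsilon> by (auto simp: \<eta>_def intro!: add_nonneg_pos)
      show "\<bar>e x\<bar> \<le> \<eta> x" unfolding \<eta>_def by (rule real_le_rsqrt) simp
      show "\<eta> x \<le> \<bar>e x\<bar> + \<epsilon>" unfolding \<eta>_def
        by (rule real_le_lsqrt) (use \<epsilon> in \<open>auto simp: power2_sum\<close>)
    qed
    have d\<eta>: "(\<eta> has_real_derivative e x * F x / \<eta> x) (at x within {0..t})" if x: "x \<in> {0..t}" for x
    proof -
      have "0 < (e x)\<^sup>2 + \<epsilon>\<^sup>2" using \<epsilon> by (auto intro!: add_nonneg_pos)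
      then show ?thesis
        unfolding \<eta>_def by (auto intro!: derivative_eq_intros de[OF x] simp: divide_simps)
    qed
    have I: "((\<lambda>x. e x * F x / \<eta> x) has_integral \<eta> t - \<eta> 0) {0..t}"
      by (rule fundamental_theorem_of_calculus)
        (use t d\<eta> in \<open>auto simp: has_real_derivative_iff_has_vector_derivative[symmetric]\<close>)
    have "\<eta> t - \<eta> 0 \<le> integral {0..t} (\<lambda>x. R x + \<epsilon> * L x)"
    proof (rule has_integral_le[OF I integrable_integral])
      show "(\<lambda>x. R x + \<epsilon> * L x) integrable_on {0..t}"
        by (intro integrable_continuous_interval continuous_intros contR cont')
      fix x assume x: "x \<in> {0..t}"
      have Lx: "0 \<le> L x" using L x t by auto
      \<comment> \<open>The regularised quotient falls short of the modulus by at most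
        \<open>\<epsilon>\<close>. This error is multiplied by \<open>L\<close> and disappears in
        the limit.\<close>
      have sq: "\<bar>e x\<bar> - \<epsilon> \<le> (e x)\<^sup>2 / \<eta> x"
      proof (cases "\<bar>e x\<bar> \<le> \<epsilon>")
        case True
        then show ?thesis using \<eta>(1)[of x] by (smt (verit) divide_nonneg_pos zero_le_power2)
      next
        case False
        then have "(\<bar>e x\<bar> - \<epsilon>) * \<eta> x \<le> (\<bar>e x\<bar> - \<epsilon>) * (\<bar>e x\<bar> + \<epsilon>)"
          by (intro mult_left_mono \<eta>) auto
        also have "\<dots> = (e x)\<^sup>2 - \<epsilon>\<^sup>2" by (simp add: algebra_simps power2_eq_square)
        also have "\<dots> \<le> (e x)\<^sup>2" by simp
        finally show ?thesis using \<eta>(1)[of x] by (simp add: pos_le_divide_eq)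
      qed
      have "e x * g x \<le> \<bar>g x\<bar> * \<eta> x"
      proof -
        have "e x * g x \<le> \<bar>g x\<bar> * \<bar>e x\<bar>" by (metis abs_ge_self abs_mult mult.commute)
        also have "\<dots> \<le> \<bar>g x\<bar> * \<eta> x" by (intro mult_left_mono \<eta>) auto
        finally show ?thesis .
      qed
      then have eg: "e x * g x / \<eta> x \<le> \<bar>g x\<bar>" using \<eta>(1)[of x] by (simp add: pos_divide_le_eq)
      have "e x * F x / \<eta> x = - (L x * ((e x)\<^sup>2 / \<eta> x)) + e x * g x / \<eta> x"
        by (simp add: F_def algebra_simps power2_eq_square add_divide_distrib diff_divide_distrib)
      also have "\<dots> \<le> - (L x * (\<bar>e x\<bar> - \<epsilon>)) + \<bar>g x\<bar>"
        using mult_left_mono[OF sq Lx] eg by linarith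
      finally show "e x * F x / \<eta> x \<le> R x + \<epsilon> * L x"
        by (simp add: R_def algebra_simps)
    qed
    also have "\<dots> = integral {0..t} R + \<epsilon> * integral {0..t} L"
      by (subst Henstock_Kurzweil_Integration.integral_add)
        (auto intro!: integrable_continuous_interval continuous_intros contR cont')
    finally have "\<eta> t \<le> \<eta> 0 + integral {0..t} R + \<epsilon> * integral {0..t} L" by simp
    moreover have "\<eta> 0 \<le> \<epsilon>"
    proof -
      have "e 0 = 0" using e'[of 0] t by simp
      then show ?thesis using \<epsilon> by (simp add: \<eta>_def)
    qed
    ultimately show ?thesis using \<eta>(2)[of t] by (simp add: algebra_simps)
  qed
  have nn: "0 \<le> integral {0..t} L"
    by (rule Henstock_Kurzweil_Integration.integral_nonneg)
      (use L t cont' in \<open>auto intro: integrable_continuous_interval\<close>)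
  have "\<bar>e t\<bar> \<le> integral {0..t} R"
  proof (rule field_le_epsilon)
    fix d :: real assume "0 < d"
    then have "\<bar>e t\<bar> \<le> integral {0..t} R
        + d / (1 + integral {0..t} L) * (1 + integral {0..t} L)"
      using nn by (intro main divide_pos_pos) auto
    then show "\<bar>e t\<bar> \<le> integral {0..t} R + d" using nn by simp
  qed
  then show ?thesis
    unfolding R_def[symmetric] by (subst LBINT_eq_integral[OF contR])
qed

text \<open>If the \<open>l\<close>-masses agree, a surplus of monomers is compensated by the larger
  clusters. For \<open>l = r\<close> or \<open>l = s\<close> one of the two monomer terms is 0, so
  each monomer difference is bounded by a norm that does not see monomers.\<close>

lemma monomer_le_cluster_weight:
  fixes l :: bd_seq
  assumes cd: "c \<in> bd_Xplus" "d \<in> bd_Xplus"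
    and eq: "(\<Sum>\<^sub>\<infinity>(r, s)\<in>Omega. l r s * c r s) = (\<Sum>\<^sub>\<infinity>(r, s)\<in>Omega. l r s * d r s)"
    and l: "\<And>r s. 0 \<le> l r s" "\<And>r s. l r s \<le> real (r + s)"
  shows "\<bar>l 1 0 * (c 1 0 - d 1 0) + l 0 1 * (c 0 1 - d 0 1)\<bar>
    \<le> (\<Sum>\<^sub>\<infinity>(r, s)\<in>Omega. (if r + s \<le> 1 then 0 else real (r + s)) * \<bar>c r s - d r s\<bar>)"
proof -
  define e where "e r s = c r s - d r s" for r s
  define w where "w r s = (if r + s \<le> 1 then 0 else real (r + s))" for r s
  define k where "k r s = (if r + s \<le> 1 then 0 else l r s)" for r s
  have e_sm: "(\<lambda>(r, s). h r s * e r s) summable_on Omega"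
    and e_eq: "(\<Sum>\<^sub>\<infinity>(r, s)\<in>Omega. h r s * e r s)
      = (\<Sum>\<^sub>\<infinity>(r, s)\<in>Omega. h r s * c r s) - (\<Sum>\<^sub>\<infinity>(r, s)\<in>Omega. h r s * d r s)"
    if "\<And>r s. \<bar>h r s\<bar> \<le> 1 * real (r + s)" for h :: bd_seq
    using summable_on_diff[OF Xplus_summable[OF cd(1), of h 1, OF that] Xplus_summable[OF cd(2), of h 1, OF that]]
    by (simp_all add: e_def split_def algebra_simps)
  have bnd: "\<bar>l r s\<bar> \<le> 1 * real (r + s)" "\<bar>k r s\<bar> \<le> 1 * real (r + s)" "\<bar>w r s\<bar> \<le> 1 * real (r + s)" for r s
    using l(1)[of r s] l(2)[of r s] by (auto simp: k_def w_def)
  have "0 = (\<Sum>\<^sub>\<infinity>(r, s)\<in>Omega. l r s * e r s)"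
    unfolding e_eq[of l, OF bnd(1)] using eq by simp
  also have "\<dots> = (\<Sum>\<^sub>\<infinity>p\<in>Omega. (\<lambda>(r, s). k r s * e r s) p
      + (\<lambda>(r, s). if r + s = 1 then l r s * e r s else 0) p)"
    by (rule infsum_cong) (auto simp: k_def)
  also have "\<dots> = (\<Sum>\<^sub>\<infinity>(r, s)\<in>Omega. k r s * e r s)
      + (\<Sum>\<^sub>\<infinity>(r, s)\<in>Omega. if r + s = 1 then l r s * e r s else 0)"
  proof (rule infsum_add[OF e_sm[of k, OF bnd(2)]])
    show "(\<lambda>(r, s). if r + s = 1 then l r s * e r s else 0) summable_on Omega"
      by (rule finite_nonzero_values_imp_summable_on, rule finite_subset[of _ "Omega_upto 1"])
        (auto split: if_splits)
  qed
  also have "(\<Sum>\<^sub>\<infinity>(r, s)\<in>Omega. if r + s = 1 then l r s * e r s else 0) = l 1 0 * e 1 0 + l 0 1 * e 0 1"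
    by (subst infsum_eq_sum_Omega_upto[of 1]) (simp_all add: Omega_upto_1[simplified])
  finally have "\<bar>l 1 0 * e 1 0 + l 0 1 * e 0 1\<bar> = \<bar>\<Sum>\<^sub>\<infinity>(r, s)\<in>Omega. k r s * e r s\<bar>"
    by linarith
  also have "\<dots> \<le> (\<Sum>\<^sub>\<infinity>p\<in>Omega. \<bar>(\<lambda>(r, s). k r s * e r s) p\<bar>)"
    using norm_infsum_bound[of "\<lambda>(r, s). k r s * e r s" Omega] summable_on_abs[OF e_sm[of k, OF bnd(2)]]
    by simp
  also have "\<dots> \<le> (\<Sum>\<^sub>\<infinity>p\<in>Omega. \<bar>(\<lambda>(r, s). w r s * e r s) p\<bar>)"
  proof (rule infsum_mono[OF summable_on_abs[OF e_sm[of k, OF bnd(2)]] summable_on_abs[OF e_sm[of w, OF bnd(3)]]])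
    fix p show "\<bar>(\<lambda>(r, s). k r s * e r s) p\<bar> \<le> \<bar>(\<lambda>(r, s). w r s * e r s) p\<bar>"
      using l by (cases p) (auto simp: k_def w_def abs_mult intro!: mult_right_mono)
  qed
  also have "\<dots> = (\<Sum>\<^sub>\<infinity>(r, s)\<in>Omega. w r s * \<bar>e r s\<bar>)"
    by (rule infsum_cong) (auto simp: abs_mult w_def)
  finally show ?thesis by (simp add: e_def w_def)
qed

section \<open>The second moment\<close>

text \<open>A discrete version of m^2 / 2 that continues linearly beyond \<open>N\<close>: its
  increments are bounded by \<open>N\<close>, as the weak form requires, and it increases to m (m -
  1) / 2 as \<open>N\<close> grows.\<close>

definition moment_weight :: "nat \<Rightarrow> nat \<Rightarrow> real" where
  "moment_weight N m = (\<Sum>j\<in>{1..<m}. real (min j N))"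

lemma moment_weight_Suc: "1 \<le> m \<Longrightarrow> moment_weight N (Suc m) = moment_weight N m + real (min m N)"
  by (simp add: moment_weight_def)

lemma moment_weight_small: "m \<le> 1 \<Longrightarrow> moment_weight N m = 0"
  by (simp add: moment_weight_def)

lemma moment_weight_nonneg: "0 \<le> moment_weight N m"
  by (simp add: moment_weight_def sum_nonneg)

lemma moment_weight_le: "moment_weight N m \<le> real N * real m" "moment_weight N m \<le> (real m)\<^sup>2"
proof -
  have "moment_weight N m \<le> (\<Sum>j\<in>{1..<m}. real N)" "moment_weight N m \<le> (\<Sum>j\<in>{1..<m}. real m)"
    unfolding moment_weight_def by (rule sum_mono; auto simp: min_def)+
  moreover have "real (m - 1) * real N \<le> real m * real N" "real (m - 1) * real m \<le> real m * real m"
    by (auto intro!: mult_right_mono)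
  ultimately show "moment_weight N m \<le> real N * real m" "moment_weight N m \<le> (real m)\<^sup>2"
    by (auto simp: power2_eq_square algebra_simps)
qed

text \<open>Size times increment is controlled by the weight, which closes the Gronwall estimate
  under linear growth of the coefficients. For m at most \<open>N\<close> this is the identity m^2 =
  m (m - 1) + m.\<close>

lemma moment_weight_ge: "real m * real (min m N) \<le> 2 * moment_weight N m + real m"
proof (induction m)
  case (Suc m)
  show ?case
  proof (cases "m = 0")
    case False
    have "real (Suc m) * real (min (Suc m) N) \<le> real m * real (min m N) + 2 * real (min m N) + 1"
      by (cases "m < N") (auto simp: min_def algebra_simps)
    then show ?thesis using Suc moment_weight_Suc[of m N] False by simp
  qed (simp add: moment_weight_def)
qed (simp add: moment_weight_nonneg)

context bd_cluster_solution
begin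

text \<open>The truncated weights give finite moments that satisfy a Gronwall inequality whose
  constants do not depend on the cutoff. Stating the result for triangles avoids a limit in the
  cutoff.\<close>

lemma second_moment_bounded:
  assumes c0: "(\<lambda>(r, s). (real (r + s))\<^sup>2 * c0 r s) summable_on Omega"
  obtains D where "0 \<le> D"
    "\<And>t n. t \<in> {0..T} \<Longrightarrow> (\<Sum>(r, s)\<in>Omega_upto n. (real (r + s))\<^sup>2 * c t r s) \<le> D"
proof -
  define Q where "Q = (\<Sum>\<^sub>\<infinity>(r, s)\<in>Omega. (real (r + s))\<^sup>2 * c0 r s)"
  have Q0: "0 \<le> Q" unfolding Q_def
    by (rule infsum_nonneg) (auto simp: Xplus_nonneg[OF c0_Xplus])
  \<comment> \<open>By \<open>moment_weight_ge\<close> growth contributes at most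
    \<open>C * M\<close> times twice the moment plus the mass. The moment term gives
    \<open>2 * M * C\<close>; the mass term, integrated up to \<open>T\<close>, joins the initial
    moment in \<open>A\<close>. The summand 1 makes \<open>K\<close> positive.\<close>
  define K where "K = 2 * M * C + 1"
  define A where "A = Q + C * M * (M * T)"
  have K: "0 < K" using M_nonneg C_nonneg by (simp add: K_def add_nonneg_pos)
  have A: "0 \<le> A" using Q0 M_nonneg C_nonneg T_nonneg by (simp add: A_def)
  have bound: "(\<Sum>\<^sub>\<infinity>(r, s)\<in>Omega. moment_weight N (r + s) * c t r s) \<le> 2 * A * exp (2 * K * t)"
    (is "?Y t \<le> _") if t: "t \<in> {0..T}" for N t
  \<comment> \<open>The bound \<open>real N * M\<close> depends on the cutoff, but it has only to be
    finite and does not reappear in the conclusion.\<close>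
  proof (rule gronwall_bounded[where Y = ?Y and B = "real N * M", OF K _ _ _ A t])
    have w_le: "\<bar>moment_weight N (r + s)\<bar> \<le> real N * real (r + s)" for r s
      using moment_weight_le(1)[of N "r + s"] moment_weight_nonneg[of N "r + s"] by simp
    have w_le': "moment_weight N (r + s) \<le> real N * (real r + real s)" for r s
      using moment_weight_le(1)[of N "r + s"] by simp
    have sm: "(\<lambda>(r, s). moment_weight N (r + s) * c t r s) summable_on Omega" if "t \<in> {0..T}" for t
      by (rule Xplus_summable[OF c_Xplus[OF that] w_le])
    fix t assume t: "t \<in> {0..T}"
    show "0 \<le> ?Y t"
      by (rule infsum_nonneg) (use c_nonneg[OF t] moment_weight_nonneg in auto)
    have "?Y t \<le> (\<Sum>\<^sub>\<infinity>(r, s)\<in>Omega. real N * real (r + s) * c t r s)"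
      by (rule infsum_mono[OF sm[OF t] Xplus_summable[OF c_Xplus[OF t], of _ "real N"]])
        (use w_le' c_nonneg[OF t] in \<open>auto intro!: mult_right_mono\<close>)
    also have "\<dots> = real N * bd_norm (c t)"
      unfolding Xplus_norm[OF c_Xplus[OF t]]
      by (subst infsum_cmult_right'[symmetric]) (auto intro!: infsum_cong simp: mult.assoc)
    also have "\<dots> \<le> real N * M" by (intro mult_left_mono c_norm t) auto
    finally show "?Y t \<le> real N * M" .
    fix S assume S0: "0 \<le> S" and S: "\<And>\<tau>. \<tau> \<in> {0..t} \<Longrightarrow> ?Y \<tau> \<le> S * exp (2 * K * \<tau>)"
    let ?E = "\<lambda>\<tau>. S * exp (2 * K * \<tau>)"
    let ?w = "\<lambda>r s. moment_weight N (r + s)"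
    have inc: "?w (r + 1) s - ?w r s = real (min (r + s) N)" "?w r (s + 1) - ?w r s = real (min (r + s) N)"
      if "1 \<le> r + s" for r s
      using moment_weight_Suc[OF that, of N] by simp_all
    have eq: "(\<lambda>(r, s). Jint t r s * (?w (r + 1) s - ?w r s) + Jdint t r s * (?w r (s + 1) - ?w r s)) summable_on Omega"
      "(\<Sum>\<^sub>\<infinity>(r, s)\<in>Omega. ?w r s * (c t r s - c0 r s))
        = (\<Sum>\<^sub>\<infinity>(r, s)\<in>Omega. Jint t r s * (?w (r + 1) s - ?w r s) + Jdint t r s * (?w r (s + 1) - ?w r s))"
      by (rule infsum_weight_eq[where K = "real N + 1", OF cluster_eq_int[OF t] Jint_summable[OF t] Jdint_summable[OF t]];
          use inc moment_weight_small moment_weight_nonneg weight_summable(1)[OF t w_le] in auto)+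
    let ?h = "\<lambda>p \<tau>. case p of (r, s) \<Rightarrow> C * M * (2 * ?w r s + real (r + s)) * c \<tau> r s"
    have h_int: "set_integrable lborel {0..t} (?h p)" if "p \<in> Omega_upto n" for p n
      using that by (cases p) (auto intro!: cont_set_integrable[OF t] continuous_intros c_cont)
    have le_h: "Jint t r s * (?w (r + 1) s - ?w r s) + Jdint t r s * (?w r (s + 1) - ?w r s)
      \<le> (LBINT \<tau>:{0..t}. ?h (r, s) \<tau>)" if rs: "1 \<le> r + s" for r s
    proof -
      have "Jint t r s * (?w (r + 1) s - ?w r s) + Jdint t r s * (?w r (s + 1) - ?w r s)
        = (LBINT \<tau>:{0..t}. real (min (r + s) N) * (flux a b (c \<tau>) r s + fluxdot adot bdot (c \<tau>) r s))"
        unfolding inc[OF rs] Jint_def Jdint_def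
        using cont_set_integrable[OF t flux_cont(1)[OF rs]] cont_set_integrable[OF t flux_cont(2)[OF rs]]
        by (simp add: set_integral_add algebra_simps)
      also have "\<dots> \<le> (LBINT \<tau>:{0..t}. ?h (r, s) \<tau>)"
      proof (rule set_integral_mono)
        show "set_integrable lborel {0..t} (\<lambda>\<tau>. real (min (r + s) N)
            * (flux a b (c \<tau>) r s + fluxdot adot bdot (c \<tau>) r s))"
          by (intro cont_set_integrable[OF t] continuous_intros flux_cont rs)
        show "set_integrable lborel {0..t} (?h (r, s))"
          using h_int[of "(r, s)" "r + s"] rs by simp
        fix \<tau> assume "\<tau> \<in> {0..t}"
        then have \<tau>: "\<tau> \<in> {0..T}" using t by auto
        have nn: "0 \<le> a r s * c \<tau> r s" "0 \<le> adot r s * c \<tau> r s"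
          "0 \<le> b (r + 1) s * c \<tau> (r + 1) s" "0 \<le> bdot r (s + 1) * c \<tau> r (s + 1)"
          using \<tau> rs by (auto intro!: mult_nonneg_nonneg c_nonneg a_nonneg adot_nonneg
              b_nonneg[simplified] bdot_nonneg[simplified])
        have "flux a b (c \<tau>) r s + fluxdot adot bdot (c \<tau>) r s
            \<le> c \<tau> 1 0 * (a r s * c \<tau> r s) + c \<tau> 0 1 * (adot r s * c \<tau> r s)"
          using nn by (simp add: flux_def fluxdot_def algebra_simps)
        also have "\<dots> \<le> M * (a r s * c \<tau> r s) + M * (adot r s * c \<tau> r s)"
          by (intro add_mono mult_right_mono nn c_le \<tau>) auto
        also have "\<dots> = M * c \<tau> r s * (a r s + adot r s)" by (simp add: algebra_simps)
        also have "\<dots> \<le> M * c \<tau> r s * (C * real (r + s))"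
          by (intro mult_left_mono growth rs mult_nonneg_nonneg M_nonneg c_nonneg \<tau>)
        finally have "real (min (r + s) N) * (flux a b (c \<tau>) r s + fluxdot adot bdot (c \<tau>) r s)
            \<le> real (min (r + s) N) * (M * c \<tau> r s * (C * real (r + s)))"
          by (intro mult_left_mono) auto
        also have "\<dots> = C * M * c \<tau> r s * (real (r + s) * real (min (r + s) N))"
          by (simp add: algebra_simps)
        also have "\<dots> \<le> C * M * c \<tau> r s * (2 * ?w r s + real (r + s))"
          by (intro mult_left_mono moment_weight_ge mult_nonneg_nonneg C_nonneg M_nonneg c_nonneg \<tau> rs)
        finally show "real (min (r + s) N) * (flux a b (c \<tau>) r s + fluxdot adot bdot (c \<tau>) r s) \<le> ?h (r, s) \<tau>"
          by (simp add: algebra_simps)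
      qed
      finally show ?thesis .
    qed
    have "(\<Sum>\<^sub>\<infinity>(r, s)\<in>Omega. ?w r s * (c t r s - c0 r s)) \<le> (LBINT \<tau>:{0..t}. C * M * (2 * ?E \<tau> + M))"
      unfolding eq(2)
    proof (rule infsum_le_Omega_upto[OF eq(1)])
      fix n
      have "(\<Sum>(r, s)\<in>Omega_upto n. Jint t r s * (?w (r + 1) s - ?w r s) + Jdint t r s * (?w r (s + 1) - ?w r s))
        \<le> (\<Sum>p\<in>Omega_upto n. LBINT \<tau>:{0..t}. ?h p \<tau>)"
        by (rule sum_mono) (use le_h in auto)
      also have "\<dots> = (LBINT \<tau>:{0..t}. \<Sum>p\<in>Omega_upto n. ?h p \<tau>)"
        by (rule LBINT_sum[symmetric]) (rule h_int)
      also have "\<dots> \<le> (LBINT \<tau>:{0..t}. C * M * (2 * ?E \<tau> + M))"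
      proof (rule set_integral_mono)
        show "set_integrable lborel {0..t} (\<lambda>\<tau>. \<Sum>p\<in>Omega_upto n. ?h p \<tau>)"
          by (intro cont_set_integrable[OF t] continuous_on_sum)
            (auto intro!: continuous_intros c_cont)
        show "set_integrable lborel {0..t} (\<lambda>\<tau>. C * M * (2 * ?E \<tau> + M))"
          by (intro cont_set_integrable[OF t] continuous_intros)
        fix \<tau> assume \<tau>t: "\<tau> \<in> {0..t}"
        then have \<tau>: "\<tau> \<in> {0..T}" using t by auto
        have "(\<Sum>p\<in>Omega_upto n. ?h p \<tau>) = C * M * (2 * (\<Sum>(r, s)\<in>Omega_upto n. ?w r s * c \<tau> r s)
            + (\<Sum>(r, s)\<in>Omega_upto n. real (r + s) * c \<tau> r s))"
          by (simp add: sum_distrib_left sum.distrib[symmetric] split_def algebra_simps)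
        also have "\<dots> \<le> C * M * (2 * ?E \<tau> + M)"
        proof (intro mult_left_mono add_mono)
          have "(\<Sum>(r, s)\<in>Omega_upto n. ?w r s * c \<tau> r s) \<le> ?Y \<tau>"
            by (rule finite_sum_le_infsum[OF sm[OF \<tau>]])
              (auto simp: moment_weight_nonneg c_nonneg[OF \<tau>])
          then show "(\<Sum>(r, s)\<in>Omega_upto n. ?w r s * c \<tau> r s) \<le> ?E \<tau>" using S[OF \<tau>t] by linarith
          show "(\<Sum>(r, s)\<in>Omega_upto n. real (r + s) * c \<tau> r s) \<le> M"
            using Xplus_finite_sum_le[OF c_Xplus[OF \<tau>] finite_Omega_upto Omega_upto_subset] c_norm[OF \<tau>]
            by (rule order_trans)
        qed (use C_nonneg M_nonneg in auto)
        finally show "(\<Sum>p\<in>Omega_upto n. ?h p \<tau>) \<le> C * M * (2 * ?E \<tau> + M)" .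
      qed
      finally show "(\<Sum>(r, s)\<in>Omega_upto n. Jint t r s * (?w (r + 1) s - ?w r s) + Jdint t r s * (?w r (s + 1) - ?w r s))
        \<le> (LBINT \<tau>:{0..t}. C * M * (2 * ?E \<tau> + M))" .
    qed
    also have "\<dots> = 2 * M * C * (LBINT \<tau>:{0..t}. ?E \<tau>) + C * M * (M * t)"
    proof -
      have "(LBINT \<tau>:{0..t}. C * M * (2 * ?E \<tau> + M)) = (LBINT \<tau>:{0..t}. (2 * M * C) * ?E \<tau> + C * M * M)"
        by (rule set_lebesgue_integral_cong) (auto simp: algebra_simps)
      also have "\<dots> = (LBINT \<tau>:{0..t}. (2 * M * C) * ?E \<tau>) + (LBINT \<tau>:{0..t}. C * M * M)"
        by (rule set_integral_add) (auto intro!: cont_set_integrable[OF t] continuous_intros)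
      also have "(LBINT \<tau>:{0..t}. C * M * M) = C * M * M * t"
        using t by (simp add: set_lebesgue_integral_def)
      finally show ?thesis by (simp only: set_integral_mult_right mult.assoc mult.commute mult.left_commute)
    qed
    also have "\<dots> \<le> K * (LBINT \<tau>:{0..t}. ?E \<tau>) + C * M * (M * T)"
    proof (rule add_mono)
      show "2 * M * C * (LBINT \<tau>:{0..t}. ?E \<tau>) \<le> K * (LBINT \<tau>:{0..t}. ?E \<tau>)"
      proof (rule mult_right_mono)
        show "0 \<le> (LBINT \<tau>:{0..t}. ?E \<tau>)" by (rule LBINT_nonneg) (simp add: S0)
      qed (simp add: K_def)
      show "C * M * (M * t) \<le> C * M * (M * T)"
        using t C_nonneg M_nonneg by (intro mult_left_mono) auto
    qed
    finally have "?Y t - (\<Sum>\<^sub>\<infinity>(r, s)\<in>Omega. ?w r s * c0 r s) \<le> K * (LBINT \<tau>:{0..t}. ?E \<tau>) + C * M * (M * T)"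
      unfolding weight_summable(2)[OF t w_le] .
    moreover have "(\<Sum>\<^sub>\<infinity>(r, s)\<in>Omega. ?w r s * c0 r s) \<le> Q"
      unfolding Q_def
      by (rule infsum_mono[OF Xplus_summable[OF c0_Xplus w_le] c0])
        (auto intro!: mult_right_mono moment_weight_le(2)[THEN order_trans] simp: Xplus_nonneg[OF c0_Xplus])
    ultimately show "?Y t \<le> A + K * (LBINT \<tau>:{0..t}. ?E \<tau>)"
      by (simp add: A_def)
  qed
  \<comment> \<open>On sizes up to \<open>n\<close> the cutoff \<open>n\<close> leaves the size
    unchanged, so \<open>moment_weight_ge\<close> bounds the square by twice the weight plus the
    size; the latter sums to at most \<open>M\<close>.\<close>
  define D where "D = 2 * (2 * A * exp (2 * K * T)) + M"
  show thesis
  proof (rule that)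
    show "0 \<le> D" using A M_nonneg by (simp add: D_def)
    fix t n assume t: "t \<in> {0..T}"
    have "(\<Sum>(r, s)\<in>Omega_upto n. (real (r + s))\<^sup>2 * c t r s)
        \<le> (\<Sum>(r, s)\<in>Omega_upto n. (2 * moment_weight n (r + s) + real (r + s)) * c t r s)"
    proof (rule sum_mono, clarify)
      fix r s assume rs: "(r, s) \<in> Omega_upto n"
      have "(real (r + s))\<^sup>2 = real (r + s) * real (min (r + s) n)"
        using rs by (simp add: power2_eq_square min_def)
      then show "(real (r + s))\<^sup>2 * c t r s \<le> (2 * moment_weight n (r + s) + real (r + s)) * c t r s"
        using moment_weight_ge[of "r + s" n] c_nonneg[OF t, of r s] rs
        by (intro mult_right_mono) auto
    qed
    also have "\<dots> = 2 * (\<Sum>(r, s)\<in>Omega_upto n. moment_weight n (r + s) * c t r s)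
        + (\<Sum>(r, s)\<in>Omega_upto n. real (r + s) * c t r s)"
      by (simp add: sum_distrib_left sum.distrib[symmetric] split_def algebra_simps)
    also have "\<dots> \<le> 2 * (2 * A * exp (2 * K * T)) + M"
    proof (intro add_mono mult_left_mono)
      have "\<bar>moment_weight n (r + s)\<bar> \<le> real n * real (r + s)" for r s
        using moment_weight_le(1)[of n "r + s"] moment_weight_nonneg[of n "r + s"] by simp
      then have "(\<Sum>(r, s)\<in>Omega_upto n. moment_weight n (r + s) * c t r s)
          \<le> (\<Sum>\<^sub>\<infinity>(r, s)\<in>Omega. moment_weight n (r + s) * c t r s)"
        by (intro finite_sum_le_infsum Xplus_summable[OF c_Xplus[OF t]])
          (auto simp: moment_weight_nonneg c_nonneg[OF t])
      also have "\<dots> \<le> 2 * A * exp (2 * K * t)" by (rule bound[OF t])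
      also have "\<dots> \<le> 2 * A * exp (2 * K * T)"
        using t K A by (intro mult_left_mono) auto
      finally show "(\<Sum>(r, s)\<in>Omega_upto n. moment_weight n (r + s) * c t r s) \<le> 2 * A * exp (2 * K * T)" .
      show "(\<Sum>(r, s)\<in>Omega_upto n. real (r + s) * c t r s) \<le> M"
        using Xplus_finite_sum_le[OF c_Xplus[OF t] finite_Omega_upto Omega_upto_subset] c_norm[OF t]
        by (rule order_trans)
    qed auto
    finally show "(\<Sum>(r, s)\<in>Omega_upto n. (real (r + s))\<^sup>2 * c t r s) \<le> D" by (simp add: D_def)
  qed
qed

end

subsection \<open>Uniqueness\<close>

lemma LBINT_sum_mono:
  fixes f g :: "'i \<Rightarrow> real \<Rightarrow> real" and h :: "real \<Rightarrow> real"
  assumes t: "t \<in> {0..T}" and f: "\<And>i. i \<in> I \<Longrightarrow> continuous_on {0..T} (f i)"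
    and h: "continuous_on {0..T} h"
    and le: "\<And>\<tau>. \<tau> \<in> {0..t} \<Longrightarrow> (\<Sum>i\<in>I. f i \<tau>) \<le> h \<tau>"
  shows "(\<Sum>i\<in>I. LBINT \<tau>:{0..t}. f i \<tau>) \<le> (LBINT \<tau>:{0..t}. h \<tau>)"
proof -
  have "(\<Sum>i\<in>I. LBINT \<tau>:{0..t}. f i \<tau>) = (LBINT \<tau>:{0..t}. \<Sum>i\<in>I. f i \<tau>)"
    by (rule LBINT_sum[symmetric]) (rule cont_set_integrable[OF t f])
  also have "\<dots> \<le> (LBINT \<tau>:{0..t}. h \<tau>)"
    by (rule set_integral_mono)
      (use le in \<open>auto intro!: cont_set_integrable[OF t] continuous_on_sum f h\<close>)
  finally show ?thesis .
qed

context bd_coefficients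
begin

lemma cluster_solution_unique:
  assumes c: "bd_cluster_solution a adot b bdot C c0 c T M"
    and d: "bd_cluster_solution a adot b bdot C c0 d T M"
    and mass: "\<And>t. t \<in> {0..T} \<Longrightarrow>
        (\<Sum>\<^sub>\<infinity>(r, s)\<in>Omega. real r * c t r s) = (\<Sum>\<^sub>\<infinity>(r, s)\<in>Omega. real r * d t r s)"
      "\<And>t. t \<in> {0..T} \<Longrightarrow>
        (\<Sum>\<^sub>\<infinity>(r, s)\<in>Omega. real s * c t r s) = (\<Sum>\<^sub>\<infinity>(r, s)\<in>Omega. real s * d t r s)"
    and c0: "(\<lambda>(r, s). (real (r + s))\<^sup>2 * c0 r s) summable_on Omega"
    and t: "t \<in> {0..T}" and rs: "1 \<le> r + s"
  shows "c t r s = d t r s"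
proof -
  interpret c: bd_cluster_solution a adot b bdot C c0 c T M by fact
  interpret d: bd_cluster_solution a adot b bdot C c0 d T M by fact
  obtain D where D: "0 \<le> D"
    "\<And>t n. t \<in> {0..T} \<Longrightarrow> (\<Sum>(r, s)\<in>Omega_upto n. (real (r + s))\<^sup>2 * d t r s) \<le> D"
    using d.second_moment_bounded[OF c0] by blast
  note M0 = c.M_nonneg
  define e where "e t r s = c t r s - d t r s" for t r s
  \<comment> \<open>The weight omits the monomers, for which no differential inequality is derived;
    \<open>mono_le\<close> recovers their differences from \<open>Y\<close>.\<close>
  define w where "w r s = (if r + s \<le> 1 then 0 else real (r + s))" for r s
  define Y where "Y t = (\<Sum>\<^sub>\<infinity>(r, s)\<in>Omega. w r s * \<bar>e t r s\<bar>)" for t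
  \<comment> \<open>The difference of the fluxes of \<open>c\<close> and \<open>d\<close> is
    \<open>a * c 1 0 * e + a * e 1 0 * d\<close> minus a fragmentation term linear in
    \<open>e\<close>. \<open>F\<close> and \<open>Fd\<close> are these differences with every
    \<open>e\<close> replaced by its modulus; \<open>P\<close> collects the terms with a monomer
    difference for both components.\<close>
  define P where "P t r s = a r s * \<bar>e t 1 0\<bar> * d t r s + adot r s * \<bar>e t 0 1\<bar> * d t r s" for t r s
  define A where "A t r s = a r s * c t 1 0 * \<bar>e t r s\<bar>" for t r s
  define Ad where "Ad t r s = adot r s * c t 0 1 * \<bar>e t r s\<bar>" for t r s
  define F where "F t r s = A t r s - b (r + 1) s * \<bar>e t (r + 1) s\<bar>
    + a r s * \<bar>e t 1 0\<bar> * d t r s" for t r s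
  define Fd where "Fd t r s = Ad t r s - bdot r (s + 1) * \<bar>e t r (s + 1)\<bar>
    + adot r s * \<bar>e t 0 1\<bar> * d t r s" for t r s
  define Fi where "Fi t r s = (LBINT \<tau>:{0..t}. F \<tau> r s)" for t r s
  define Fdi where "Fdi t r s = (LBINT \<tau>:{0..t}. Fd \<tau> r s)" for t r s
  define Pi where "Pi t r s = (LBINT \<tau>:{0..t}. P \<tau> r s)" for t r s
  have e_cont: "continuous_on {0..T} (\<lambda>t. e t r s)" if "1 \<le> r + s" for r s
    unfolding e_def by (intro continuous_intros c.c_cont d.c_cont that)
  have F_cont: "continuous_on {0..T} (\<lambda>t. F t r s)" "continuous_on {0..T} (\<lambda>t. Fd t r s)"
    "continuous_on {0..T} (\<lambda>t. P t r s)"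
    "continuous_on {0..T} (\<lambda>t. A t r s)" "continuous_on {0..T} (\<lambda>t. Ad t r s)"
    if "1 \<le> r + s" for r s
    unfolding F_def Fd_def P_def A_def Ad_def using that
    by (auto intro!: continuous_intros c.c_cont d.c_cont e_cont)
  have e_le: "\<bar>e t r s\<bar> \<le> c t r s + d t r s" "\<bar>e t r s\<bar> \<le> M"
    if "t \<in> {0..T}" "1 \<le> r + s" for t r s
    using c.c_nonneg[OF that] d.c_nonneg[OF that] c.c_le[OF that] d.c_le[OF that]
    by (auto simp: e_def)
  have w_le: "\<bar>w r s\<bar> \<le> 1 * real (r + s)" "0 \<le> w r s" for r s
    by (auto simp: w_def)
  have cd_sm: "(\<lambda>(r, s). w r s * c t r s + w r s * d t r s) summable_on Omega" if "t \<in> {0..T}" for t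
    using summable_on_add[OF Xplus_summable[OF c.c_Xplus[OF that] w_le(1)]
        Xplus_summable[OF d.c_Xplus[OF that] w_le(1)]]
    by (simp add: split_def)
  have we_sm: "(\<lambda>(r, s). w r s * \<bar>e t r s\<bar>) summable_on Omega" if t: "t \<in> {0..T}" for t
  proof (rule summable_on_bounded_by[OF cd_sm[OF t]])
    fix p assume "p \<in> Omega"
    then obtain r s where p: "p = (r, s)" "1 \<le> r + s" by (cases p) auto
    have "w r s * \<bar>e t r s\<bar> \<le> w r s * (c t r s + d t r s)"
      by (intro mult_left_mono e_le t p w_le)
    then show "\<bar>case p of (r, s) \<Rightarrow> w r s * \<bar>e t r s\<bar>\<bar>
        \<le> (case p of (r, s) \<Rightarrow> w r s * c t r s + w r s * d t r s)"
      using w_le(2)[of r s] by (simp add: p abs_mult algebra_simps)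
  qed
  have Y_ge: "(\<Sum>(r, s)\<in>Omega_upto n. w r s * \<bar>e t r s\<bar>) \<le> Y t" if "t \<in> {0..T}" for t n
    unfolding Y_def by (rule finite_sum_le_infsum[OF we_sm[OF that]]) (use w_le(2) in auto)
  have Y_nonneg: "0 \<le> Y t" for t
    unfolding Y_def by (rule infsum_nonneg) (use w_le(2) in auto)
  have mono_le: "\<bar>e t 1 0\<bar> \<le> Y t" "\<bar>e t 0 1\<bar> \<le> Y t" if t: "t \<in> {0..T}" for t
  proof -
    show "\<bar>e t 1 0\<bar> \<le> Y t"
      using monomer_le_cluster_weight[OF c.c_Xplus[OF t] d.c_Xplus[OF t] mass(1)[OF t]]
      by (simp add: Y_def e_def w_def)
    show "\<bar>e t 0 1\<bar> \<le> Y t"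
      using monomer_le_cluster_weight[OF c.c_Xplus[OF t] d.c_Xplus[OF t] mass(2)[OF t]]
      by (simp add: Y_def e_def w_def)
  qed
  have Y_le: "Y t \<le> 2 * M" if t: "t \<in> {0..T}" for t
    unfolding Y_def
  proof (rule infsum_le_Omega_upto[OF we_sm[OF t]])
    fix n
    have "(\<Sum>(r, s)\<in>Omega_upto n. w r s * \<bar>e t r s\<bar>)
        \<le> (\<Sum>(r, s)\<in>Omega_upto n. real (r + s) * c t r s + real (r + s) * d t r s)"
    proof (rule sum_mono, clarify)
      fix r s assume "(r, s) \<in> Omega_upto n"
      then have rs: "1 \<le> r + s" by simp
      have "w r s * \<bar>e t r s\<bar> \<le> real (r + s) * (c t r s + d t r s)"
        by (intro mult_mono e_le t rs) (auto simp: w_def)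
      then show "w r s * \<bar>e t r s\<bar> \<le> real (r + s) * c t r s + real (r + s) * d t r s"
        by (simp add: algebra_simps)
    qed
    also have "\<dots> = (\<Sum>(r, s)\<in>Omega_upto n. real (r + s) * c t r s)
        + (\<Sum>(r, s)\<in>Omega_upto n. real (r + s) * d t r s)"
      by (simp add: split_def sum.distrib)
    also have "\<dots> \<le> M + M"
      using Xplus_finite_sum_le[OF c.c_Xplus[OF t] finite_Omega_upto Omega_upto_subset, of n]
        Xplus_finite_sum_le[OF d.c_Xplus[OF t] finite_Omega_upto Omega_upto_subset, of n]
        c.c_norm[OF t] d.c_norm[OF t] by linarith
    finally show "(\<Sum>(r, s)\<in>Omega_upto n. w r s * \<bar>e t r s\<bar>) \<le> 2 * M" by simp
  qed
  \<comment> \<open>The factor 3 stands for the larger clusters and one further \<open>Y\<close> for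
    each of the two monomers.\<close>
  have weight_le_Y: "(\<Sum>(r, s)\<in>Omega_upto n. real (r + s) * \<bar>e t r s\<bar>) \<le> 3 * Y t"
    if t: "t \<in> {0..T}" for t n
  proof -
    let ?m = "\<lambda>(r, s). if r + s = 1 then \<bar>e t r s\<bar> else 0"
    have "(\<Sum>(r, s)\<in>Omega_upto n. real (r + s) * \<bar>e t r s\<bar>)
        = (\<Sum>(r, s)\<in>Omega_upto n. w r s * \<bar>e t r s\<bar>) + sum ?m (Omega_upto n)"
      unfolding sum.distrib[symmetric] by (rule sum.cong) (auto simp: w_def le_Suc_eq)
    also have "sum ?m (Omega_upto n) \<le> infsum ?m Omega"
    proof (rule finite_sum_le_infsum)
      show "?m summable_on Omega"
        by (rule finite_nonzero_values_imp_summable_on, rule finite_subset[of _ "Omega_upto 1"])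
          (auto split: if_splits)
    qed auto
    also have "infsum ?m Omega = \<bar>e t 1 0\<bar> + \<bar>e t 0 1\<bar>"
      by (subst infsum_eq_sum_Omega_upto[of 1]) (simp_all add: Omega_upto_1[simplified])
    finally show ?thesis using mono_le[OF t] Y_ge[OF t, of n] by linarith
  qed
  \<comment> \<open>Taking moduli turns the outflow term \<open>- a r s * e 1 0 * d r s\<close> into
    a gain, whereas \<open>- F\<close> contains it as a loss. Correcting this for both components
    gives twice \<open>P\<close>.\<close>
  have sub: "\<bar>e t r s\<bar> - 2 * Pi t r s \<le> - (Delta_r (Fi t) r s + Delta_s (Fdi t) r s)"
    if t: "t \<in> {0..T}" and rs: "2 \<le> r + s" for t r s
  proof -
    have rs1: "1 \<le> r + s" "r \<noteq> 0 \<Longrightarrow> 1 \<le> r - 1 + s" "s \<noteq> 0 \<Longrightarrow> 1 \<le> r + (s - 1)"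
      using rs by auto
    \<comment> \<open>Sort the equation for \<open>e r s\<close>: \<open>L\<close> is the
      nonnegative coefficient of \<open>- e r s\<close>, and \<open>g\<close> contains all other
      terms, so the loss term survives the passage to moduli.\<close>
    define L where "L \<tau> = a r s * c \<tau> 1 0 + adot r s * c \<tau> 0 1
      + (if r = 0 then 0 else b r s) + (if s = 0 then 0 else bdot r s)" for \<tau>
    define g where "g \<tau> = b (r + 1) s * e \<tau> (r + 1) s + bdot r (s + 1) * e \<tau> r (s + 1)
      - a r s * e \<tau> 1 0 * d \<tau> r s - adot r s * e \<tau> 0 1 * d \<tau> r s
      + (if r = 0 then 0 else a (r - 1) s * c \<tau> 1 0 * e \<tau> (r - 1) s + a (r - 1) s * e \<tau> 1 0 * d \<tau> (r - 1) s)
      + (if s = 0 then 0 else adot r (s - 1) * c \<tau> 0 1 * e \<tau> r (s - 1) + adot r (s - 1) * e \<tau> 0 1 * d \<tau> r (s - 1))" for \<tau>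
    have bb: "r \<noteq> 0 \<Longrightarrow> 0 \<le> b r s" "s \<noteq> 0 \<Longrightarrow> 0 \<le> bdot r s"
      using b_nonneg[of "r - 1" s] bdot_nonneg[of r "s - 1"] rs1 by auto
    have e_cont': "r \<noteq> 0 \<Longrightarrow> continuous_on {0..T} (\<lambda>t. e t (r - 1) s)"
      "s \<noteq> 0 \<Longrightarrow> continuous_on {0..T} (\<lambda>t. e t r (s - 1))"
      "r \<noteq> 0 \<Longrightarrow> continuous_on {0..T} (\<lambda>t. d t (r - 1) s)"
      "s \<noteq> 0 \<Longrightarrow> continuous_on {0..T} (\<lambda>t. d t r (s - 1))"
      using rs1 by (auto intro: e_cont d.c_cont)
    have L_cont: "continuous_on {0..T} L"
      unfolding L_def by (intro continuous_intros c.c_cont) auto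
    have g_cont: "continuous_on {0..T} g"
      unfolding g_def using rs1 e_cont'
      by (cases "r = 0"; cases "s = 0"; auto intro!: continuous_intros e_cont d.c_cont c.c_cont)
    let ?Dc = "\<lambda>c \<tau>. Delta_r (flux a b (c \<tau>)) r s + Delta_s (fluxdot adot bdot (c \<tau>)) r s"
    have e_eq: "e \<tau> r s = (LBINT \<sigma>:{0..\<tau>}. - L \<sigma> * e \<sigma> r s + g \<sigma>)" if \<tau>: "\<tau> \<in> {0..T}" for \<tau>
    proof -
      have i: "set_integrable lborel {0..\<tau>} (\<lambda>\<tau>. Delta_r (flux a b (c \<tau>)) r s)"
        "set_integrable lborel {0..\<tau>} (\<lambda>\<tau>. Delta_s (fluxdot adot bdot (c \<tau>)) r s)"
        "set_integrable lborel {0..\<tau>} (\<lambda>\<tau>. Delta_r (flux a b (d \<tau>)) r s)"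
        "set_integrable lborel {0..\<tau>} (\<lambda>\<tau>. Delta_s (fluxdot adot bdot (d \<tau>)) r s)"
        by (rule set_integrable_Delta_r set_integrable_Delta_s; rule cont_set_integrable[OF \<tau>];
            rule c.flux_cont d.flux_cont; assumption)+
      have "e \<tau> r s = (LBINT \<sigma>:{0..\<tau>}. ?Dc d \<sigma>) - (LBINT \<sigma>:{0..\<tau>}. ?Dc c \<sigma>)"
        unfolding e_def c.cluster_eq[OF \<tau> rs] d.cluster_eq[OF \<tau> rs] by simp
      also have "\<dots> = (LBINT \<sigma>:{0..\<tau>}. ?Dc d \<sigma> - ?Dc c \<sigma>)"
        by (rule set_integral_diff(2)[symmetric]) (intro set_integral_add i)+
      also have "\<dots> = (LBINT \<sigma>:{0..\<tau>}. - L \<sigma> * e \<sigma> r s + g \<sigma>)"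
      proof (rule set_lebesgue_integral_cong, simp, intro allI impI)
        fix \<sigma> show "?Dc d \<sigma> - ?Dc c \<sigma> = - L \<sigma> * e \<sigma> r s + g \<sigma>"
          using rs1 by (cases r; cases s)
            (auto simp: Delta_r_def Delta_s_def zero_ext_def flux_def fluxdot_def L_def g_def e_def algebra_simps)
      qed
      finally show ?thesis .
    qed
    have i: "set_integrable lborel {0..t} (\<lambda>\<tau>. Delta_r (F \<tau>) r s)"
      "set_integrable lborel {0..t} (\<lambda>\<tau>. Delta_s (Fd \<tau>) r s)"
      "(LBINT \<tau>:{0..t}. Delta_r (F \<tau>) r s) = Delta_r (Fi t) r s"
      "(LBINT \<tau>:{0..t}. Delta_s (Fd \<tau>) r s) = Delta_s (Fdi t) r s"
      unfolding Fi_def[abs_def] Fdi_def[abs_def]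
      by (rule set_integrable_Delta_r set_integrable_Delta_s LBINT_Delta_r LBINT_Delta_s;
          rule cont_set_integrable[OF t]; rule F_cont; assumption)+
    have iP: "set_integrable lborel {0..t} (\<lambda>\<tau>. P \<tau> r s)"
      by (intro cont_set_integrable[OF t] F_cont rs1)
    have iR: "set_integrable lborel {0..t} (\<lambda>\<tau>. Delta_r (F \<tau>) r s + Delta_s (Fd \<tau>) r s)"
      "set_integrable lborel {0..t} (\<lambda>\<tau>. 2 * P \<tau> r s)"
      by (intro set_integral_add(1) i) (use iP in simp)
    have R_eq: "(LBINT \<tau>:{0..t}. 2 * P \<tau> r s - (Delta_r (F \<tau>) r s + Delta_s (Fd \<tau>) r s))
        = 2 * Pi t r s - (Delta_r (Fi t) r s + Delta_s (Fdi t) r s)"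
      unfolding set_integral_diff(2)[OF iR(2,1)] set_integral_add(2)[OF i(1,2)] i(3,4) Pi_def by simp
    have "\<bar>e t r s\<bar> \<le> (LBINT \<tau>:{0..t}. - L \<tau> * \<bar>e \<tau> r s\<bar> + \<bar>g \<tau>\<bar>)"
    proof (rule abs_le_integral_loss_gain[OF e_cont[OF rs1(1)] L_cont g_cont _ e_eq t])
      fix \<tau> assume "\<tau> \<in> {0..T}"
      then show "0 \<le> L \<tau>" unfolding L_def using bb rs1
        by (auto intro!: add_nonneg_nonneg mult_nonneg_nonneg a_nonneg adot_nonneg c.c_nonneg)
    qed
    also have "\<dots> \<le> (LBINT \<tau>:{0..t}. 2 * P \<tau> r s - (Delta_r (F \<tau>) r s + Delta_s (Fd \<tau>) r s))"
    proof (rule set_integral_mono)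
      show "set_integrable lborel {0..t} (\<lambda>\<tau>. - L \<tau> * \<bar>e \<tau> r s\<bar> + \<bar>g \<tau>\<bar>)"
        by (intro cont_set_integrable[OF t] continuous_intros L_cont g_cont e_cont rs1)
      show "set_integrable lborel {0..t} (\<lambda>\<tau>. 2 * P \<tau> r s - (Delta_r (F \<tau>) r s + Delta_s (Fd \<tau>) r s))"
        by (intro set_integral_diff(1) iR)
      fix \<tau> assume "\<tau> \<in> {0..t}"
      then have \<tau>: "\<tau> \<in> {0..T}" using t by auto
      have tri: "\<bar>x1 + x2 - x3 - x4 + x5 + x6\<bar> \<le> \<bar>x1\<bar> + \<bar>x2\<bar> + \<bar>x3\<bar> + \<bar>x4\<bar> + \<bar>x5\<bar> + \<bar>x6\<bar>" for x1 x2 x3 x4 x5 x6 :: real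
        by linarith
      have if_r: "\<bar>if r = 0 then 0 else a (r - 1) s * c \<tau> 1 0 * e \<tau> (r - 1) s + a (r - 1) s * e \<tau> 1 0 * d \<tau> (r - 1) s\<bar>
          \<le> (if r = 0 then 0 else A \<tau> (r - 1) s + a (r - 1) s * \<bar>e \<tau> 1 0\<bar> * d \<tau> (r - 1) s)"
      proof (cases "r = 0")
        case False
        have "0 \<le> a (r - 1) s" "0 \<le> c \<tau> 1 0" "0 \<le> d \<tau> (r - 1) s"
          using rs1(2)[OF False] \<tau> by (auto intro: a_nonneg c.c_nonneg d.c_nonneg)
        then show ?thesis using False unfolding A_def
          by (auto simp: abs_mult intro!: order_trans[OF abs_triangle_ineq])
      qed simp
      have if_s: "\<bar>if s = 0 then 0 else adot r (s - 1) * c \<tau> 0 1 * e \<tau> r (s - 1) + adot r (s - 1) * e \<tau> 0 1 * d \<tau> r (s - 1)\<bar>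
          \<le> (if s = 0 then 0 else Ad \<tau> r (s - 1) + adot r (s - 1) * \<bar>e \<tau> 0 1\<bar> * d \<tau> r (s - 1))"
      proof (cases "s = 0")
        case False
        have "0 \<le> adot r (s - 1)" "0 \<le> c \<tau> 0 1" "0 \<le> d \<tau> r (s - 1)"
          using rs1(3)[OF False] \<tau> by (auto intro: adot_nonneg c.c_nonneg d.c_nonneg)
        then show ?thesis using False unfolding Ad_def
          by (auto simp: abs_mult intro!: order_trans[OF abs_triangle_ineq])
      qed simp
      have o: "\<bar>b (r + 1) s * e \<tau> (r + 1) s\<bar> = b (r + 1) s * \<bar>e \<tau> (r + 1) s\<bar>"
        "\<bar>bdot r (s + 1) * e \<tau> r (s + 1)\<bar> = bdot r (s + 1) * \<bar>e \<tau> r (s + 1)\<bar>"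
        "\<bar>a r s * e \<tau> 1 0 * d \<tau> r s\<bar> = a r s * \<bar>e \<tau> 1 0\<bar> * d \<tau> r s"
        "\<bar>adot r s * e \<tau> 0 1 * d \<tau> r s\<bar> = adot r s * \<bar>e \<tau> 0 1\<bar> * d \<tau> r s"
        using b_nonneg[OF rs1(1)] bdot_nonneg[OF rs1(1)] a_nonneg[OF rs1(1)] adot_nonneg[OF rs1(1)]
          d.c_nonneg[OF \<tau> rs1(1)] by (auto simp: abs_mult)
      have "\<bar>g \<tau>\<bar> \<le> b (r + 1) s * \<bar>e \<tau> (r + 1) s\<bar> + bdot r (s + 1) * \<bar>e \<tau> r (s + 1)\<bar>
          + a r s * \<bar>e \<tau> 1 0\<bar> * d \<tau> r s + adot r s * \<bar>e \<tau> 0 1\<bar> * d \<tau> r s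
          + (if r = 0 then 0 else A \<tau> (r - 1) s + a (r - 1) s * \<bar>e \<tau> 1 0\<bar> * d \<tau> (r - 1) s)
          + (if s = 0 then 0 else Ad \<tau> r (s - 1) + adot r (s - 1) * \<bar>e \<tau> 0 1\<bar> * d \<tau> r (s - 1))"
        unfolding g_def by (rule order_trans[OF tri]) (use if_r if_s o in linarith)
      also have "\<dots> - L \<tau> * \<bar>e \<tau> r s\<bar> = 2 * P \<tau> r s - (Delta_r (F \<tau>) r s + Delta_s (Fd \<tau>) r s)"
        using rs1 by (cases r; cases s)
          (auto simp: Delta_r_def Delta_s_def zero_ext_def F_def Fd_def A_def Ad_def P_def L_def algebra_simps)
      finally show "- L \<tau> * \<bar>e \<tau> r s\<bar> + \<bar>g \<tau>\<bar>
          \<le> 2 * P \<tau> r s - (Delta_r (F \<tau>) r s + Delta_s (Fd \<tau>) r s)" by simp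
    qed
    finally show ?thesis unfolding R_eq by simp
  qed
  have ad_nn: "0 \<le> a r s * d t r s" "0 \<le> adot r s * d t r s" if "t \<in> {0..T}" "1 \<le> r + s" for t r s
    using that by (auto intro!: mult_nonneg_nonneg a_nonneg adot_nonneg d.c_nonneg)
  have P_nonneg: "0 \<le> P t r s" if "t \<in> {0..T}" "1 \<le> r + s" for t r s
    unfolding P_def using that
    by (intro add_nonneg_nonneg mult_nonneg_nonneg a_nonneg adot_nonneg d.c_nonneg) auto
  have P_le: "P t r s \<le> C * E * (real (r + s) * d t r s)"
    if t: "t \<in> {0..T}" and rs: "1 \<le> r + s" and E: "\<bar>e t 1 0\<bar> \<le> E" "\<bar>e t 0 1\<bar> \<le> E" for t r s E
  proof -
    have "P t r s = \<bar>e t 1 0\<bar> * (a r s * d t r s) + \<bar>e t 0 1\<bar> * (adot r s * d t r s)"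
      by (simp add: P_def)
    also have "\<dots> \<le> E * (a r s * d t r s) + E * (adot r s * d t r s)"
      by (intro add_mono mult_right_mono E ad_nn t rs)
    also have "\<dots> = E * d t r s * (a r s + adot r s)" by (simp add: algebra_simps)
    also have "\<dots> \<le> E * d t r s * (C * real (r + s))"
      using E by (intro mult_left_mono growth rs mult_nonneg_nonneg d.c_nonneg t) auto
    finally show ?thesis by (simp add: algebra_simps)
  qed
  have wPi: "w r s * Pi t r s = (LBINT \<tau>:{0..t}. w r s * P \<tau> r s)" for t r s
    by (simp add: Pi_def)
  \<comment> \<open>The weight and the growth of the coefficients supply one factor r + s each;
    their product against \<open>d\<close> is bounded by the second moment.\<close>
  have wPi_sm: "(\<lambda>(r, s). w r s * Pi t r s) summable_on Omega" if t: "t \<in> {0..T}" for t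
  proof (rule summable_onI_Omega_upto)
    have tt: "{0..t} \<subseteq> {0..T}" using t by auto
    show "0 \<le> (\<lambda>(r, s). w r s * Pi t r s) (r, s)" if "1 \<le> r + s" for r s
      using that w_le(2) tt by (auto simp: Pi_def intro!: mult_nonneg_nonneg LBINT_nonneg P_nonneg)
    fix n
    have "(\<Sum>p\<in>Omega_upto n. LBINT \<tau>:{0..t}. (\<lambda>(r, s). w r s * P \<tau> r s) p) \<le> (LBINT \<tau>:{0..t}. C * M * D)"
    proof (rule LBINT_sum_mono[OF t])
      fix \<tau> assume "\<tau> \<in> {0..t}"
      then have \<tau>: "\<tau> \<in> {0..T}" using tt by auto
      have "(\<Sum>(r, s)\<in>Omega_upto n. w r s * P \<tau> r s)
          \<le> (\<Sum>(r, s)\<in>Omega_upto n. C * M * ((real (r + s))\<^sup>2 * d \<tau> r s))"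
      proof (rule sum_mono, clarify)
        fix r s assume "(r, s) \<in> Omega_upto n"
        then have rs: "1 \<le> r + s" by simp
        have "w r s * P \<tau> r s \<le> real (r + s) * (C * M * (real (r + s) * d \<tau> r s))"
          by (intro mult_mono P_le \<tau> rs e_le(2) P_nonneg) (auto simp: w_def)
        then show "w r s * P \<tau> r s \<le> C * M * ((real (r + s))\<^sup>2 * d \<tau> r s)"
          by (simp add: power2_eq_square algebra_simps)
      qed
      also have "\<dots> = C * M * (\<Sum>(r, s)\<in>Omega_upto n. (real (r + s))\<^sup>2 * d \<tau> r s)"
        by (simp add: sum_distrib_left split_def)
      also have "\<dots> \<le> C * M * D"
        using C_nonneg M0 by (intro mult_left_mono D \<tau>) auto
      finally show "(\<Sum>p\<in>Omega_upto n. (\<lambda>(r, s). w r s * P \<tau> r s) p) \<le> C * M * D" .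
    qed (auto intro!: continuous_intros F_cont)
    then show "sum (\<lambda>(r, s). w r s * Pi t r s) (Omega_upto n) \<le> (LBINT \<tau>:{0..t}. C * M * D)"
      by (simp add: split_def wPi)
  qed
  \<comment> \<open>\<open>F\<close> contains two growth terms, each with a factor at most
    \<open>M\<close>, and one fragmentation term with factor 1; likewise \<open>Fd\<close>.\<close>
  let ?G = "\<lambda>\<tau> r s. (2 * M + 1) * (gross_rate (c \<tau>) r s + gross_rate (d \<tau>) r s)"
  have F_le: "\<bar>F \<tau> r s\<bar> \<le> ?G \<tau> r s" "\<bar>Fd \<tau> r s\<bar> \<le> ?G \<tau> r s"
    if \<tau>: "\<tau> \<in> {0..T}" and rs: "1 \<le> r + s" for \<tau> r s
  proof -
    let ?x = "a r s * (c \<tau> r s + d \<tau> r s)" and ?xd = "adot r s * (c \<tau> r s + d \<tau> r s)"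
    let ?y = "b (r + 1) s * (c \<tau> (r + 1) s + d \<tau> (r + 1) s)"
    let ?yd = "bdot r (s + 1) * (c \<tau> r (s + 1) + d \<tau> r (s + 1))"
    have nn: "0 \<le> ?x" "0 \<le> ?xd" "0 \<le> ?y" "0 \<le> ?yd"
      using rs by (auto intro!: mult_nonneg_nonneg add_nonneg_nonneg a_nonneg adot_nonneg
          b_nonneg[simplified] bdot_nonneg[simplified] c.c_nonneg \<tau> d.c_nonneg)
    have prod: "0 \<le> h * u * z \<and> h * u * z \<le> M * (h * (c \<tau> r s + d \<tau> r s))"
      if "0 \<le> h" "0 \<le> u" "u \<le> M" "0 \<le> z" "z \<le> c \<tau> r s + d \<tau> r s" for h u z
      using mult_mono[OF that(3) mult_left_mono[OF that(5,1)] M0 mult_nonneg_nonneg[OF that(1,4)]] that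
      by (auto simp: algebra_simps)
    note h = a_nonneg[OF rs] adot_nonneg[OF rs]
    note u = c.c_nonneg[OF \<tau>, of 1 0, simplified] c.c_le[OF \<tau>, of 1 0, simplified]
      c.c_nonneg[OF \<tau>, of 0 1, simplified] c.c_le[OF \<tau>, of 0 1, simplified]
      e_le(2)[OF \<tau>, of 1 0, simplified] e_le(2)[OF \<tau>, of 0 1, simplified]
    have z: "0 \<le> d \<tau> r s" "d \<tau> r s \<le> c \<tau> r s + d \<tau> r s"
      using c.c_nonneg[OF \<tau> rs] d.c_nonneg[OF \<tau> rs] by auto
    have 1: "0 \<le> A \<tau> r s \<and> A \<tau> r s \<le> M * ?x" "0 \<le> Ad \<tau> r s \<and> Ad \<tau> r s \<le> M * ?xd"
      unfolding A_def Ad_def using prod[OF h(1) _ _ _ e_le(1)[OF \<tau> rs]] prod[OF h(2) _ _ _ e_le(1)[OF \<tau> rs]] u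
      by simp_all
    have 2: "0 \<le> a r s * \<bar>e \<tau> 1 0\<bar> * d \<tau> r s \<and> a r s * \<bar>e \<tau> 1 0\<bar> * d \<tau> r s \<le> M * ?x"
      "0 \<le> adot r s * \<bar>e \<tau> 0 1\<bar> * d \<tau> r s \<and> adot r s * \<bar>e \<tau> 0 1\<bar> * d \<tau> r s \<le> M * ?xd"
      using prod[OF h(1) _ _ z] prod[OF h(2) _ _ z] u by simp_all
    have 3: "0 \<le> b (r + 1) s * \<bar>e \<tau> (r + 1) s\<bar> \<and> b (r + 1) s * \<bar>e \<tau> (r + 1) s\<bar> \<le> ?y"
      "0 \<le> bdot r (s + 1) * \<bar>e \<tau> r (s + 1)\<bar> \<and> bdot r (s + 1) * \<bar>e \<tau> r (s + 1)\<bar> \<le> ?yd"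
      using e_le(1)[OF \<tau>, of "r + 1" s] e_le(1)[OF \<tau>, of r "s + 1"] b_nonneg[OF rs] bdot_nonneg[OF rs] rs
      by (auto intro!: mult_left_mono)
    have G: "?G \<tau> r s = 2 * M * ?x + 2 * M * ?xd + 2 * M * ?y + 2 * M * ?yd + ?x + ?xd + ?y + ?yd"
      by (simp add: gross_rate_def algebra_simps)
    have "0 \<le> M * ?x" "0 \<le> M * ?xd" "0 \<le> M * ?y" "0 \<le> M * ?yd" using nn M0 by auto
    then show "\<bar>F \<tau> r s\<bar> \<le> ?G \<tau> r s" "\<bar>Fd \<tau> r s\<bar> \<le> ?G \<tau> r s"
      using 1 2 3 nn unfolding G F_def Fd_def by linarith+
  qed
  have Fi_sm: "(\<lambda>(r, s). Fi t r s) summable_on Omega" "(\<lambda>(r, s). Fdi t r s) summable_on Omega"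
    if t: "t \<in> {0..T}" for t
  proof -
    have G_sm: "(\<lambda>p. (2 * M + 1) * ((\<lambda>(r, s). LBINT \<tau>:{0..t}. gross_rate (c \<tau>) r s) p
        + (\<lambda>(r, s). LBINT \<tau>:{0..t}. gross_rate (d \<tau>) r s) p)) summable_on Omega"
      by (intro summable_on_cmult_right summable_on_add c.gross_rate_summable d.gross_rate_summable t)
    have bnd: "\<bar>LBINT \<tau>:{0..t}. h \<tau>\<bar> \<le> (2 * M + 1) * ((LBINT \<tau>:{0..t}. gross_rate (c \<tau>) r s)
        + (LBINT \<tau>:{0..t}. gross_rate (d \<tau>) r s))"
      if h: "continuous_on {0..T} h" "\<And>\<tau>. \<tau> \<in> {0..T} \<Longrightarrow> \<bar>h \<tau>\<bar> \<le> ?G \<tau> r s" and rs: "1 \<le> r + s" for h r s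
    proof -
      note i = cont_set_integrable[OF t h(1)] cont_set_integrable[OF t c.gross_rate_cont[OF rs]]
        cont_set_integrable[OF t d.gross_rate_cont[OF rs]]
      have "\<bar>LBINT \<tau>:{0..t}. h \<tau>\<bar> \<le> (LBINT \<tau>:{0..t}. \<bar>h \<tau>\<bar>)"
        using set_integral_norm_bound[OF i(1)] by simp
      also have "\<dots> \<le> (LBINT \<tau>:{0..t}. ?G \<tau> r s)"
        by (rule set_integral_mono)
          (use t h in \<open>auto intro!: cont_set_integrable[OF t] continuous_intros
            c.gross_rate_cont[OF rs] d.gross_rate_cont[OF rs]\<close>)
      also have "\<dots> = (2 * M + 1) * ((LBINT \<tau>:{0..t}. gross_rate (c \<tau>) r s)
        + (LBINT \<tau>:{0..t}. gross_rate (d \<tau>) r s))"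
        unfolding set_integral_mult_right set_integral_add(2)[OF i(2,3)] ..
      finally show ?thesis .
    qed
    show "(\<lambda>(r, s). Fi t r s) summable_on Omega" "(\<lambda>(r, s). Fdi t r s) summable_on Omega"
      by (rule summable_on_bounded_by[OF G_sm]; clarsimp simp: Fi_def Fdi_def;
          rule bnd; use F_cont F_le in auto)+
  qed
  \<comment> \<open>These are the increments of \<open>w\<close>, which jumps from 0 to 2 between
    sizes 1 and 2 and rises by 1 afterwards.\<close>
  define k where "k r s = (if r + s = 1 then 2 else 1 :: real)" for r s :: nat
  have k: "w (r + 1) s - w r s = k r s" "w r (s + 1) - w r s = k r s" "0 \<le> k r s" "k r s \<le> 2"
    "k r s + 2 * w r s \<le> 4 * real (r + s)" if "1 \<le> r + s" for r s
    using that by (auto simp: w_def k_def)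
  \<comment> \<open>The growth terms contribute \<open>2 * M * C\<close>, with 2 bounding
    \<open>k\<close>, times the 3 of \<open>weight_le_Y\<close>. The monomer terms contribute
    \<open>4 * C * D\<close>, with 4 from \<open>k r s + 2 * w r s \<le> 4 * real (r + s)\<close>.
    The summand 1 gives positivity.\<close>
  define K where "K = 6 * M * C + 4 * C * D + 1"
  have K: "0 < K" using M0 C_nonneg D(1) by (simp add: K_def add_nonneg_pos)
  have Y0: "Y t \<le> 2 * 0 * exp (2 * K * t)" if t: "t \<in> {0..T}" for t
  proof (rule gronwall_bounded[where Y = Y and B = "2 * M", OF K _ _ _ _ t])
    fix t assume t: "t \<in> {0..T}"
    show "0 \<le> Y t" by (rule Y_nonneg)
    show "Y t \<le> 2 * M" by (rule Y_le[OF t])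
    fix S :: real assume S0: "0 \<le> S" and S: "\<And>\<tau>. \<tau> \<in> {0..t} \<Longrightarrow> Y \<tau> \<le> S * exp (2 * K * \<tau>)"
    let ?E = "\<lambda>\<tau>. S * exp (2 * K * \<tau>)"
    define v where "v r s = \<bar>e t r s\<bar> - 2 * Pi t r s" for r s
    have wv: "(\<lambda>(r, s). w r s * v r s) = (\<lambda>p. (\<lambda>(r, s). w r s * \<bar>e t r s\<bar>) p - 2 * (\<lambda>(r, s). w r s * Pi t r s) p)"
      by (auto simp: v_def algebra_simps)
    note sm2 = summable_on_cmult_right[OF wPi_sm[OF t], of 2]
    have wv_sm: "(\<lambda>(r, s). w r s * v r s) summable_on Omega"
      unfolding wv by (rule summable_on_diff(1)[OF we_sm[OF t] sm2])
    let ?H = "\<lambda>(r, s). Fi t r s * (w (r + 1) s - w r s) + Fdi t r s * (w r (s + 1) - w r s)"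
    have le: "?H summable_on Omega" "(\<Sum>\<^sub>\<infinity>(r, s)\<in>Omega. w r s * v r s) \<le> infsum ?H Omega"
      by (rule infsum_weight_le[where K = 2 and v = v, OF _ Fi_sm[OF t]];
          use sub[OF t] w_le(2) k wv_sm in \<open>auto simp: v_def w_def\<close>)+
    have "Y t = (\<Sum>\<^sub>\<infinity>(r, s)\<in>Omega. w r s * v r s) + (\<Sum>\<^sub>\<infinity>p\<in>Omega. 2 * (\<lambda>(r, s). w r s * Pi t r s) p)"
      unfolding wv summable_on_diff(2)[OF we_sm[OF t] sm2] Y_def by simp
    also have "\<dots> \<le> infsum ?H Omega + (\<Sum>\<^sub>\<infinity>p\<in>Omega. 2 * (\<lambda>(r, s). w r s * Pi t r s) p)"
      using le(2) by simp
    also have "\<dots> = (\<Sum>\<^sub>\<infinity>p\<in>Omega. ?H p + 2 * (\<lambda>(r, s). w r s * Pi t r s) p)"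
      by (rule infsum_add[OF le(1) sm2, symmetric])
    also have "\<dots> \<le> (LBINT \<tau>:{0..t}. K * ?E \<tau>)"
    proof (rule infsum_le_Omega_upto[OF summable_on_add[OF le(1) sm2]])
      fix n
      let ?h = "\<lambda>p \<tau>. case p of (r, s) \<Rightarrow>
        2 * M * C * (real (r + s) * \<bar>e \<tau> r s\<bar>) + 4 * C * ?E \<tau> * ((real (r + s))\<^sup>2 * d \<tau> r s)"
      have h_cont: "continuous_on {0..T} (?h p)" if "p \<in> Omega_upto n" for p
        using that by (cases p) (auto intro!: continuous_intros e_cont d.c_cont)
      have "(\<Sum>p\<in>Omega_upto n. ?H p + 2 * (\<lambda>(r, s). w r s * Pi t r s) p)
        \<le> (\<Sum>p\<in>Omega_upto n. LBINT \<tau>:{0..t}. ?h p \<tau>)"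
      proof (rule sum_mono)
        fix p assume p: "p \<in> Omega_upto n"
        obtain r s where p_eq: "p = (r, s)" by fastforce
        have rs: "1 \<le> r + s" using p p_eq by simp
        note i = cont_set_integrable[OF t F_cont(1)[OF rs]] cont_set_integrable[OF t F_cont(2)[OF rs]]
          cont_set_integrable[OF t F_cont(3)[OF rs]]
        have "?H p + 2 * (\<lambda>(r, s). w r s * Pi t r s) p = k r s * Fi t r s + k r s * Fdi t r s + 2 * w r s * Pi t r s"
          by (simp add: p_eq k[OF rs, simplified])
        also have "\<dots> = (LBINT \<tau>:{0..t}. k r s * F \<tau> r s + k r s * Fd \<tau> r s + 2 * w r s * P \<tau> r s)"
          unfolding Fi_def Fdi_def Pi_def using i by (simp add: set_integral_add)
        also have "\<dots> \<le> (LBINT \<tau>:{0..t}. ?h p \<tau>)"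
        proof (rule set_integral_mono)
          show "set_integrable lborel {0..t} (\<lambda>\<tau>. k r s * F \<tau> r s + k r s * Fd \<tau> r s + 2 * w r s * P \<tau> r s)"
            by (intro cont_set_integrable[OF t] continuous_intros F_cont rs)
          show "set_integrable lborel {0..t} (?h p)"
            by (rule cont_set_integrable[OF t h_cont[OF p]])
          fix \<tau> assume \<tau>t: "\<tau> \<in> {0..t}"
          then have \<tau>: "\<tau> \<in> {0..T}" using t by auto
          have "F \<tau> r s + Fd \<tau> r s \<le> A \<tau> r s + Ad \<tau> r s + P \<tau> r s"
            using mult_nonneg_nonneg[OF b_nonneg[OF rs] abs_ge_zero[of "e \<tau> (r + 1) s"]]
              mult_nonneg_nonneg[OF bdot_nonneg[OF rs] abs_ge_zero[of "e \<tau> r (s + 1)"]]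
            unfolding F_def Fd_def P_def by linarith
          then have "k r s * F \<tau> r s + k r s * Fd \<tau> r s \<le> k r s * (A \<tau> r s + Ad \<tau> r s + P \<tau> r s)"
            unfolding distrib_left[symmetric] by (rule mult_left_mono) (rule k(3)[OF rs])
          then have 1: "k r s * F \<tau> r s + k r s * Fd \<tau> r s + 2 * w r s * P \<tau> r s
              \<le> k r s * (A \<tau> r s + Ad \<tau> r s) + (k r s + 2 * w r s) * P \<tau> r s"
            by (simp add: algebra_simps)
          have "A \<tau> r s + Ad \<tau> r s = c \<tau> 1 0 * (a r s * \<bar>e \<tau> r s\<bar>) + c \<tau> 0 1 * (adot r s * \<bar>e \<tau> r s\<bar>)"
            by (simp add: A_def Ad_def)
          also have "\<dots> \<le> M * (a r s * \<bar>e \<tau> r s\<bar>) + M * (adot r s * \<bar>e \<tau> r s\<bar>)"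
            by (intro add_mono mult_right_mono c.c_le \<tau> mult_nonneg_nonneg a_nonneg adot_nonneg rs) auto
          also have "\<dots> = M * \<bar>e \<tau> r s\<bar> * (a r s + adot r s)" by (simp add: algebra_simps)
          also have "\<dots> \<le> M * \<bar>e \<tau> r s\<bar> * (C * real (r + s))"
            using M0 by (intro mult_left_mono growth rs) auto
          finally have A_le: "A \<tau> r s + Ad \<tau> r s \<le> M * \<bar>e \<tau> r s\<bar> * (C * real (r + s))" .
          have A0: "0 \<le> M * \<bar>e \<tau> r s\<bar> * (C * real (r + s))"
            using M0 C_nonneg by (intro mult_nonneg_nonneg) auto
          have 2: "k r s * (A \<tau> r s + Ad \<tau> r s) \<le> 2 * (M * \<bar>e \<tau> r s\<bar> * (C * real (r + s)))"
            using mult_left_mono[OF A_le k(3)[OF rs]] mult_right_mono[OF k(4)[OF rs] A0] by linarith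
          have "P \<tau> r s \<le> C * ?E \<tau> * (real (r + s) * d \<tau> r s)"
            by (rule P_le[OF \<tau> rs]) (use mono_le[OF \<tau>] S[OF \<tau>t] in linarith)+
          then have 3: "(k r s + 2 * w r s) * P \<tau> r s \<le> 4 * real (r + s) * (C * ?E \<tau> * (real (r + s) * d \<tau> r s))"
            using k[OF rs] w_le(2) P_nonneg[OF \<tau> rs] by (intro mult_mono) auto
          show "k r s * F \<tau> r s + k r s * Fd \<tau> r s + 2 * w r s * P \<tau> r s \<le> ?h p \<tau>"
            using 1 2 3 by (simp add: p_eq algebra_simps power2_eq_square)
        qed
        finally show "?H p + 2 * (\<lambda>(r, s). w r s * Pi t r s) p \<le> (LBINT \<tau>:{0..t}. ?h p \<tau>)" .
      qed
      also have "\<dots> \<le> (LBINT \<tau>:{0..t}. K * ?E \<tau>)"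
      proof (rule LBINT_sum_mono[OF t h_cont])
        show "continuous_on {0..T} (\<lambda>\<tau>. K * ?E \<tau>)" by (intro continuous_intros)
        fix \<tau> assume \<tau>t: "\<tau> \<in> {0..t}"
        then have \<tau>: "\<tau> \<in> {0..T}" using t by auto
        have E0: "0 \<le> ?E \<tau>" using S0 by simp
        have "(\<Sum>p\<in>Omega_upto n. ?h p \<tau>) = 2 * M * C * (\<Sum>(r, s)\<in>Omega_upto n. real (r + s) * \<bar>e \<tau> r s\<bar>)
            + 4 * C * ?E \<tau> * (\<Sum>(r, s)\<in>Omega_upto n. (real (r + s))\<^sup>2 * d \<tau> r s)"
          by (simp add: sum_distrib_left sum.distrib split_def)
        also have "\<dots> \<le> 2 * M * C * (3 * ?E \<tau>) + 4 * C * ?E \<tau> * D"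
        proof (intro add_mono mult_left_mono)
          show "(\<Sum>(r, s)\<in>Omega_upto n. real (r + s) * \<bar>e \<tau> r s\<bar>) \<le> 3 * ?E \<tau>"
            using weight_le_Y[OF \<tau>, of n] S[OF \<tau>t] by linarith
        qed (use D(2)[OF \<tau>] M0 C_nonneg E0 in auto)
        also have "\<dots> \<le> K * ?E \<tau>" using E0 by (simp add: K_def algebra_simps)
        finally show "(\<Sum>p\<in>Omega_upto n. ?h p \<tau>) \<le> K * ?E \<tau>" .
      qed
      finally show "(\<Sum>p\<in>Omega_upto n. ?H p + 2 * (\<lambda>(r, s). w r s * Pi t r s) p)
        \<le> (LBINT \<tau>:{0..t}. K * ?E \<tau>)" .
    qed
    also have "\<dots> = K * (LBINT \<tau>:{0..t}. ?E \<tau>)" by (rule set_integral_mult_right)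
    finally show "Y t \<le> 0 + K * (LBINT \<tau>:{0..t}. ?E \<tau>)" by simp
  qed simp
  have e0: "e t r s = 0"
  proof (cases "2 \<le> r + s")
    case True
    have "(\<Sum>(r, s)\<in>{(r, s)}. w r s * \<bar>e t r s\<bar>) \<le> Y t"
      unfolding Y_def by (rule finite_sum_le_infsum[OF we_sm[OF t]]) (use True w_le(2) in auto)
    then have "w r s * \<bar>e t r s\<bar> \<le> 0" using Y0[OF t] by simp
    moreover have "0 < w r s" using True by (simp add: w_def)
    ultimately show ?thesis by (simp add: mult_le_0_iff)
  next
    case False
    then have "(r, s) \<in> Omega_upto 1" using rs by simp
    then have "(r, s) = (1, 0) \<or> (r, s) = (0, 1)" unfolding Omega_upto_1 by simp
    then show ?thesis using mono_le[OF t] Y0[OF t] by auto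
  qed
  then show ?thesis by (simp add: e_def)
qed

section \<open>Transfer between solutions and their restrictions to compact time intervals\<close>

lemma time_interval_le: "t \<in> time_interval T \<Longrightarrow> \<tau> \<in> {0..t} \<Longrightarrow> \<tau> \<in> time_interval T"
  by (auto simp: time_interval_def) (metis ereal_less_eq(3) order_le_less_trans)

text \<open>The conclusion covers all sufficiently large \<open>M\<close>, so that two solutions can
  be compared with a common bound.\<close>

lemma bd_solution_cluster:
  assumes sol: "bd_solution a adot b bdot c0 T c" and t: "t \<in> time_interval T"
  obtains M0 where "\<And>M. M0 \<le> M \<Longrightarrow> bd_cluster_solution a adot b bdot C c0 c t M"
proof -
  note s = sol[unfolded bd_solution_def]
  obtain B where B: "\<And>t. t \<in> time_interval T \<Longrightarrow> bd_norm (c t) \<le> B"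
    using s unfolding bdd_above_def by auto
  have sub: "{0..t} \<subseteq> time_interval T" using time_interval_le[OF t] by auto
  show thesis
  proof (rule that[of B])
    fix M assume M: "B \<le> M"
    show "bd_cluster_solution a adot b bdot C c0 c t M"
    proof unfold_locales
      show "0 \<le> t" using t by (simp add: time_interval_def)
      show "c0 \<in> bd_Xplus" using s by auto
      show "c u \<in> bd_Xplus" "bd_norm (c u) \<le> M" if "u \<in> {0..t}" for u
        using s M sub that B[of u] by auto
      show "continuous_on {0..t} (\<lambda>t. c t r s)" if "1 \<le> r + s" for r s
        using s that by (auto intro!: continuous_on_subset[OF _ sub])
      show "(\<integral>\<^sup>+\<tau>\<in>{0..t}. (\<Sum>\<^sub>\<infinity>(r, s)\<in>Omega. ennreal (gross_rate (c \<tau>) r s)) \<partial>lborel) < \<infinity>"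
        using s t unfolding gross_rate_def by blast
      show "c u r s = c0 r s - (LBINT \<tau>:{0..u}.
            Delta_r (flux a b (c \<tau>)) r s + Delta_s (fluxdot adot bdot (c \<tau>)) r s)"
        if "u \<in> {0..t}" "2 \<le> r + s" for u r s
        using s that sub by blast
    qed
  qed
qed

lemma bd_solution_mass:
  assumes sol: "bd_solution a adot b bdot c0 T c" and t: "t \<in> time_interval T"
  shows "(\<Sum>\<^sub>\<infinity>(r, s)\<in>Omega. real r * c t r s) = (\<Sum>\<^sub>\<infinity>(r, s)\<in>Omega. real r * c0 r s)"
    and "(\<Sum>\<^sub>\<infinity>(r, s)\<in>Omega. real s * c t r s) = (\<Sum>\<^sub>\<infinity>(r, s)\<in>Omega. real s * c0 r s)"
proof -
  obtain M where "bd_cluster_solution a adot b bdot C c0 c t M"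
    using bd_solution_cluster[OF sol t] by blast
  then interpret bd_cluster_solution a adot b bdot C c0 c t M .
  have "c t 1 0 = c0 1 0 - (LBINT \<tau>:{0..t}. loss10 (c \<tau>))"
    "c t 0 1 = c0 0 1 - (LBINT \<tau>:{0..t}. loss01 (c \<tau>))"
    using sol t unfolding bd_solution_def loss10_def loss01_def by blast+
  then show "(\<Sum>\<^sub>\<infinity>(r, s)\<in>Omega. real r * c t r s) = (\<Sum>\<^sub>\<infinity>(r, s)\<in>Omega. real r * c0 r s)"
    and "(\<Sum>\<^sub>\<infinity>(r, s)\<in>Omega. real s * c t r s) = (\<Sum>\<^sub>\<infinity>(r, s)\<in>Omega. real s * c0 r s)"
    using mass_balance[of t 1 0] mass_balance[of t 0 1] T_nonneg by simp_all
qed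

lemma bd_solution_unique:
  assumes c: "bd_solution a adot b bdot c0 T c" and d: "bd_solution a adot b bdot c0 T d"
    and c0: "(\<lambda>(r, s). (real (r + s))\<^sup>2 * c0 r s) summable_on Omega"
    and t: "t \<in> time_interval T" and rs: "1 \<le> r + s"
  shows "c t r s = d t r s"
proof -
  obtain M1 where M1: "\<And>M. M1 \<le> M \<Longrightarrow> bd_cluster_solution a adot b bdot C c0 c t M"
    using bd_solution_cluster[OF c t] by blast
  obtain M2 where M2: "\<And>M. M2 \<le> M \<Longrightarrow> bd_cluster_solution a adot b bdot C c0 d t M"
    using bd_solution_cluster[OF d t] by blast
  show ?thesis
  proof (rule cluster_solution_unique[OF M1[of "max M1 M2"] M2[of "max M1 M2"] _ _ c0 _ rs])
    show "t \<in> {0..t}" using t by (simp add: time_interval_def)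
    fix u assume u: "u \<in> {0..t}"
    note u' = time_interval_le[OF t u]
    show "(\<Sum>\<^sub>\<infinity>(r, s)\<in>Omega. real r * c u r s) = (\<Sum>\<^sub>\<infinity>(r, s)\<in>Omega. real r * d u r s)"
      "(\<Sum>\<^sub>\<infinity>(r, s)\<in>Omega. real s * c u r s) = (\<Sum>\<^sub>\<infinity>(r, s)\<in>Omega. real s * d u r s)"
      using bd_solution_mass[OF c u'] bd_solution_mass[OF d u'] by simp_all
  qed auto
qed

text \<open>\<open>M\<close> does not depend on \<open>T\<close>, which yields the norm bound on the
  whole half-line. The monomer equations are recovered from the two masses by
  \<open>mass_balance\<close>.\<close>

lemma bd_solution_globalI:
  assumes sol: "\<And>T. 0 \<le> T \<Longrightarrow> bd_cluster_solution a adot b bdot C c0 c T M"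
    and mass: "\<And>t. 0 \<le> t \<Longrightarrow> (\<Sum>\<^sub>\<infinity>(r, s)\<in>Omega. real r * c t r s) = (\<Sum>\<^sub>\<infinity>(r, s)\<in>Omega. real r * c0 r s)"
      "\<And>t. 0 \<le> t \<Longrightarrow> (\<Sum>\<^sub>\<infinity>(r, s)\<in>Omega. real s * c t r s) = (\<Sum>\<^sub>\<infinity>(r, s)\<in>Omega. real s * c0 r s)"
  shows "bd_solution a adot b bdot c0 \<infinity> c"
proof -
  have I: "time_interval \<infinity> = {0..}" by (auto simp: time_interval_def)
  have cont: "continuous_on {0..} (\<lambda>t. c t r s)" if rs: "1 \<le> r + s" for r s
    unfolding continuous_on_eq_continuous_within
  proof
    fix x :: real assume x: "x \<in> {0..}"
    have "continuous_on {0..x + 1} (\<lambda>t. c t r s)"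
      using bd_cluster_solution.c_cont[OF sol rs, of "x + 1"] x by simp
    then have "continuous (at x within {0..x + 1}) (\<lambda>t. c t r s)"
      using x by (simp add: continuous_on_eq_continuous_within)
    \<comment> \<open>The interval was continued past \<open>x\<close> so that it agrees with the
      half-line near \<open>x\<close>, also to the right.\<close>
    moreover have "at x within {0..x + 1} = at x within {0..}"
      by (rule at_within_nhd[of _ "{..<x + 1}"]) auto
    ultimately show "continuous (at x within {0..}) (\<lambda>t. c t r s)" by simp
  qed
  have eqs: "c t 1 0 = c0 1 0 - (LBINT \<tau>:{0..t}. loss10 (c \<tau>)) \<and>
      c t 0 1 = c0 0 1 - (LBINT \<tau>:{0..t}. loss01 (c \<tau>)) \<and>
      (\<forall>r s. r + s \<ge> 2 \<longrightarrow> c t r s = c0 r s - (LBINT \<tau>:{0..t}.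
            Delta_r (flux a b (c \<tau>)) r s + Delta_s (fluxdot adot bdot (c \<tau>)) r s)) \<and>
      c t \<in> bd_Xplus \<and> bd_norm (c t) \<le> M \<and>
      (\<integral>\<^sup>+\<tau>\<in>{0..t}. (\<Sum>\<^sub>\<infinity>(r, s)\<in>Omega. ennreal (gross_rate (c \<tau>) r s)) \<partial>lborel) < \<infinity>"
    if t: "0 \<le> t" for t
  proof -
    interpret bd_cluster_solution a adot b bdot C c0 c t M by (rule sol[OF t])
    have t': "t \<in> {0..t}" using t by simp
    have "c t 1 0 = c0 1 0 - (LBINT \<tau>:{0..t}. loss10 (c \<tau>))"
      "c t 0 1 = c0 0 1 - (LBINT \<tau>:{0..t}. loss01 (c \<tau>))"
      using mass_balance[OF t', of 1 0] mass_balance[OF t', of 0 1] mass[OF t] by simp_all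
    then show ?thesis using cluster_eq[OF t'] c_Xplus[OF t'] c_norm[OF t'] rate_finite by blast
  qed
  have "c0 \<in> bd_Xplus" using bd_cluster_solution.c0_Xplus[OF sol[of 0]] by simp
  then show ?thesis
    unfolding bd_solution_def I
    using eqs cont unfolding loss10_def loss01_def gross_rate_def
    by (auto simp: bdd_above_def)
qed

end

subsection \<open>Tools for the limit\<close>

text \<open>A variant of the Arzela-Ascoli argument for functions with jumps. The term
  \<open>h n\<close> absorbs the time step, and \<open>\<epsilon>\<close> the variation of the
  monomers that no Lipschitz constant controls. Convergence at rational times extends to all times
  by approximation, and the limit is continuous since both defects become negligible.\<close>

lemma
  fixes f :: "nat \<Rightarrow> real \<Rightarrow> real" and h :: "nat \<Rightarrow> real"
  assumes h: "h \<longlonglongrightarrow> 0"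
    and equi: "\<And>T \<epsilon>. 0 < \<epsilon> \<Longrightarrow> \<exists>\<Lambda>\<ge>0. \<forall>n. \<forall>t\<in>{0..T}. \<forall>u\<in>{0..T}.
      \<bar>f n t - f n u\<bar> \<le> \<Lambda> * (\<bar>t - u\<bar> + h n) + \<epsilon>"
    and conv: "\<And>q. q \<in> \<rat> \<Longrightarrow> 0 \<le> q \<Longrightarrow> convergent (\<lambda>n. f n q)"
  shows asymp_equicontinuous_convergent: "0 \<le> t \<Longrightarrow> convergent (\<lambda>n. f n t)"
    and asymp_equicontinuous_lim_cont: "continuous_on {0..T} (\<lambda>t. lim (\<lambda>n. f n t))"
proof -
  have conv': "convergent (\<lambda>n. f n t)" if t: "0 \<le> t" for t
  proof (rule Cauchy_convergent, rule metric_CauchyI)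
    fix e :: real assume e: "0 < e"
    obtain \<Lambda> where \<Lambda>: "0 \<le> \<Lambda>" "\<And>n t' u. t' \<in> {0..t + 1} \<Longrightarrow> u \<in> {0..t + 1} \<Longrightarrow>
        \<bar>f n t' - f n u\<bar> \<le> \<Lambda> * (\<bar>t' - u\<bar> + h n) + e / 8"
      using equi[of "e / 8" "t + 1"] e by auto
    \<comment> \<open>Two terms \<open>\<Lambda> * \<delta>\<close> and the defect give three
      eighths of \<open>e\<close> on either side of the rational time; a quarter is left for the
      Cauchy property there.\<close>
    define \<delta> where "\<delta> = e / (8 * (\<Lambda> + 1))"
    have \<delta>: "0 < \<delta>" "\<Lambda> * \<delta> \<le> e / 8" using e \<Lambda>(1) by (auto simp: \<delta>_def field_simps)
    obtain q where q: "q \<in> \<rat>" "t < q" "q < t + min 1 \<delta>"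
      using Rats_dense_in_real[of t "t + min 1 \<delta>"] \<delta>(1) by auto
    obtain N1 where N1: "\<And>n. n \<ge> N1 \<Longrightarrow> h n \<le> \<delta>"
      using order_tendstoD(2)[OF h \<delta>(1)] unfolding eventually_sequentially by (meson less_imp_le)
    have "Cauchy (\<lambda>n. f n q)" using conv[OF q(1)] q t by (intro convergent_Cauchy) simp
    then obtain N2 where N2: "\<And>m n. m \<ge> N2 \<Longrightarrow> n \<ge> N2 \<Longrightarrow> dist (f m q) (f n q) < e / 4"
      using e by (meson metric_CauchyD zero_less_divide_iff zero_less_numeral)
    have tq: "\<bar>f n t - f n q\<bar> \<le> 3 * (e / 8)" if "n \<ge> N1" for n
    proof -
      have "\<bar>f n t - f n q\<bar> \<le> \<Lambda> * (\<bar>t - q\<bar> + h n) + e / 8"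
        by (rule \<Lambda>) (use t q in auto)
      also have "\<Lambda> * (\<bar>t - q\<bar> + h n) \<le> \<Lambda> * (\<delta> + \<delta>)"
        by (intro mult_left_mono add_mono N1 that \<Lambda>) (use q in auto)
      finally show ?thesis using \<delta>(2) by (simp add: algebra_simps)
    qed
    show "\<exists>N. \<forall>m\<ge>N. \<forall>n\<ge>N. dist (f m t) (f n t) < e"
    proof (intro exI allI impI)
      fix m n assume "m \<ge> max N1 N2" "n \<ge> max N1 N2"
      then show "dist (f m t) (f n t) < e"
        using tq[of m] tq[of n] N2[of m n] unfolding dist_real_def max.bounded_iff by linarith
    qed
  qed
  then show "0 \<le> t \<Longrightarrow> convergent (\<lambda>n. f n t)" .
  let ?F = "\<lambda>t. lim (\<lambda>n. f n t)"
  have F: "(\<lambda>n. f n t) \<longlonglongrightarrow> ?F t" if "0 \<le> t" for t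
    using conv'[OF that] by (simp add: convergent_LIMSEQ_iff)
  show "continuous_on {0..T} ?F"
    unfolding continuous_on_iff
  proof (intro ballI allI impI)
    fix t e :: real assume t: "t \<in> {0..T}" and e: "0 < e"
    obtain \<Lambda> where \<Lambda>: "0 \<le> \<Lambda>" "\<And>n t' u. t' \<in> {0..T} \<Longrightarrow> u \<in> {0..T} \<Longrightarrow>
        \<bar>f n t' - f n u\<bar> \<le> \<Lambda> * (\<bar>t' - u\<bar> + h n) + e / 4"
      using equi[of "e / 4" T] e by auto
    have lip: "\<bar>?F u - ?F t\<bar> \<le> \<Lambda> * (\<bar>u - t\<bar> + 0) + e / 4" if u: "u \<in> {0..T}" for u
    proof (rule LIMSEQ_le)
      show "(\<lambda>n. \<bar>f n u - f n t\<bar>) \<longlonglongrightarrow> \<bar>?F u - ?F t\<bar>"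
        using t u by (intro tendsto_intros F) auto
      show "(\<lambda>n. \<Lambda> * (\<bar>u - t\<bar> + h n) + e / 4) \<longlonglongrightarrow> \<Lambda> * (\<bar>u - t\<bar> + 0) + e / 4"
        by (intro tendsto_intros h)
    qed (use \<Lambda>(2)[OF u t] in auto)
    show "\<exists>d>0. \<forall>u\<in>{0..T}. dist u t < d \<longrightarrow> dist (?F u) (?F t) < e"
    proof (intro exI conjI ballI impI)
      show d: "0 < e / (2 * (\<Lambda> + 1))" using e \<Lambda>(1) by simp
      fix u assume u: "u \<in> {0..T}" and "dist u t < e / (2 * (\<Lambda> + 1))"
      then have "\<bar>u - t\<bar> * (\<Lambda> + 1) \<le> e / 2"
        using \<Lambda>(1) by (simp add: dist_real_def field_simps)
      then have "\<Lambda> * \<bar>u - t\<bar> + \<bar>u - t\<bar> \<le> e / 2" by (simp only: ring_distribs mult.commute[of _ \<Lambda>] mult_1_right)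
      then have "\<Lambda> * (\<bar>u - t\<bar> + 0) \<le> e / 2"
        unfolding add_0_right by linarith
      then show "dist (?F u) (?F t) < e"
        using lip[OF u] e unfolding dist_real_def by linarith
    qed
  qed
qed

section \<open>Integrals of step functions and their limits\<close>

text \<open>Dominated convergence with a moving upper limit. It moves from below, so the domain
  stays where the bound holds, and the only point at which the indicators may fail to converge to 1
  is \<open>T\<close>, a null set.\<close>

lemma LBINT_tendsto:
  fixes f :: "nat \<Rightarrow> real \<Rightarrow> real" and x :: "nat \<Rightarrow> real"
  assumes f: "\<And>n. f n \<in> borel_measurable borel" and F: "set_borel_measurable lborel {0..T} F"
    and bound: "\<And>n \<tau>. N \<le> n \<Longrightarrow> \<tau> \<in> {0..T} \<Longrightarrow> \<bar>f n \<tau>\<bar> \<le> L"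
    and lim: "\<And>\<tau>. \<tau> \<in> {0..T} \<Longrightarrow> (\<lambda>n. f n \<tau>) \<longlonglongrightarrow> F \<tau>"
    and x: "x \<longlonglongrightarrow> T" "\<And>n. x n \<le> T"
  shows "(\<lambda>n. LBINT \<tau>:{0..x n}. f n \<tau>) \<longlonglongrightarrow> (LBINT \<tau>:{0..T}. F \<tau>)"
proof -
  have "(\<lambda>n. LBINT \<tau>:{0..x (n + N)}. f (n + N) \<tau>) \<longlonglongrightarrow> (LBINT \<tau>:{0..T}. F \<tau>)"
    unfolding set_lebesgue_integral_def
  proof (rule integral_dominated_convergence)
    show "(\<lambda>\<tau>. indicator {0..T} \<tau> *\<^sub>R F \<tau>) \<in> borel_measurable lborel"
      using F by (simp add: set_borel_measurable_def)
    show "(\<lambda>\<tau>. indicator {0..x (n + N)} \<tau> *\<^sub>R f (n + N) \<tau>) \<in> borel_measurable lborel" for n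
      using f[of "n + N"] by measurable
    show "integrable lborel (\<lambda>\<tau>. indicator {0..T} \<tau> *\<^sub>R L)"
      using borel_integrable_atLeastAtMost'[of 0 T "\<lambda>_. L"] by (simp add: set_integrable_def)
    show "AE \<tau> in lborel. norm (indicator {0..x (n + N)} \<tau> *\<^sub>R f (n + N) \<tau>) \<le> indicator {0..T} \<tau> *\<^sub>R L" for n
    proof (rule AE_I2)
      fix \<tau> :: real
      show "norm (indicator {0..x (n + N)} \<tau> *\<^sub>R f (n + N) \<tau>) \<le> indicator {0..T} \<tau> *\<^sub>R L"
      proof (cases "\<tau> \<in> {0..T}")
        case True
        then show ?thesis using bound[of "n + N" \<tau>] abs_ge_zero[of "f (n + N) \<tau>"]
          by (auto simp: indicator_def)
      next
        case False
        then have "\<tau> \<notin> {0..x (n + N)}" using x(2)[of "n + N"] by auto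
        with False show ?thesis by simp
      qed
    qed
    have "AE \<tau> in lborel. \<tau> \<noteq> T" by (rule AE_lborel_singleton)
    then show "AE \<tau> in lborel. (\<lambda>n. indicator {0..x (n + N)} \<tau> *\<^sub>R f (n + N) \<tau>)
        \<longlonglongrightarrow> indicator {0..T} \<tau> *\<^sub>R F \<tau>"
    proof eventually_elim
      fix \<tau> assume ne: "\<tau> \<noteq> T"
      show "(\<lambda>n. indicator {0..x (n + N)} \<tau> *\<^sub>R f (n + N) \<tau>) \<longlonglongrightarrow> indicator {0..T} \<tau> *\<^sub>R F \<tau>"
      proof (cases "\<tau> \<in> {0..T}")
        case True
        then have "\<tau> < T" using ne by simp
        then have "\<forall>\<^sub>F n in sequentially. \<tau> < x n" by (rule order_tendstoD(1)[OF x(1)])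
        then have "\<forall>\<^sub>F n in sequentially. f n \<tau> = indicator {0..x n} \<tau> *\<^sub>R f n \<tau>"
          by eventually_elim (use True in auto)
        then have "(\<lambda>n. indicator {0..x n} \<tau> *\<^sub>R f n \<tau>) \<longlonglongrightarrow> F \<tau>"
          using lim[OF True] by (rule Lim_transform_eventually[rotated])
        then have "(\<lambda>n. indicator {0..x (n + N)} \<tau> *\<^sub>R f (n + N) \<tau>) \<longlonglongrightarrow> F \<tau>"
          by (rule LIMSEQ_ignore_initial_segment)
        then show ?thesis using True by simp
      next
        case False
        then have "\<tau> \<notin> {0..x (n + N)}" for n using x(2)[of "n + N"] by auto
        with False show ?thesis by simp
      qed
    qed
  qed
  then show ?thesis
    using LIMSEQ_offset[of "\<lambda>n. LBINT \<tau>:{0..x n}. f n \<tau>" N] by simp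
qed

lemma step_measurable:
  fixes f :: "nat \<Rightarrow> real" and h :: real
  shows "(\<lambda>\<tau>. f (nat \<lfloor>\<tau> / h\<rfloor>)) \<in> borel_measurable borel"
proof -
  have "(\<lambda>\<tau>. \<tau> / h) \<in> borel_measurable borel" by simp
  from measurable_compose[OF measurable_compose[OF this measurable_real_floor], of "\<lambda>i. f (nat i)" borel]
  show ?thesis by simp
qed

text \<open>Sums produced by the Euler scheme become integrals without quadrature error, provided
  that the upper limit is a grid point. This is why integrals of the scheme run up to
  \<open>grid n t\<close> and not up to \<open>t\<close>.\<close>

lemma step_LBINT:
  fixes f :: "nat \<Rightarrow> real"
  assumes h: "0 < h"
  shows "(LBINT \<tau>:{0..real K * h}. f (nat \<lfloor>\<tau> / h\<rfloor>)) = h * (\<Sum>j<K. f j)"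
proof -
  let ?g = "\<lambda>\<tau>. f (nat \<lfloor>\<tau> / h\<rfloor>)"
  have piece: "set_integrable lborel {real k * h..<real (Suc k) * h} ?g \<and>
      (LBINT \<tau>:{real k * h..<real (Suc k) * h}. ?g \<tau>) = h * f k" for k
  proof -
    have eq: "?g \<tau> = f k" if "\<tau> \<in> {real k * h..<real (Suc k) * h}" for \<tau>
    proof -
      have "real k \<le> \<tau> / h" "\<tau> / h < real k + 1" using that h by (auto simp: field_simps)
      then have "\<lfloor>\<tau> / h\<rfloor> = int k" by (intro floor_unique) auto
      then show ?thesis by simp
    qed
    have "set_integrable lborel {real k * h..<real (Suc k) * h} (\<lambda>_. f k)"
      by (rule set_integrable_subset[OF borel_integrable_atLeastAtMost'
            [of "real k * h" "real (Suc k) * h", OF continuous_on_const]]) auto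
    moreover have "(LBINT \<tau>:{real k * h..<real (Suc k) * h}. f k) = h * f k"
      using h by (simp add: set_lebesgue_integral_def algebra_simps)
    moreover have "set_integrable lborel {real k * h..<real (Suc k) * h} ?g
        \<longleftrightarrow> set_integrable lborel {real k * h..<real (Suc k) * h} (\<lambda>_. f k)"
      by (rule set_integrable_cong) (use eq in auto)
    moreover have "(LBINT \<tau>:{real k * h..<real (Suc k) * h}. ?g \<tau>)
        = (LBINT \<tau>:{real k * h..<real (Suc k) * h}. f k)"
      by (rule set_lebesgue_integral_cong) (use eq in auto)
    ultimately show ?thesis by simp
  qed
  have "set_integrable lborel {0..<real K * h} ?g \<and> (LBINT \<tau>:{0..<real K * h}. ?g \<tau>) = h * (\<Sum>j<K. f j)"
  proof (induction K)
    case 0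
    then show ?case by (simp add: set_integrable_def set_lebesgue_integral_def)
  next
    case (Suc K)
    have un: "{0..<real (Suc K) * h} = {0..<real K * h} \<union> {real K * h..<real (Suc K) * h}"
    proof -
      have "0 \<le> real K * h" "real K * h \<le> real (Suc K) * h" using h by (auto simp: algebra_simps)
      then show ?thesis by auto
    qed
    have dj: "{0..<real K * h} \<inter> {real K * h..<real (Suc K) * h} = {}" by auto
    show ?case
      unfolding un
    proof
      show "set_integrable lborel ({0..<real K * h} \<union> {real K * h..<real (Suc K) * h}) ?g"
        by (rule set_integrable_Un) (use Suc piece[of K] in auto)
      have "(LBINT \<tau>:{0..<real K * h} \<union> {real K * h..<real (Suc K) * h}. ?g \<tau>)
          = (LBINT \<tau>:{0..<real K * h}. ?g \<tau>) + (LBINT \<tau>:{real K * h..<real (Suc K) * h}. ?g \<tau>)"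
        by (rule set_integral_Un[OF dj]) (use Suc piece[of K] in auto)
      then show "(LBINT \<tau>:{0..<real K * h} \<union> {real K * h..<real (Suc K) * h}. ?g \<tau>) = h * (\<Sum>j<Suc K. f j)"
        using Suc piece[of K] by (simp add: distrib_left)
    qed
  qed
  moreover have "(LBINT \<tau>:{0..real K * h}. ?g \<tau>) = (LBINT \<tau>:{0..<real K * h}. ?g \<tau>)"
    unfolding set_lebesgue_integral_def
  proof (rule integral_cong_AE)
    have "AE \<tau> in lborel. \<tau> \<noteq> real K * h" by (rule AE_lborel_singleton)
    then show "AE \<tau> in lborel. indicator {0..real K * h} \<tau> *\<^sub>R ?g \<tau> = indicator {0..<real K * h} \<tau> *\<^sub>R ?g \<tau>"
      by eventually_elim (auto simp: indicator_def)
  qed (use step_measurable in measurable)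
  ultimately show ?thesis by simp
qed

section \<open>Tails and a superlinear weight\<close>

lemma tail_weight_exists:
  fixes u :: bd_seq
  assumes u: "(\<lambda>(r, s). real (r + s) * u r s) summable_on Omega" and nn: "\<And>r s. 1 \<le> r + s \<Longrightarrow> 0 \<le> u r s"
    and \<epsilon>: "0 < \<epsilon>"
  obtains j where "\<And>n. (\<Sum>(r, s)\<in>Omega_upto n. if j < r + s then real (r + s) * u r s else 0) \<le> \<epsilon>"
proof -
  let ?f = "\<lambda>(r, s). real (r + s) * u r s"
  have "\<forall>\<^sub>F n in sequentially. infsum ?f Omega - \<epsilon> < sum ?f (Omega_upto n)"
    using order_tendstoD(1)[OF sum_Omega_upto_tendsto[OF u]] \<epsilon> by simp
  then obtain j where j: "infsum ?f Omega - \<epsilon> < sum ?f (Omega_upto j)"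
    using eventually_happens by fastforce
  show thesis
  proof
    fix n
    let ?N = "max n j"
    have "(\<Sum>(r, s)\<in>Omega_upto n. if j < r + s then real (r + s) * u r s else 0)
        \<le> (\<Sum>(r, s)\<in>Omega_upto ?N. if j < r + s then real (r + s) * u r s else 0)"
      by (rule sum_mono2) (auto simp: nn)
    also have "\<dots> = (\<Sum>p\<in>Omega_upto ?N - Omega_upto j. ?f p)"
      by (rule sum.mono_neutral_cong_right) auto
    also have "\<dots> = sum ?f (Omega_upto ?N) - sum ?f (Omega_upto j)"
      by (rule sum_diff) auto
    also have "sum ?f (Omega_upto ?N) \<le> infsum ?f Omega"
      by (rule finite_sum_le_infsum[OF u]) (auto simp: nn)
    finally show "(\<Sum>(r, s)\<in>Omega_upto n. if j < r + s then real (r + s) * u r s else 0) \<le> \<epsilon>"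
      using j by linarith
  qed
qed

text \<open>De la Vallee-Poussin weight: \<open>G m = \<Sum>\<^sub>k (m - R k)\<^sup>+\<close>, where the cutoffs \<open>R k\<close> at least double
  (so that \<open>m (G (m + 1) - G m) \<le> 2 G m + m\<close>) and the mass beyond \<open>R k\<close> is at most \<open>2\<^sup>-\<^sup>k\<close>.\<close>

lemma superlinear_weight_exists:
  fixes u :: bd_seq
  assumes u: "(\<lambda>(r, s). real (r + s) * u r s) summable_on Omega" and nn: "\<And>r s. 1 \<le> r + s \<Longrightarrow> 0 \<le> u r s"
  obtains G :: "nat \<Rightarrow> real" where "G 1 = 0" "\<And>m. 0 \<le> G m" "\<And>m. G m \<le> G (Suc m)"
    "\<And>m. real m * (G (Suc m) - G m) \<le> 2 * G m + real m"
    "\<And>A. \<exists>m0. \<forall>m\<ge>m0. A * real m \<le> G m"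
    "\<And>n. (\<Sum>(r, s)\<in>Omega_upto n. G (r + s) * u r s) \<le> 2"
proof -
  define tail where "tail j n = (\<Sum>(r, s)\<in>Omega_upto n. if j < r + s then real (r + s) * u r s else 0)" for j n
  have "\<exists>j. \<forall>n. tail j n \<le> (1 / 2) ^ k" for k
    unfolding tail_def by (rule tail_weight_exists[OF u nn, of "(1 / 2) ^ k"]) auto
  then obtain f where f: "\<And>k n. tail (f k) n \<le> (1 / 2) ^ k"
    by metis
  \<comment> \<open>The sum over all earlier indices keeps \<open>R k\<close> above
    \<open>f k\<close>, and the power of 3 makes the cutoffs at least triple, whence also
    \<open>k < R k\<close>.\<close>
  define R where "R k = 3 ^ k * (1 + (\<Sum>i\<le>k. f i))" for k :: nat
  have R_Suc: "3 * R k \<le> R (Suc k)" for k by (simp add: R_def)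
  have R1: "1 \<le> R k" for k by (simp add: R_def Suc_le_eq)
  have R_lin: "k < R k" for k
  proof (induction k)
    case (Suc k)
    then show ?case using R_Suc[of k] by linarith
  qed (use R1[of 0] in simp)
  have R_mono: "k \<le> l \<Longrightarrow> R k \<le> R l" for k l
  proof (rule lift_Suc_mono_le[of R])
    show "R n \<le> R (Suc n)" for n using R_Suc[of n] by simp
  qed
  have R_double: "3 * R k \<le> R l" if "k < l" for k l
    using R_mono[of "Suc k" l] R_Suc[of k] that by linarith
  have R_f: "f k \<le> R k" for k
  proof -
    have "f k \<le> (\<Sum>i\<le>k. f i)" by (rule member_le_sum) auto
    also have "\<dots> \<le> 1 * (1 + (\<Sum>i\<le>k. f i))" by simp
    also have "\<dots> \<le> 3 ^ k * (1 + (\<Sum>i\<le>k. f i))" by (rule mult_right_mono) auto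
    finally show ?thesis by (simp add: R_def)
  qed
  define G where "G m = (\<Sum>k<m. real (m - R k))" for m
  \<comment> \<open>Terms with k at least m vanish because \<open>k < R k\<close>; the upper limit
    of the sum can thus be adapted to the situation.\<close>
  have G_ext: "G m = (\<Sum>k<N. real (m - R k))" if "m \<le> N" for m N
    unfolding G_def
  proof (rule sum.mono_neutral_left)
    show "\<forall>i\<in>{..<N} - {..<m}. real (m - R i) = 0"
    proof
      fix i assume "i \<in> {..<N} - {..<m}"
      then show "real (m - R i) = 0" using R_lin[of i] by simp
    qed
  qed (use that in auto)
  have G_Suc: "G (Suc m) - G m = (\<Sum>k<Suc m. of_bool (R k \<le> m))" for m
    unfolding G_ext[of "Suc m" "Suc m", OF order_refl] G_ext[of m "Suc m", OF le_SucI[OF order_refl]]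
      sum_subtractf[symmetric]
    by (rule sum.cong) (auto simp: of_nat_diff Suc_diff_le)
  show thesis
  proof (rule that[of G])
    show "G 1 = 0" using R1[of 0] by (simp add: G_def)
    show "0 \<le> G m" for m by (simp add: G_def sum_nonneg)
    show "G m \<le> G (Suc m)" for m
    proof -
      have "0 \<le> G (Suc m) - G m" unfolding G_Suc by (rule sum_nonneg) simp
      then show ?thesis by simp
    qed
    show "real m * (G (Suc m) - G m) \<le> 2 * G m + real m" for m
    proof -
      \<comment> \<open>A cutoff not above m satisfies \<open>m \<le> 2 * (m - R k)\<close> unless
        it lies in the upper half (m / 2, m]. As the cutoffs triple, at most one of them does, and
        it costs a single additional m.\<close>
      let ?Q = "{k. k < Suc m \<and> R k \<le> m \<and> m < 2 * R k}"
      have "k = l" if "k \<in> ?Q" "l \<in> ?Q" for k l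
        using R_double[of k l] R_double[of l k] that by (cases k l rule: linorder_cases) auto
      then have Q: "card ?Q \<le> 1" by (simp add: card_le_Suc0_iff_eq)
      have "real m * (G (Suc m) - G m) = (\<Sum>k<Suc m. real m * of_bool (R k \<le> m))"
        unfolding G_Suc by (rule sum_distrib_left)
      also have "\<dots> \<le> (\<Sum>k<Suc m. 2 * real (m - R k) + (if R k \<le> m \<and> m < 2 * R k then real m else 0))"
        by (rule sum_mono) (auto simp: of_nat_diff)
      also have "\<dots> = 2 * G m + real m * real (card ?Q)"
      proof -
        have "(\<Sum>k<Suc m. (if R k \<le> m \<and> m < 2 * R k then real m else 0)) = (\<Sum>k\<in>?Q. real m)"
          by (rule sum.mono_neutral_cong_right) auto
        then show ?thesis
          by (simp add: sum.distrib sum_distrib_left[symmetric] G_ext[of m "Suc m"])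
      qed
      also have "\<dots> \<le> 2 * G m + real m * 1" using Q by (intro add_left_mono mult_left_mono) auto
      finally show ?thesis by simp
    qed
    show "\<exists>m0. \<forall>m\<ge>m0. A * real m \<le> G m" for A
    proof -
      \<comment> \<open>For m at least \<open>2 * R K\<close> each of the first K summands is at
        least m / 2, so K of order 2 A suffices.\<close>
      obtain K where K: "2 * A \<le> real K" using real_arch_simple by blast
      have "A * real m \<le> G m" if m: "m \<ge> 2 * R K" for m
      proof -
        have "real m / 2 \<le> real (m - R k)" if "k < K" for k
          using R_mono[of k K] that m by (simp add: of_nat_diff)
        then have "(\<Sum>k<K. real m / 2) \<le> (\<Sum>k<K. real (m - R k))" by (intro sum_mono) auto
        also have "\<dots> \<le> G m"
          unfolding G_def by (rule sum_mono2) (use m R_lin[of K] in auto)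
        finally have "real K * (real m / 2) \<le> G m" by simp
        moreover have "2 * A * (real m / 2) \<le> real K * (real m / 2)" by (rule mult_right_mono[OF K]) simp
        ultimately show ?thesis by simp
      qed
      then show ?thesis by blast
    qed
    show "(\<Sum>(r, s)\<in>Omega_upto n. G (r + s) * u r s) \<le> 2" for n
    proof -
      have "(\<Sum>(r, s)\<in>Omega_upto n. G (r + s) * u r s)
          = (\<Sum>p\<in>Omega_upto n. \<Sum>k<n. (\<lambda>(r, s). real (r + s - R k) * u r s) p)"
        by (rule sum.cong) (auto simp: G_ext sum_distrib_right)
      also have "\<dots> = (\<Sum>k<n. \<Sum>(r, s)\<in>Omega_upto n. real (r + s - R k) * u r s)"
        by (subst sum.swap) simp
      also have "\<dots> \<le> (\<Sum>k<n. (1 / 2) ^ k)"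
      proof (rule sum_mono)
        fix k
        have "(\<Sum>(r, s)\<in>Omega_upto n. real (r + s - R k) * u r s)
            \<le> tail (f k) n"
          unfolding tail_def by (rule sum_mono) (use R_f[of k] in \<open>auto simp: nn intro!: mult_right_mono\<close>)
        also have "\<dots> \<le> (1 / 2) ^ k" by (rule f)
        finally show "(\<Sum>(r, s)\<in>Omega_upto n. real (r + s - R k) * u r s) \<le> (1 / 2) ^ k" .
      qed
      also have "\<dots> \<le> 2" by (simp add: sum_gp_strict)
      finally show ?thesis .
    qed
  qed
qed

subsection \<open>The truncated Euler scheme\<close>

lemma sum_Omega_upto_monomers:
  assumes "1 \<le> n"
  shows "(\<Sum>(r, s)\<in>Omega_upto n. if r + s = 1 then f r s else 0) = f 1 0 + (f 0 1 :: real)"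
proof -
  have "(\<Sum>(r, s)\<in>Omega_upto n. if r + s = 1 then f r s else 0)
      = (\<Sum>(r, s)\<in>Omega_upto 1. if r + s = 1 then f r s else 0)"
    by (rule sum.mono_neutral_right) (use assms Omega_upto_mono in auto)
  then show ?thesis by (simp add: Omega_upto_1[simplified])
qed

locale bd_euler = bd_coefficients +
  fixes c0 :: bd_seq
  assumes c0_Xplus: "c0 \<in> bd_Xplus"
begin

definition "M = bd_norm c0"

text \<open>No reaction of the truncated system produces a cluster of size larger than \<open>n\<close>.\<close>

definition trunc_flux :: "nat \<Rightarrow> bd_seq \<Rightarrow> bd_seq" where
  "trunc_flux n c r s = (if r + s < n then flux a b c r s else 0)"

definition trunc_fluxdot :: "nat \<Rightarrow> bd_seq \<Rightarrow> bd_seq" where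
  "trunc_fluxdot n c r s = (if r + s < n then fluxdot adot bdot c r s else 0)"

definition trunc_rhs :: "nat \<Rightarrow> bd_seq \<Rightarrow> bd_seq" where
  "trunc_rhs n c r s =
    (if (r, s) = (1, 0) then - (trunc_flux n c 1 0 + trunc_fluxdot n c 1 0
        + (\<Sum>(r, s)\<in>Omega_upto n. trunc_flux n c r s))
     else if (r, s) = (0, 1) then - (trunc_flux n c 0 1 + trunc_fluxdot n c 0 1
        + (\<Sum>(r, s)\<in>Omega_upto n. trunc_fluxdot n c r s))
     else - (Delta_r (trunc_flux n c) r s + Delta_s (trunc_fluxdot n c) r s))"

text \<open>Weak form of the truncated system: attaching a monomer replaces two clusters by one,
  which changes the weighted total by the bracket. Three choices are used later. The weights r and s
  annihilate the brackets and give conservation, the constant 1 gives - 1 and counts clusters, and a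
  function of the size gives a moment.\<close>

lemma sum_weight_trunc_rhs:
  assumes n: "1 \<le> n"
  shows "(\<Sum>(r, s)\<in>Omega_upto n. \<phi> r s * trunc_rhs n c r s) =
    (\<Sum>(r, s)\<in>Omega_upto n. trunc_flux n c r s * (\<phi> (r + 1) s - \<phi> r s - \<phi> 1 0)
      + trunc_fluxdot n c r s * (\<phi> r (s + 1) - \<phi> r s - \<phi> 0 1))"
proof -
  \<comment> \<open>Summation by parts is applied to the part of \<open>\<phi>\<close> living on
    sizes 2 to \<open>n\<close>. The two monomer values are added by hand, with the monomer
    equations supplying the flux sums.\<close>
  define w where "w r s = (if 2 \<le> r + s \<and> r + s \<le> n then \<phi> r s else 0)" for r s
  let ?B = "Omega_upto n" and ?J = "trunc_flux n c" and ?Jd = "trunc_fluxdot n c"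
  have w: "w 1 0 = 0" "w 0 1 = 0" "\<And>r s. n < r + s \<Longrightarrow> w r s = 0" by (auto simp: w_def)
  have "(\<Sum>(r, s)\<in>?B. \<phi> r s * trunc_rhs n c r s)
      = (\<Sum>(r, s)\<in>?B. - (w r s * Delta_r ?J r s) - w r s * Delta_s ?Jd r s
          + (if r + s = 1 then \<phi> r s * trunc_rhs n c r s else 0))"
  proof (rule sum.cong, simp, clarify)
    fix r s assume rs: "(r, s) \<in> ?B"
    show "\<phi> r s * trunc_rhs n c r s = - (w r s * Delta_r ?J r s) - w r s * Delta_s ?Jd r s
        + (if r + s = 1 then \<phi> r s * trunc_rhs n c r s else 0)"
    proof (cases "2 \<le> r + s")
      case True
      then have eq: "trunc_rhs n c r s = - (Delta_r ?J r s + Delta_s ?Jd r s)"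
        by (auto simp: trunc_rhs_def)
      show ?thesis unfolding eq using True rs by (simp add: w_def algebra_simps)
    next
      case False
      then show ?thesis using rs by (auto simp: w_def)
    qed
  qed
  also have "\<dots> = - (\<Sum>(r, s)\<in>?B. w r s * Delta_r ?J r s) - (\<Sum>(r, s)\<in>?B. w r s * Delta_s ?Jd r s)
      + (\<Sum>(r, s)\<in>?B. if r + s = 1 then \<phi> r s * trunc_rhs n c r s else 0)"
    by (simp add: split_def sum.distrib sum_subtractf sum_negf)
  also have "\<dots> = (\<Sum>(r, s)\<in>?B. ?J r s * (w (r + 1) s - w r s)) + (\<Sum>(r, s)\<in>?B. ?Jd r s * (w r (s + 1) - w r s))
      + (\<phi> 1 0 * trunc_rhs n c 1 0 + \<phi> 0 1 * trunc_rhs n c 0 1)"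
    using sum_Delta_r_parts[of w n ?J, OF w] sum_Delta_s_parts[of w n ?Jd, OF w]
      sum_Omega_upto_monomers[OF n, of "\<lambda>r s. \<phi> r s * trunc_rhs n c r s"] by linarith
  also have "\<dots> = (\<Sum>(r, s)\<in>?B. ?J r s * (w (r + 1) s - w r s)) + (\<Sum>(r, s)\<in>?B. ?Jd r s * (w r (s + 1) - w r s))
      - (\<Sum>(r, s)\<in>?B. if r + s = 1 then \<phi> r s * (?J r s + ?Jd r s) else 0)
      - \<phi> 1 0 * (\<Sum>(r, s)\<in>?B. ?J r s) - \<phi> 0 1 * (\<Sum>(r, s)\<in>?B. ?Jd r s)"
    unfolding sum_Omega_upto_monomers[OF n] by (simp add: trunc_rhs_def algebra_simps)
  also have "\<dots> = (\<Sum>(r, s)\<in>?B. ?J r s * (w (r + 1) s - w r s) + ?Jd r s * (w r (s + 1) - w r s)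
      - (if r + s = 1 then \<phi> r s * (?J r s + ?Jd r s) else 0) - \<phi> 1 0 * ?J r s - \<phi> 0 1 * ?Jd r s)"
    by (simp add: split_def sum.distrib sum_subtractf sum_distrib_left)
  also have "\<dots> = (\<Sum>(r, s)\<in>?B. ?J r s * (\<phi> (r + 1) s - \<phi> r s - \<phi> 1 0)
      + ?Jd r s * (\<phi> r (s + 1) - \<phi> r s - \<phi> 0 1))"
  proof (rule sum.cong, simp, clarify)
    fix r s assume rs: "(r, s) \<in> ?B"
    show "?J r s * (w (r + 1) s - w r s) + ?Jd r s * (w r (s + 1) - w r s)
      - (if r + s = 1 then \<phi> r s * (?J r s + ?Jd r s) else 0) - \<phi> 1 0 * ?J r s - \<phi> 0 1 * ?Jd r s
      = ?J r s * (\<phi> (r + 1) s - \<phi> r s - \<phi> 1 0) + ?Jd r s * (\<phi> r (s + 1) - \<phi> r s - \<phi> 0 1)"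
    proof (cases "r + s < n")
      case True
      have 1: "w (r + 1) s = \<phi> (r + 1) s" "w r (s + 1) = \<phi> r (s + 1)"
        "w r s = (if r + s = 1 then 0 else \<phi> r s)"
        using True rs by (auto simp: w_def)
      show ?thesis unfolding 1 by (simp add: algebra_simps)
    qed (simp add: trunc_flux_def trunc_fluxdot_def)
  qed
  finally show ?thesis .
qed

section \<open>Positivity and conservation in the scheme\<close>

text \<open>The invariant of the scheme. The masses are those of the initial data cut off at size
  \<open>n\<close>, not of \<open>c0\<close> itself; positivity is also required at the junk index
  (0, 0), which saves side conditions.\<close>

definition admissible :: "nat \<Rightarrow> bd_seq \<Rightarrow> bool" where
  "admissible n c \<longleftrightarrow> (\<forall>r s. 0 \<le> c r s) \<and> (\<forall>r s. n < r + s \<longrightarrow> c r s = 0) \<and>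
    (\<Sum>(r, s)\<in>Omega_upto n. real r * c r s) = (\<Sum>(r, s)\<in>Omega_upto n. real r * c0 r s) \<and>
    (\<Sum>(r, s)\<in>Omega_upto n. real s * c r s) = (\<Sum>(r, s)\<in>Omega_upto n. real s * c0 r s)"

lemma M_nonneg: "0 \<le> M"
  using Xplus_le_norm[OF c0_Xplus, of 1 0] Xplus_nonneg[OF c0_Xplus, of 1 0] by (simp add: M_def)

lemma admissible_mass:
  assumes c: "admissible n c"
  shows "(\<Sum>(r, s)\<in>Omega_upto n. real (r + s) * c r s) \<le> M"
proof -
  have split: "(\<Sum>(r, s)\<in>Omega_upto n. real (r + s) * c r s) = (\<Sum>(r, s)\<in>Omega_upto n. real r * c r s)
      + (\<Sum>(r, s)\<in>Omega_upto n. real s * c r s)" for c :: bd_seq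
    by (simp add: split_def sum.distrib[symmetric] algebra_simps)
  have "(\<Sum>(r, s)\<in>Omega_upto n. real (r + s) * c r s) = (\<Sum>(r, s)\<in>Omega_upto n. real (r + s) * c0 r s)"
    unfolding split using c by (simp add: admissible_def)
  also have "\<dots> \<le> M"
    unfolding M_def by (rule Xplus_finite_sum_le[OF c0_Xplus finite_Omega_upto Omega_upto_subset])
  finally show ?thesis .
qed

lemma admissible_mass_upto:
  assumes c: "admissible n c"
  shows "(\<Sum>(r, s)\<in>Omega_upto k. real (r + s) * c r s) \<le> M"
proof -
  have "(\<Sum>(r, s)\<in>Omega_upto k. real (r + s) * c r s) \<le> (\<Sum>(r, s)\<in>Omega_upto (max k n). real (r + s) * c r s)"
    by (rule sum_mono2) (use c in \<open>auto simp: admissible_def\<close>)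
  also have "\<dots> = (\<Sum>(r, s)\<in>Omega_upto n. real (r + s) * c r s)"
    by (rule sum.mono_neutral_right) (use c in \<open>auto simp: admissible_def\<close>)
  finally show ?thesis using admissible_mass[OF c] by simp
qed

lemma admissible_le:
  assumes c: "admissible n c" and rs: "1 \<le> r + s"
  shows "c r s \<le> M"
proof -
  have nn: "0 \<le> c r s" for r s using c by (simp add: admissible_def)
  have "1 * c r s \<le> real (r + s) * c r s" by (rule mult_right_mono[OF _ nn]) (use rs in simp)
  also have "\<dots> \<le> (\<Sum>(r, s)\<in>Omega_upto (r + s). real (r + s) * c r s)"
    using member_le_sum[of "(r, s)" "Omega_upto (r + s)" "\<lambda>(r, s). real (r + s) * c r s"] nn rs by auto
  also have "\<dots> \<le> M" by (rule admissible_mass_upto[OF c])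
  finally show ?thesis by simp
qed

text \<open>A common bound for the coefficients at sizes up to \<open>n\<close>. It may grow
  arbitrarily fast with \<open>n\<close>; this is harmless because it is used only to choose the
  time step.\<close>

definition coeff_sum :: "nat \<Rightarrow> real" where
  "coeff_sum n = (\<Sum>(r, s)\<in>Omega_upto n. a r s + adot r s + b (r + 1) s + bdot r (s + 1))"

lemma coeff_sum_nonneg: "0 \<le> coeff_sum n"
  unfolding coeff_sum_def
  by (rule sum_nonneg) (use a_nonneg adot_nonneg b_nonneg bdot_nonneg in auto)

lemma coeff_le_sum:
  assumes "1 \<le> r + s" "r + s \<le> n"
  shows "a r s \<le> coeff_sum n" "adot r s \<le> coeff_sum n" "b (r + 1) s \<le> coeff_sum n"
    "bdot r (s + 1) \<le> coeff_sum n"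
proof -
  have "(\<lambda>(r, s). a r s + adot r s + b (r + 1) s + bdot r (s + 1)) (r, s) \<le> coeff_sum n"
    unfolding coeff_sum_def
    by (rule member_le_sum) (use assms a_nonneg adot_nonneg b_nonneg bdot_nonneg in auto)
  then show "a r s \<le> coeff_sum n" "adot r s \<le> coeff_sum n" "b (r + 1) s \<le> coeff_sum n"
    "bdot r (s + 1) \<le> coeff_sum n"
    using a_nonneg[OF assms(1)] adot_nonneg[OF assms(1)] b_nonneg[OF assms(1)] bdot_nonneg[OF assms(1)]
    by auto
qed

lemma trunc_flux_le:
  assumes c: "admissible n c" and rs: "1 \<le> r + s"
  shows "trunc_flux n c r s \<le> c 1 0 * (a r s * c r s)" "trunc_fluxdot n c r s \<le> c 0 1 * (adot r s * c r s)"
    "- (b (r + 1) s * c (r + 1) s) \<le> trunc_flux n c r s"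
    "- (bdot r (s + 1) * c r (s + 1)) \<le> trunc_fluxdot n c r s"
proof -
  have nn: "0 \<le> c r s" for r s using c by (simp add: admissible_def)
  have "0 \<le> c 1 0 * (a r s * c r s)" "0 \<le> c 0 1 * (adot r s * c r s)"
    "0 \<le> b (r + 1) s * c (r + 1) s" "0 \<le> bdot r (s + 1) * c r (s + 1)"
    by (intro mult_nonneg_nonneg nn a_nonneg adot_nonneg b_nonneg bdot_nonneg rs)+
  then show "trunc_flux n c r s \<le> c 1 0 * (a r s * c r s)" "trunc_fluxdot n c r s \<le> c 0 1 * (adot r s * c r s)"
    "- (b (r + 1) s * c (r + 1) s) \<le> trunc_flux n c r s"
    "- (bdot r (s + 1) * c r (s + 1)) \<le> trunc_fluxdot n c r s"
    by (auto simp: trunc_flux_def trunc_fluxdot_def flux_def fluxdot_def algebra_simps)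
qed

text \<open>Each bound contains the concentration that the reaction consumes: (r, s) for growth, the
  larger cluster for fragmentation. Losses proportional to what is present cannot lead to negative
  values if the time step is small.\<close>

lemma trunc_flux_coeff_bounds:
  assumes c: "admissible n c" and rs: "1 \<le> r + s"
  shows "trunc_flux n c r s \<le> coeff_sum n * M * c r s" "trunc_fluxdot n c r s \<le> coeff_sum n * M * c r s"
    "- (coeff_sum n * c (r + 1) s) \<le> trunc_flux n c r s" "- (coeff_sum n * c r (s + 1)) \<le> trunc_fluxdot n c r s"
proof -
  have nn: "0 \<le> c r s" for r s using c by (simp add: admissible_def)
  have R: "0 \<le> coeff_sum n * M * c r s" "0 \<le> coeff_sum n * c (r + 1) s" "0 \<le> coeff_sum n * c r (s + 1)"
    by (intro mult_nonneg_nonneg nn coeff_sum_nonneg M_nonneg)+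
  have "trunc_flux n c r s \<le> coeff_sum n * M * c r s \<and> trunc_fluxdot n c r s \<le> coeff_sum n * M * c r s
    \<and> - (coeff_sum n * c (r + 1) s) \<le> trunc_flux n c r s \<and> - (coeff_sum n * c r (s + 1)) \<le> trunc_fluxdot n c r s"
  proof (cases "r + s < n")
    case True
    have le: "a r s \<le> coeff_sum n" "adot r s \<le> coeff_sum n" "b (r + 1) s \<le> coeff_sum n"
      "bdot r (s + 1) \<le> coeff_sum n"
      using coeff_le_sum[OF rs] True by auto
    have "c 1 0 * (a r s * c r s) \<le> M * (coeff_sum n * c r s)"
      "c 0 1 * (adot r s * c r s) \<le> M * (coeff_sum n * c r s)"
      by (intro mult_mono mult_right_mono admissible_le[OF c] le nn M_nonneg mult_nonneg_nonneg
          a_nonneg adot_nonneg rs coeff_sum_nonneg; simp)+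
    moreover have "b (r + 1) s * c (r + 1) s \<le> coeff_sum n * c (r + 1) s"
      "bdot r (s + 1) * c r (s + 1) \<le> coeff_sum n * c r (s + 1)"
      by (intro mult_right_mono le nn)+
    ultimately show ?thesis using trunc_flux_le[OF c rs] by (simp add: algebra_simps)
  next
    case False
    then show ?thesis using R by (simp add: trunc_flux_def trunc_fluxdot_def)
  qed
  then show "trunc_flux n c r s \<le> coeff_sum n * M * c r s" "trunc_fluxdot n c r s \<le> coeff_sum n * M * c r s"
    "- (coeff_sum n * c (r + 1) s) \<le> trunc_flux n c r s" "- (coeff_sum n * c r (s + 1)) \<le> trunc_fluxdot n c r s"
    by blast+
qed

text \<open>The attached monomer is consumed by all growth reactions at once; its concentration is
  their common factor and is kept, while the other concentration is bounded by
  \<open>M\<close>.\<close>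

lemma sum_trunc_flux_le:
  assumes c: "admissible n c"
  shows "(\<Sum>(r, s)\<in>Omega_upto n. trunc_flux n c r s) \<le> coeff_sum n * M * c 1 0"
    "(\<Sum>(r, s)\<in>Omega_upto n. trunc_fluxdot n c r s) \<le> coeff_sum n * M * c 0 1"
proof -
  have nn: "0 \<le> c r s" for r s using c by (simp add: admissible_def)
  have one: "(\<Sum>(r, s)\<in>Omega_upto n. h r s) \<le> coeff_sum n * M * z"
    if h: "\<And>r s. 1 \<le> r + s \<Longrightarrow> h r s \<le> z * (k r s * c r s)"
      and k: "\<And>r s. 1 \<le> r + s \<Longrightarrow> 0 \<le> k r s \<and> k r s \<le> a r s + adot r s" and z: "0 \<le> z"
    for h k :: bd_seq and z
  proof -
    have "(\<Sum>(r, s)\<in>Omega_upto n. h r s)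
        \<le> (\<Sum>(r, s)\<in>Omega_upto n. z * M * (a r s + adot r s + b (r + 1) s + bdot r (s + 1)))"
    proof (rule sum_mono, clarify)
      fix r s assume "(r, s) \<in> Omega_upto n"
      then have rs: "1 \<le> r + s" by simp
      have "h r s \<le> z * (k r s * c r s)" by (rule h[OF rs])
      also have "\<dots> \<le> z * ((a r s + adot r s + b (r + 1) s + bdot r (s + 1)) * M)"
        using k[OF rs] b_nonneg[OF rs] bdot_nonneg[OF rs]
        by (intro mult_left_mono mult_mono admissible_le[OF c rs] nn z) auto
      finally show "h r s \<le> z * M * (a r s + adot r s + b (r + 1) s + bdot r (s + 1))"
        by (simp add: algebra_simps)
    qed
    also have "\<dots> = coeff_sum n * M * z"
      by (simp add: coeff_sum_def sum_distrib_left[symmetric] split_def)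
    finally show ?thesis .
  qed
  show "(\<Sum>(r, s)\<in>Omega_upto n. trunc_flux n c r s) \<le> coeff_sum n * M * c 1 0"
    by (rule one[of _ _ a]) (use trunc_flux_le(1)[OF c] a_nonneg adot_nonneg nn in auto)
  show "(\<Sum>(r, s)\<in>Omega_upto n. trunc_fluxdot n c r s) \<le> coeff_sum n * M * c 0 1"
    by (rule one[of _ _ adot]) (use trunc_flux_le(2)[OF c] a_nonneg adot_nonneg nn in auto)
qed

text \<open>A monomer loses through its own two growth fluxes and through the flux sum, three terms
  with a factor \<open>M\<close>. A larger cluster loses through two growth and two fragmentation
  terms. The constant covers both cases.\<close>

definition rate_const :: "nat \<Rightarrow> real" where
  "rate_const n = (3 * M + 2) * coeff_sum n"

lemma trunc_rhs_ge:
  assumes c: "admissible n c"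
  shows "- (rate_const n * c r s) \<le> trunc_rhs n c r s"
proof -
  let ?K = "coeff_sum n"
  have nn: "0 \<le> c r s" for r s using c by (simp add: admissible_def)
  have R: "0 \<le> ?K * M * c r s" "0 \<le> ?K * c r s" for r s
    by (intro mult_nonneg_nonneg nn coeff_sum_nonneg M_nonneg)+
  have rate: "rate_const n * c r s = 3 * (?K * M * c r s) + 2 * (?K * c r s)" for r s
    by (simp add: rate_const_def algebra_simps)
  consider "(r, s) = (1, 0)" | "(r, s) = (0, 1)" | "(r, s) \<noteq> (1, 0)" "(r, s) \<noteq> (0, 1)" by blast
  then show ?thesis
  proof cases
    case 1
    then show ?thesis
      using trunc_flux_coeff_bounds(1,2)[OF c, of 1 0] sum_trunc_flux_le(1)[OF c] R(2)[of 1 0]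
      unfolding rate by (simp add: trunc_rhs_def)
  next
    case 2
    then show ?thesis
      using trunc_flux_coeff_bounds(1,2)[OF c, of 0 1] sum_trunc_flux_le(2)[OF c] R(2)[of 0 1]
      unfolding rate by (simp add: trunc_rhs_def)
  next
    case 3
    have z: "zero_ext (trunc_flux n c) r s \<le> ?K * M * c r s" "zero_ext (trunc_fluxdot n c) r s \<le> ?K * M * c r s"
      using trunc_flux_coeff_bounds(1,2)[OF c] R(1)[of r s] by (auto simp: zero_ext_def)
    have zr: "- (?K * c r s) \<le> (if r = 0 then 0 else zero_ext (trunc_flux n c) (r - 1) s)"
      using trunc_flux_coeff_bounds(3)[OF c, of "r - 1" s] R(2)[of r s] by (auto simp: zero_ext_def)
    have zs: "- (?K * c r s) \<le> (if s = 0 then 0 else zero_ext (trunc_fluxdot n c) r (s - 1))"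
      using trunc_flux_coeff_bounds(4)[OF c, of r "s - 1"] R(2)[of r s] by (auto simp: zero_ext_def)
    have "trunc_rhs n c r s = - (Delta_r (trunc_flux n c) r s + Delta_s (trunc_fluxdot n c) r s)"
      using 3 by (auto simp: trunc_rhs_def)
    then show ?thesis
      using z zr zs R(1)[of r s] unfolding rate Delta_r_def Delta_s_def by linarith
  qed
qed

text \<open>The first summand of the denominator preserves positivity, the others make the step
  positive, well defined and convergent to 0.\<close>

definition dt :: "nat \<Rightarrow> real" where
  "dt n = 1 / (rate_const n + real n + 1)"

lemma rate_const_nonneg: "0 \<le> rate_const n"
  using M_nonneg coeff_sum_nonneg by (simp add: rate_const_def)

lemma dt_pos: "0 < dt n" and dt_le: "dt n \<le> 1 / (real n + 1)" and dt_rate: "dt n * rate_const n \<le> 1"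
  using rate_const_nonneg[of n] by (auto simp: dt_def field_simps intro!: divide_left_mono mult_pos_pos)

primrec euler :: "nat \<Rightarrow> nat \<Rightarrow> bd_seq" where
  "euler n 0 = (\<lambda>r s. if 1 \<le> r + s \<and> r + s \<le> n then c0 r s else 0)"
| "euler n (Suc k) = (\<lambda>r s. euler n k r s + dt n * trunc_rhs n (euler n k) r s)"

lemma sum_weight_euler_Suc:
  assumes "1 \<le> n"
  shows "(\<Sum>(r, s)\<in>Omega_upto n. \<phi> r s * euler n (Suc k) r s) = (\<Sum>(r, s)\<in>Omega_upto n. \<phi> r s * euler n k r s)
    + dt n * (\<Sum>(r, s)\<in>Omega_upto n. trunc_flux n (euler n k) r s * (\<phi> (r + 1) s - \<phi> r s - \<phi> 1 0)
      + trunc_fluxdot n (euler n k) r s * (\<phi> r (s + 1) - \<phi> r s - \<phi> 0 1))"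
  unfolding sum_weight_trunc_rhs[OF assms, symmetric]
  by (simp add: split_def sum_distrib_left sum.distrib algebra_simps)

lemma euler_admissible:
  assumes n: "1 \<le> n"
  shows "admissible n (euler n k)"
proof (induction k)
  case 0
  have "(\<Sum>(r, s)\<in>Omega_upto n. h r s * euler n 0 r s) = (\<Sum>(r, s)\<in>Omega_upto n. h r s * c0 r s)" for h :: bd_seq
    by (rule sum.cong) auto
  then show ?case by (simp add: admissible_def Xplus_nonneg[OF c0_Xplus])
next
  case (Suc k)
  let ?c = "euler n k"
  have nn: "0 \<le> ?c r s" for r s using Suc by (simp add: admissible_def)
  have "0 \<le> euler n (Suc k) r s" for r s
  proof -
    have "dt n * - (rate_const n * ?c r s) \<le> dt n * trunc_rhs n ?c r s"
      by (rule mult_left_mono[OF trunc_rhs_ge[OF Suc]]) (use dt_pos[of n] in simp)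
    moreover have "dt n * rate_const n * ?c r s \<le> 1 * ?c r s"
      by (rule mult_right_mono[OF dt_rate nn])
    ultimately show ?thesis by simp
  qed
  moreover have "euler n (Suc k) r s = 0" if "n < r + s" for r s
  proof -
    have "trunc_rhs n ?c r s = 0"
      using that n by (auto simp: trunc_rhs_def Delta_r_def Delta_s_def zero_ext_def
          trunc_flux_def trunc_fluxdot_def)
    then show ?thesis using Suc that by (simp add: admissible_def)
  qed
  moreover have "(\<Sum>(r, s)\<in>Omega_upto n. real r * euler n (Suc k) r s) = (\<Sum>(r, s)\<in>Omega_upto n. real r * c0 r s)"
    using Suc unfolding sum_weight_euler_Suc[OF n, of "\<lambda>r s. real r"] by (simp add: admissible_def)
  moreover have "(\<Sum>(r, s)\<in>Omega_upto n. real s * euler n (Suc k) r s) = (\<Sum>(r, s)\<in>Omega_upto n. real s * c0 r s)"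
    using Suc unfolding sum_weight_euler_Suc[OF n, of "\<lambda>r s. real s"] by (simp add: admissible_def)
  ultimately show ?case unfolding admissible_def by blast
qed

section \<open>Estimates uniform in the truncation level\<close>

lemma euler_growth_le:
  assumes n: "1 \<le> n" and rs: "1 \<le> r + s" and d: "0 \<le> d"
  shows "d * (euler n k 1 0 * (a r s * euler n k r s) + euler n k 0 1 * (adot r s * euler n k r s))
    \<le> C * M * (real (r + s) * d * euler n k r s)"
proof -
  let ?c = "euler n k"
  note c = euler_admissible[OF n, of k]
  have nn: "0 \<le> ?c r s" for r s using c by (simp add: admissible_def)
  have "?c 1 0 * (a r s * ?c r s) + ?c 0 1 * (adot r s * ?c r s) \<le> M * (a r s * ?c r s) + M * (adot r s * ?c r s)"
    by (intro add_mono mult_right_mono admissible_le[OF c] mult_nonneg_nonneg nn a_nonneg adot_nonneg rs) auto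
  also have "\<dots> = M * ?c r s * (a r s + adot r s)" by (simp add: algebra_simps)
  also have "\<dots> \<le> M * ?c r s * (C * real (r + s))"
    by (intro mult_left_mono growth rs mult_nonneg_nonneg M_nonneg nn)
  finally have "d * (?c 1 0 * (a r s * ?c r s) + ?c 0 1 * (adot r s * ?c r s)) \<le> d * (M * ?c r s * (C * real (r + s)))"
    by (rule mult_left_mono[OF _ d])
  then show ?thesis by (simp add: algebra_simps)
qed

text \<open>A discrete Gronwall argument. Adding \<open>M\<close> to the moment makes the affine
  recursion multiplicative, and 1 + x is at most exp x, so the growth factor depends on the elapsed
  time and not on the number of steps.\<close>

lemma euler_moment_le:
  assumes n: "1 \<le> n"
    and G: "G 1 = 0" "\<And>m. 0 \<le> G m" "\<And>m. G m \<le> G (Suc m)"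
      "\<And>m. real m * (G (Suc m) - G m) \<le> 2 * G m + real m"
  shows "(\<Sum>(r, s)\<in>Omega_upto n. G (r + s) * euler n k r s)
    \<le> ((\<Sum>(r, s)\<in>Omega_upto n. G (r + s) * c0 r s) + M) * exp (2 * C * M * (real k * dt n))"
proof -
  define S where "S k = (\<Sum>(r, s)\<in>Omega_upto n. G (r + s) * euler n k r s)" for k
  have S_Suc: "S (Suc k) + M \<le> (S k + M) * exp (2 * C * M * dt n)" for k
  proof -
    let ?c = "euler n k"
    note c = euler_admissible[OF n, of k]
    have nn: "0 \<le> ?c r s" for r s using c by (simp add: admissible_def)
    have S0: "0 \<le> S k" unfolding S_def by (rule sum_nonneg) (use nn G(2) in auto)
    have "(\<Sum>(r, s)\<in>Omega_upto n. trunc_flux n ?c r s * (G (r + 1 + s) - G (r + s) - G (1 + 0))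
        + trunc_fluxdot n ?c r s * (G (r + (s + 1)) - G (r + s) - G (0 + 1)))
      \<le> (\<Sum>(r, s)\<in>Omega_upto n. C * M * ((2 * G (r + s) + real (r + s)) * ?c r s))"
    proof (rule sum_mono, clarify)
      fix r s assume "(r, s) \<in> Omega_upto n"
      then have rs: "1 \<le> r + s" by simp
      let ?d = "G (Suc (r + s)) - G (r + s)"
      have d: "0 \<le> ?d" using G(3)[of "r + s"] by simp
      have "trunc_flux n ?c r s * ?d + trunc_fluxdot n ?c r s * ?d
          \<le> ?c 1 0 * (a r s * ?c r s) * ?d + ?c 0 1 * (adot r s * ?c r s) * ?d"
        by (intro add_mono mult_right_mono trunc_flux_le[OF c rs] d)
      also have "\<dots> = ?d * (?c 1 0 * (a r s * ?c r s) + ?c 0 1 * (adot r s * ?c r s))"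
        by (simp add: algebra_simps)
      also have "\<dots> \<le> C * M * (real (r + s) * ?d * ?c r s)"
        by (rule euler_growth_le[OF n rs d])
      also have "\<dots> \<le> C * M * ((2 * G (r + s) + real (r + s)) * ?c r s)"
        by (intro mult_left_mono mult_right_mono G(4) nn mult_nonneg_nonneg C_nonneg M_nonneg)
      finally show "trunc_flux n ?c r s * (G (r + 1 + s) - G (r + s) - G (1 + 0))
        + trunc_fluxdot n ?c r s * (G (r + (s + 1)) - G (r + s) - G (0 + 1))
        \<le> C * M * ((2 * G (r + s) + real (r + s)) * ?c r s)"
        using G(1) by simp
    qed
    also have "\<dots> = C * M * (2 * S k + (\<Sum>(r, s)\<in>Omega_upto n. real (r + s) * ?c r s))"
      by (simp add: S_def split_def sum_distrib_left sum.distrib[symmetric] algebra_simps)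
    also have "\<dots> \<le> C * M * (2 * S k + M)"
      by (intro mult_left_mono add_left_mono admissible_mass[OF c] mult_nonneg_nonneg C_nonneg M_nonneg)
    also have "\<dots> \<le> C * M * (2 * (S k + M))"
      using M_nonneg C_nonneg by (intro mult_left_mono mult_nonneg_nonneg) auto
    finally have le: "(\<Sum>(r, s)\<in>Omega_upto n. trunc_flux n ?c r s * (G (r + 1 + s) - G (r + s) - G (1 + 0))
        + trunc_fluxdot n ?c r s * (G (r + (s + 1)) - G (r + s) - G (0 + 1))) \<le> C * M * (2 * (S k + M))" .
    have "S (Suc k) + M \<le> S k + dt n * (C * M * (2 * (S k + M))) + M"
      unfolding S_def sum_weight_euler_Suc[OF n, of "\<lambda>r s. G (r + s)"]
      using mult_left_mono[OF le, of "dt n"] dt_pos[of n] unfolding S_def by simp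
    also have "\<dots> = (S k + M) * (1 + 2 * C * M * dt n)" by (simp add: algebra_simps)
    also have "\<dots> \<le> (S k + M) * exp (2 * C * M * dt n)"
      using S0 M_nonneg by (intro mult_left_mono exp_ge_add_one_self) auto
    finally show ?thesis .
  qed
  have "S k + M \<le> (S 0 + M) * exp (2 * C * M * (real k * dt n))"
  proof (induction k)
    case (Suc k)
    have "S (Suc k) + M \<le> (S k + M) * exp (2 * C * M * dt n)" by (rule S_Suc)
    also have "\<dots> \<le> (S 0 + M) * exp (2 * C * M * (real k * dt n)) * exp (2 * C * M * dt n)"
      by (rule mult_right_mono[OF Suc]) simp
    also have "\<dots> = (S 0 + M) * exp (2 * C * M * (real (Suc k) * dt n))"
      by (simp add: exp_add[symmetric] algebra_simps)
    finally show ?case .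
  qed simp
  moreover have "S 0 = (\<Sum>(r, s)\<in>Omega_upto n. G (r + s) * c0 r s)"
    unfolding S_def by (rule sum.cong) auto
  ultimately show ?thesis using M_nonneg by (simp add: S_def)
qed

text \<open>Every fragmentation creates one cluster, so counting clusters bounds the time integral of the
  fragmentation rates although \<open>b\<close> and \<open>bdot\<close> are arbitrary.\<close>

lemma euler_gross_rate_le:
  assumes k: "k < n"
  shows "dt n * (\<Sum>j<K. \<Sum>(r, s)\<in>Omega_upto k. gross_rate (euler n j) r s)
    \<le> M + real K * dt n * (C * M * M + C * M)"
proof -
  have n: "1 \<le> n" using k by simp
  \<comment> \<open>The number of clusters in the system, which lies between 0 and the total
    mass.\<close>
  define N where "N j = (\<Sum>(r, s)\<in>Omega_upto n. euler n j r s)" for j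
  have one: "dt n * (\<Sum>(r, s)\<in>Omega_upto k. gross_rate (euler n j) r s)
      \<le> N (Suc j) - N j + dt n * (C * M * M + C * M)" for j
  proof -
    let ?c = "euler n j"
    note c = euler_admissible[OF n, of j]
    have nn: "0 \<le> ?c r s" for r s using c by (simp add: admissible_def)
    let ?q = "\<lambda>r s. b (r + 1) s * ?c (r + 1) s + bdot r (s + 1) * ?c r (s + 1)"
    have q0: "0 \<le> ?q r s" if "1 \<le> r + s" for r s
      by (intro add_nonneg_nonneg mult_nonneg_nonneg nn b_nonneg bdot_nonneg that)
    have "(\<Sum>(r, s)\<in>Omega_upto k. gross_rate ?c r s)
        \<le> (\<Sum>(r, s)\<in>Omega_upto n. (a r s + adot r s) * ?c r s + (if r + s < n then ?q r s else 0))"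
    proof -
      have "(\<Sum>(r, s)\<in>Omega_upto k. gross_rate ?c r s)
          = (\<Sum>(r, s)\<in>Omega_upto k. (a r s + adot r s) * ?c r s + (if r + s < n then ?q r s else 0))"
        by (rule sum.cong) (use k in \<open>auto simp: gross_rate_def\<close>)
      also have "\<dots> \<le> (\<Sum>(r, s)\<in>Omega_upto n. (a r s + adot r s) * ?c r s + (if r + s < n then ?q r s else 0))"
      proof (rule sum_mono2)
        fix p assume "p \<in> Omega_upto n - Omega_upto k"
        then obtain r s where p: "p = (r, s)" "1 \<le> r + s" by (cases p) auto
        show "0 \<le> (case p of (r, s) \<Rightarrow> (a r s + adot r s) * ?c r s + (if r + s < n then ?q r s else 0))"
          using q0[OF p(2)] nn[of r s] a_nonneg[OF p(2)] adot_nonneg[OF p(2)] by (simp add: p)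
      qed (use k Omega_upto_mono in auto)
      finally show ?thesis .
    qed
    \<comment> \<open>\<open>C\<close> pays for the growth coefficients in the gross rate and
      \<open>C * M\<close> for the growth reactions contained in the fluxes. The remaining sum of
      negative fluxes is the net production of clusters, which telescopes in time.\<close>
    also have "\<dots> \<le> (\<Sum>(r, s)\<in>Omega_upto n. (C + C * M) * (real (r + s) * ?c r s)
        - (trunc_flux n ?c r s + trunc_fluxdot n ?c r s))"
    proof (rule sum_mono, clarify)
      fix r s assume "(r, s) \<in> Omega_upto n"
      then have rs: "1 \<le> r + s" by simp
      have g: "(a r s + adot r s) * ?c r s \<le> C * real (r + s) * ?c r s"
        by (intro mult_right_mono growth rs nn)
      have h: "?c 1 0 * (a r s * ?c r s) + ?c 0 1 * (adot r s * ?c r s) \<le> C * M * (real (r + s) * ?c r s)"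
        using euler_growth_le[OF n rs, of 1 j] by simp
      have i: "(if r + s < n then ?q r s else 0) + (trunc_flux n ?c r s + trunc_fluxdot n ?c r s)
          \<le> ?c 1 0 * (a r s * ?c r s) + ?c 0 1 * (adot r s * ?c r s)"
      proof (cases "r + s < n")
        case False
        have "0 \<le> ?c 1 0 * (a r s * ?c r s) + ?c 0 1 * (adot r s * ?c r s)"
          by (intro add_nonneg_nonneg mult_nonneg_nonneg nn a_nonneg adot_nonneg rs)
        with False show ?thesis by (simp add: trunc_flux_def trunc_fluxdot_def)
      qed (simp add: trunc_flux_def trunc_fluxdot_def flux_def fluxdot_def algebra_simps)
      show "(a r s + adot r s) * ?c r s + (if r + s < n then ?q r s else 0)
        \<le> (C + C * M) * (real (r + s) * ?c r s) - (trunc_flux n ?c r s + trunc_fluxdot n ?c r s)"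
        using g h i by (simp add: distrib_right mult.assoc)
    qed
    also have "\<dots> = (C + C * M) * (\<Sum>(r, s)\<in>Omega_upto n. real (r + s) * ?c r s)
        - (\<Sum>(r, s)\<in>Omega_upto n. trunc_flux n ?c r s + trunc_fluxdot n ?c r s)"
      by (simp add: split_def sum_subtractf sum_distrib_left)
    also have "\<dots> \<le> (C + C * M) * M - (\<Sum>(r, s)\<in>Omega_upto n. trunc_flux n ?c r s + trunc_fluxdot n ?c r s)"
      using C_nonneg M_nonneg by (intro diff_right_mono mult_left_mono admissible_mass[OF c]) auto
    finally have "dt n * (\<Sum>(r, s)\<in>Omega_upto k. gross_rate ?c r s) \<le> dt n * ((C + C * M) * M
        - (\<Sum>(r, s)\<in>Omega_upto n. trunc_flux n ?c r s + trunc_fluxdot n ?c r s))"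
      by (rule mult_left_mono) (use dt_pos[of n] in simp)
    moreover have "N (Suc j) = N j - dt n * (\<Sum>(r, s)\<in>Omega_upto n. trunc_flux n ?c r s + trunc_fluxdot n ?c r s)"
    proof -
      have "(\<Sum>(r, s)\<in>Omega_upto n. trunc_flux n ?c r s * (1 - 1 - 1) + trunc_fluxdot n ?c r s * (1 - 1 - 1))
          = - (\<Sum>(r, s)\<in>Omega_upto n. trunc_flux n ?c r s + trunc_fluxdot n ?c r s)"
        by (simp add: split_def sum_negf[symmetric])
      then show ?thesis
        using sum_weight_euler_Suc[OF n, of "\<lambda>_ _. 1" j] by (simp add: N_def del: euler.simps)
    qed
    ultimately show ?thesis by (simp add: algebra_simps)
  qed
  have "dt n * (\<Sum>j<K. \<Sum>(r, s)\<in>Omega_upto k. gross_rate (euler n j) r s)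
      = (\<Sum>j<K. dt n * (\<Sum>(r, s)\<in>Omega_upto k. gross_rate (euler n j) r s))"
    by (rule sum_distrib_left)
  also have "\<dots> \<le> (\<Sum>j<K. N (Suc j) - N j + dt n * (C * M * M + C * M))"
    by (rule sum_mono) (rule one)
  also have "\<dots> = N K - N 0 + real K * dt n * (C * M * M + C * M)"
    by (simp add: sum.distrib sum_lessThan_telescope)
  finally have main: "dt n * (\<Sum>j<K. \<Sum>(r, s)\<in>Omega_upto k. gross_rate (euler n j) r s)
      \<le> N K - N 0 + real K * dt n * (C * M * M + C * M)" .
  have "0 \<le> N 0" unfolding N_def
    using euler_admissible[OF n, of 0] by (intro sum_nonneg) (auto simp: admissible_def)
  moreover have "N K \<le> (\<Sum>(r, s)\<in>Omega_upto n. real (r + s) * euler n K r s)"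
    unfolding N_def
  proof (rule sum_mono, clarify)
    fix r s assume "(r, s) \<in> Omega_upto n"
    then show "euler n K r s \<le> real (r + s) * euler n K r s"
      using mult_right_mono[of 1 "real (r + s)" "euler n K r s"] euler_admissible[OF n, of K]
      by (auto simp: admissible_def)
  qed
  moreover have "\<dots> \<le> M" by (rule admissible_mass[OF euler_admissible[OF n]])
  ultimately show ?thesis using main by linarith
qed

text \<open>A bound, uniform in \<open>n\<close>, for the four fluxes in the equation for (r, s).
  The form \<open>r - 1 + 1\<close> is that of the flux bound at the index (r - 1, s). For r = 0 or
  s = 0 truncated subtraction merely adds nonnegative terms.\<close>

definition lip_const :: bd_seq where
  "lip_const r s = (a r s * M * M + b (r + 1) s * M) + (a (r - 1) s * M * M + b (r - 1 + 1) s * M)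
    + ((adot r s * M * M + bdot r (s + 1) * M) + (adot r (s - 1) * M * M + bdot r (s - 1 + 1) * M))"

lemma lip_const_nonneg:
  assumes "2 \<le> r + s"
  shows "0 \<le> lip_const r s"
  unfolding lip_const_def
  by (intro add_nonneg_nonneg mult_nonneg_nonneg M_nonneg a_nonneg adot_nonneg b_nonneg bdot_nonneg)
    (use assms in auto)

lemma flux_abs_le_coeff:
  assumes c: "admissible n c" and rs: "1 \<le> r + s"
  shows "\<bar>flux a b c r s\<bar> \<le> a r s * M * M + b (r + 1) s * M"
    "\<bar>fluxdot adot bdot c r s\<bar> \<le> adot r s * M * M + bdot r (s + 1) * M"
proof -
  have nn: "0 \<le> c r s" for r s using c by (simp add: admissible_def)
  have 1: "0 \<le> a r s * c 1 0 * c r s" "0 \<le> adot r s * c 0 1 * c r s"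
    "0 \<le> b (r + 1) s * c (r + 1) s" "0 \<le> bdot r (s + 1) * c r (s + 1)"
    by (intro mult_nonneg_nonneg nn a_nonneg adot_nonneg b_nonneg bdot_nonneg rs)+
  have 2: "a r s * c 1 0 * c r s \<le> a r s * M * M" "adot r s * c 0 1 * c r s \<le> adot r s * M * M"
    by (intro mult_mono admissible_le[OF c] nn M_nonneg mult_nonneg_nonneg a_nonneg adot_nonneg rs;
        simp)+
  have 3: "b (r + 1) s * c (r + 1) s \<le> b (r + 1) s * M" "bdot r (s + 1) * c r (s + 1) \<le> bdot r (s + 1) * M"
    by (intro mult_left_mono admissible_le[OF c] b_nonneg bdot_nonneg rs; simp)+
  show "\<bar>flux a b c r s\<bar> \<le> a r s * M * M + b (r + 1) s * M"
    "\<bar>fluxdot adot bdot c r s\<bar> \<le> adot r s * M * M + bdot r (s + 1) * M"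
    using 1 2 3 unfolding flux_def fluxdot_def by linarith+
qed

lemma Delta_abs_le:
  assumes J: "\<And>r s. 1 \<le> r + s \<Longrightarrow> \<bar>J r s\<bar> \<le> a r s * M * M + b (r + 1) s * M"
    and Jd: "\<And>r s. 1 \<le> r + s \<Longrightarrow> \<bar>Jd r s\<bar> \<le> adot r s * M * M + bdot r (s + 1) * M"
    and rs: "2 \<le> r + s"
  shows "\<bar>Delta_r J r s + Delta_s Jd r s\<bar> \<le> lip_const r s"
proof -
  have rs1: "1 \<le> r + s" "1 \<le> r - 1 + s" "1 \<le> r + (s - 1)" using rs by auto
  note J = J[OF rs1(1)] J[OF rs1(2)] Jd[OF rs1(1)] Jd[OF rs1(3)]
  have D: "Delta_r J r s = J r s - (if r = 0 then 0 else J (r - 1) s)"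
    "Delta_s Jd r s = Jd r s - (if s = 0 then 0 else Jd r (s - 1))"
    using rs1 by (simp_all add: Delta_r_def Delta_s_def zero_ext_def)
  have "\<bar>Delta_r J r s\<bar> \<le> \<bar>J r s\<bar> + \<bar>J (r - 1) s\<bar>"
    using abs_triangle_ineq4[of "J r s" "J (r - 1) s"] unfolding D by (cases "r = 0") simp_all
  moreover have "\<bar>Delta_s Jd r s\<bar> \<le> \<bar>Jd r s\<bar> + \<bar>Jd r (s - 1)\<bar>"
    using abs_triangle_ineq4[of "Jd r s" "Jd r (s - 1)"] unfolding D by (cases "s = 0") simp_all
  ultimately show ?thesis using J unfolding lip_const_def by linarith
qed

lemma euler_rhs_bound:
  assumes n: "1 \<le> n" and rs: "2 \<le> r + s"
  shows "\<bar>trunc_rhs n (euler n k) r s\<bar> \<le> lip_const r s"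
proof -
  note c = euler_admissible[OF n, of k]
  have nn: "0 \<le> a r s * M * M + b (r + 1) s * M" "0 \<le> adot r s * M * M + bdot r (s + 1) * M"
    if "1 \<le> r + s" for r s
    by (intro add_nonneg_nonneg mult_nonneg_nonneg M_nonneg a_nonneg adot_nonneg b_nonneg bdot_nonneg that)+
  have "trunc_rhs n (euler n k) r s
      = - (Delta_r (trunc_flux n (euler n k)) r s + Delta_s (trunc_fluxdot n (euler n k)) r s)"
    using rs by (auto simp: trunc_rhs_def)
  moreover have "\<bar>Delta_r (trunc_flux n (euler n k)) r s + Delta_s (trunc_fluxdot n (euler n k)) r s\<bar> \<le> lip_const r s"
    by (rule Delta_abs_le[OF _ _ rs])
      (use flux_abs_le_coeff[OF c] nn in \<open>auto simp: trunc_flux_def trunc_fluxdot_def\<close>)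
  ultimately show ?thesis by simp
qed

lemma euler_eq_sum: "euler n k r s = euler n 0 r s + dt n * (\<Sum>j<k. trunc_rhs n (euler n j) r s)"
  by (induction k) (simp_all del: euler.simps(1) add: distrib_left)

lemma euler_lipschitz:
  assumes n: "1 \<le> n" and rs: "2 \<le> r + s" and kl: "k \<le> l"
  shows "\<bar>euler n l r s - euler n k r s\<bar> \<le> lip_const r s * (real (l - k) * dt n)"
proof -
  let ?f = "\<lambda>j. trunc_rhs n (euler n j) r s"
  have split: "(\<Sum>j<l. ?f j) = (\<Sum>j<k. ?f j) + (\<Sum>j\<in>{k..<l}. ?f j)"
    using sum.atLeastLessThan_concat[of 0 k l ?f] kl by (simp add: lessThan_atLeast0)
  have "euler n l r s - euler n k r s = dt n * (\<Sum>j\<in>{k..<l}. ?f j)"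
    unfolding euler_eq_sum[of n l] euler_eq_sum[of n k] split by (simp only: distrib_left)
  then have eq: "\<bar>euler n l r s - euler n k r s\<bar> = dt n * \<bar>\<Sum>j\<in>{k..<l}. ?f j\<bar>"
    using dt_pos[of n] by (simp only: abs_mult abs_of_pos)
  have "\<bar>\<Sum>j\<in>{k..<l}. ?f j\<bar> \<le> (\<Sum>j\<in>{k..<l}. \<bar>?f j\<bar>)" by (rule sum_abs)
  also have "\<dots> \<le> (\<Sum>j\<in>{k..<l}. lip_const r s)"
    by (rule sum_mono) (rule euler_rhs_bound[OF n rs])
  finally have "\<bar>\<Sum>j\<in>{k..<l}. ?f j\<bar> \<le> real (l - k) * lip_const r s" by simp
  then have "dt n * \<bar>\<Sum>j\<in>{k..<l}. ?f j\<bar> \<le> dt n * (real (l - k) * lip_const r s)"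
    by (rule mult_left_mono) (rule less_imp_le[OF dt_pos])
  then show ?thesis unfolding eq by (simp only: mult.commute mult.left_commute)
qed

end

subsection \<open>Existence\<close>

context bd_euler
begin

definition approx :: "nat \<Rightarrow> real \<Rightarrow> bd_seq" where
  "approx n t = euler n (nat \<lfloor>t / dt n\<rfloor>)"

text \<open>The grid time at which the value of \<open>approx n t\<close> is attained; up to this
  time the scheme is an exact integral equation.\<close>

definition grid :: "nat \<Rightarrow> real \<Rightarrow> real" where
  "grid n t = real (nat \<lfloor>t / dt n\<rfloor>) * dt n"

lemma approx_admissible: "1 \<le> n \<Longrightarrow> admissible n (approx n t)"
  unfolding approx_def by (rule euler_admissible)

lemma approx_nonneg: "1 \<le> n \<Longrightarrow> 0 \<le> approx n t r s"
  using approx_admissible[of n t] by (simp add: admissible_def)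

lemma grid_bounds:
  assumes "0 \<le> t"
  shows "0 \<le> grid n t" "grid n t \<le> t" "t \<le> grid n t + dt n"
proof -
  have f: "real (nat \<lfloor>t / dt n\<rfloor>) = real_of_int \<lfloor>t / dt n\<rfloor>"
    using assms dt_pos[of n] by simp
  show "grid n t \<le> t"
    unfolding grid_def f using iffD1[OF pos_le_divide_eq[OF dt_pos] of_int_floor_le] .
  have "t \<le> (real_of_int \<lfloor>t / dt n\<rfloor> + 1) * dt n"
    using iffD1[OF pos_divide_le_eq[OF dt_pos] real_of_int_floor_add_one_ge] .
  then show "t \<le> grid n t + dt n" unfolding grid_def f by (simp only: distrib_right mult_1)
  show "0 \<le> grid n t" unfolding grid_def using dt_pos[of n] by simp
qed

text \<open>The additional \<open>dt n\<close> accounts for the jumps: times that are arbitrarily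
  close can be separated by a grid point.\<close>

lemma approx_lipschitz:
  assumes n: "1 \<le> n" and rs: "2 \<le> r + s" and tu: "0 \<le> t" "0 \<le> u"
  shows "\<bar>approx n t r s - approx n u r s\<bar> \<le> lip_const r s * (\<bar>t - u\<bar> + dt n)"
proof -
  have le: "\<bar>approx n t r s - approx n u r s\<bar> \<le> lip_const r s * (\<bar>t - u\<bar> + dt n)"
    if "0 \<le> u" "u \<le> t" for t u
  proof -
    let ?k = "nat \<lfloor>u / dt n\<rfloor>" and ?l = "nat \<lfloor>t / dt n\<rfloor>"
    have kl: "?k \<le> ?l"
      using that dt_pos[of n] by (intro nat_mono floor_mono divide_right_mono) auto
    have "\<bar>approx n t r s - approx n u r s\<bar> \<le> lip_const r s * (real (?l - ?k) * dt n)"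
      unfolding approx_def by (rule euler_lipschitz[OF n rs kl])
    also have "real (?l - ?k) * dt n = grid n t - grid n u"
      using kl by (simp add: grid_def of_nat_diff left_diff_distrib)
    also have "lip_const r s * (grid n t - grid n u) \<le> lip_const r s * (\<bar>t - u\<bar> + dt n)"
    proof (rule mult_left_mono[OF _ lip_const_nonneg[OF rs]])
      show "grid n t - grid n u \<le> \<bar>t - u\<bar> + dt n"
        using grid_bounds(2)[of t n] grid_bounds(3)[of u n] that by linarith
    qed
    finally show ?thesis .
  qed
  show ?thesis
  proof (cases "u \<le> t")
    case False
    then show ?thesis using le[of t u] tu by (simp only: abs_minus_commute)
  qed (use le tu in blast)
qed

text \<open>\<open>H\<close> bounds the superlinear moment uniformly in the truncation level and in
  time: 2 comes from the choice of \<open>G\<close>, \<open>M\<close> and the exponential from the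
  Gronwall argument. Beyond \<open>R\<close> the weight exceeds \<open>H / \<epsilon>\<close> times
  the size, which forces the tail below \<open>\<epsilon>\<close>.\<close>

lemma approx_tail:
  assumes \<epsilon>: "0 < \<epsilon>"
  obtains R where "\<And>(n::nat) t. 1 \<le> n \<Longrightarrow> t \<in> {0..T} \<Longrightarrow>
    (\<Sum>(r, s)\<in>Omega_upto n. if R < r + s then real (r + s) * approx n t r s else 0) \<le> \<epsilon>"
proof -
  have "(\<lambda>(r, s). real (r + s) * c0 r s) summable_on Omega"
    by (rule Xplus_summable[OF c0_Xplus, of _ 1]) simp
  then obtain G :: "nat \<Rightarrow> real" where G: "G 1 = 0" "\<And>m. 0 \<le> G m" "\<And>m. G m \<le> G (Suc m)"
    "\<And>m. real m * (G (Suc m) - G m) \<le> 2 * G m + real m"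
    and G_super: "\<And>A. \<exists>m0. \<forall>m\<ge>m0. A * real m \<le> G m"
    and G_c0: "\<And>n. (\<Sum>(r, s)\<in>Omega_upto n. G (r + s) * c0 r s) \<le> 2"
    by (rule superlinear_weight_exists) (use Xplus_nonneg[OF c0_Xplus] in auto)
  define H where "H = (2 + M) * exp (2 * C * M * T)"
  have H: "0 < H" using M_nonneg by (simp add: H_def add_pos_nonneg)
  obtain R where R: "\<And>m. R \<le> m \<Longrightarrow> H / \<epsilon> * real m \<le> G m" using G_super by blast
  show thesis
  proof
    fix n :: nat and t assume n: "1 \<le> n" and t: "t \<in> {0..T}"
    have "H / \<epsilon> * (\<Sum>(r, s)\<in>Omega_upto n. if R < r + s then real (r + s) * approx n t r s else 0)
        \<le> (\<Sum>(r, s)\<in>Omega_upto n. G (r + s) * approx n t r s)"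
      unfolding sum_distrib_left
    proof (rule sum_mono, clarify)
      fix r s
      show "H / \<epsilon> * (if R < r + s then real (r + s) * approx n t r s else 0) \<le> G (r + s) * approx n t r s"
        using mult_right_mono[OF R[of "r + s"] approx_nonneg[OF n, of t r s]]
          mult_nonneg_nonneg[OF G(2)[of "r + s"] approx_nonneg[OF n, of t r s]]
        by (simp add: mult.assoc)
    qed
    also have "\<dots> \<le> ((\<Sum>(r, s)\<in>Omega_upto n. G (r + s) * c0 r s) + M) * exp (2 * C * M * grid n t)"
      unfolding approx_def grid_def by (rule euler_moment_le[OF n G])
    also have "\<dots> \<le> H"
      unfolding H_def
    proof (intro mult_mono add_right_mono G_c0)
      show "exp (2 * C * M * grid n t) \<le> exp (2 * C * M * T)"
        using grid_bounds(2)[of t n] t C_nonneg M_nonneg by (auto intro!: mult_left_mono)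
    qed (use M_nonneg in auto)
    finally show "(\<Sum>(r, s)\<in>Omega_upto n. if R < r + s then real (r + s) * approx n t r s else 0) \<le> \<epsilon>"
      using H \<epsilon> by (simp add: field_simps)
  qed
qed

text \<open>By conservation the mass missing from sizes up to \<open>R\<close> is precisely the mass
  of the larger clusters. The reference value is the mass of the truncated initial data.\<close>

lemma approx_mass_upto:
  assumes n: "1 \<le> n" and l: "l = (\<lambda>r s. real r) \<or> l = (\<lambda>r s. real s)"
  shows "0 \<le> (\<Sum>(r, s)\<in>Omega_upto n. l r s * c0 r s) - (\<Sum>(r, s)\<in>Omega_upto R. l r s * approx n t r s)"
    and "(\<Sum>(r, s)\<in>Omega_upto n. l r s * c0 r s) - (\<Sum>(r, s)\<in>Omega_upto R. l r s * approx n t r s)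
      \<le> (\<Sum>(r, s)\<in>Omega_upto n. if R < r + s then real (r + s) * approx n t r s else 0)"
proof -
  let ?u = "approx n t"
  have l': "0 \<le> l r s" "l r s \<le> real (r + s)" for r s using l by auto
  have "(\<Sum>(r, s)\<in>Omega_upto n. l r s * c0 r s) = (\<Sum>(r, s)\<in>Omega_upto n. l r s * ?u r s)"
    using l approx_admissible[OF n, of t] by (auto simp: admissible_def)
  also have "\<dots> = (\<Sum>(r, s)\<in>Omega_upto n. if r + s \<le> R then l r s * ?u r s else 0)
      + (\<Sum>(r, s)\<in>Omega_upto n. if R < r + s then l r s * ?u r s else 0)"
    unfolding sum.distrib[symmetric] by (rule sum.cong) auto
  also have "(\<Sum>(r, s)\<in>Omega_upto n. if r + s \<le> R then l r s * ?u r s else 0)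
      = (\<Sum>(r, s)\<in>Omega_upto R. l r s * ?u r s)"
    by (rule sum.mono_neutral_cong) (use approx_admissible[OF n, of t] in \<open>auto simp: admissible_def\<close>)
  finally have eq: "(\<Sum>(r, s)\<in>Omega_upto n. l r s * c0 r s) - (\<Sum>(r, s)\<in>Omega_upto R. l r s * ?u r s)
      = (\<Sum>(r, s)\<in>Omega_upto n. if R < r + s then l r s * ?u r s else 0)"
    by simp
  show "0 \<le> (\<Sum>(r, s)\<in>Omega_upto n. l r s * c0 r s) - (\<Sum>(r, s)\<in>Omega_upto R. l r s * ?u r s)"
    unfolding eq by (rule sum_nonneg) (use l' approx_nonneg[OF n] in auto)
  show "(\<Sum>(r, s)\<in>Omega_upto n. l r s * c0 r s) - (\<Sum>(r, s)\<in>Omega_upto R. l r s * ?u r s)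
      \<le> (\<Sum>(r, s)\<in>Omega_upto n. if R < r + s then real (r + s) * ?u r s else 0)"
    unfolding eq
  proof (rule sum_mono, clarify)
    fix r s
    show "(if R < r + s then l r s * ?u r s else 0) \<le> (if R < r + s then real (r + s) * ?u r s else 0)"
      using mult_right_mono[OF l'(2) approx_nonneg[OF n, of t r s]] by simp
  qed
qed

text \<open>The time derivatives of the monomers are not bounded uniformly in \<open>n\<close>; their equicontinuity
  comes from conservation of mass and the uniform tail bound.\<close>

lemma approx_monomer_equicontinuous:
  assumes l: "l = (\<lambda>r s. real r) \<or> l = (\<lambda>r s. real s)" and \<epsilon>: "0 < \<epsilon>"
  shows "\<exists>\<Lambda>\<ge>0. \<forall>n\<ge>(1::nat). \<forall>t\<in>{0..T}. \<forall>u\<in>{0..T}.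
    \<bar>l 1 0 * (approx n t 1 0 - approx n u 1 0) + l 0 1 * (approx n t 0 1 - approx n u 0 1)\<bar>
      \<le> \<Lambda> * (\<bar>t - u\<bar> + dt n) + \<epsilon>"
proof -
  have l': "0 \<le> l r s" for r s using l by auto
  obtain R0 where R0: "\<And>(n::nat) t. 1 \<le> n \<Longrightarrow> t \<in> {0..T} \<Longrightarrow>
    (\<Sum>(r, s)\<in>Omega_upto n. if R0 < r + s then real (r + s) * approx n t r s else 0) \<le> \<epsilon>"
    using approx_tail[OF \<epsilon>] by blast
  \<comment> \<open>The successor ensures that the triangle contains both monomers; enlarging the
    cutoff does not increase the tail.\<close>
  define R where "R = Suc R0"
  have R: "(\<Sum>(r, s)\<in>Omega_upto n. if R < r + s then real (r + s) * approx n t r s else 0) \<le> \<epsilon>"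
    if "1 \<le> n" "t \<in> {0..T}" for n :: nat and t
    by (rule order_trans[OF sum_mono R0[OF that]]) (use approx_nonneg[OF that(1)] in \<open>auto simp: R_def\<close>)
  define \<Lambda> where "\<Lambda> = (\<Sum>(r, s)\<in>Omega_upto R. if 2 \<le> r + s then l r s * lip_const r s else 0)"
  have \<Lambda>: "0 \<le> \<Lambda>" unfolding \<Lambda>_def
    by (rule sum_nonneg) (use l' lip_const_nonneg in auto)
  have split: "(\<Sum>(r, s)\<in>Omega_upto R. l r s * v r s) = (l 1 0 * v 1 0 + l 0 1 * v 0 1)
      + (\<Sum>(r, s)\<in>Omega_upto R. if 2 \<le> r + s then l r s * v r s else 0)" for v :: bd_seq
  proof -
    have "(\<Sum>(r, s)\<in>Omega_upto R. l r s * v r s)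
        = (\<Sum>(r, s)\<in>Omega_upto R. if r + s = 1 then l r s * v r s else 0)
          + (\<Sum>(r, s)\<in>Omega_upto R. if 2 \<le> r + s then l r s * v r s else 0)"
      unfolding sum.distrib[symmetric] by (rule sum.cong) auto
    then show ?thesis using sum_Omega_upto_monomers[of R "\<lambda>r s. l r s * v r s"] by (simp add: R_def)
  qed
  show ?thesis
  proof (intro exI conjI allI impI ballI, rule \<Lambda>)
    fix n :: nat and t u assume n: "1 \<le> n" and t: "t \<in> {0..T}" and u: "u \<in> {0..T}"
    let ?h = "\<bar>t - u\<bar> + dt n"
    let ?S = "\<lambda>t. \<Sum>(r, s)\<in>Omega_upto R. l r s * approx n t r s"
    let ?m = "\<lambda>t. l 1 0 * approx n t 1 0 + l 0 1 * approx n t 0 1"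
    let ?Q = "\<lambda>t. \<Sum>(r, s)\<in>Omega_upto R. if 2 \<le> r + s then l r s * approx n t r s else 0"
    have S: "\<bar>?S t - ?S u\<bar> \<le> \<epsilon>"
      using approx_mass_upto[OF n l, where R = R and t = t] approx_mass_upto[OF n l, where R = R and t = u] R[OF n t] R[OF n u]
      by linarith
    have "\<bar>?Q t - ?Q u\<bar> = \<bar>\<Sum>(r, s)\<in>Omega_upto R. if 2 \<le> r + s then l r s * (approx n t r s - approx n u r s) else 0\<bar>"
      unfolding sum_subtractf[symmetric]
      by (rule arg_cong[of _ _ abs], rule sum.cong) (auto simp: right_diff_distrib)
    also have "\<dots> \<le> (\<Sum>p\<in>Omega_upto R. \<bar>case p of (r, s) \<Rightarrow> if 2 \<le> r + s then l r s * (approx n t r s - approx n u r s) else 0\<bar>)"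
      by (rule sum_abs)
    also have "\<dots> \<le> (\<Sum>p\<in>Omega_upto R. (case p of (r, s) \<Rightarrow> if 2 \<le> r + s then l r s * lip_const r s else 0) * ?h)"
    proof (rule sum_mono)
      fix p :: "nat \<times> nat"
      obtain r s where p: "p = (r, s)" by fastforce
      show "\<bar>case p of (r, s) \<Rightarrow> if 2 \<le> r + s then l r s * (approx n t r s - approx n u r s) else 0\<bar>
        \<le> (case p of (r, s) \<Rightarrow> if 2 \<le> r + s then l r s * lip_const r s else 0) * ?h"
      proof (cases "2 \<le> r + s")
        case True
        have "l r s * \<bar>approx n t r s - approx n u r s\<bar> \<le> l r s * (lip_const r s * ?h)"
          using t u by (intro mult_left_mono approx_lipschitz[OF n True] l') auto
        then show ?thesis using True l'[of r s] by (simp add: p abs_mult mult.assoc)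
      qed (simp add: p)
    qed
    also have "\<dots> = \<Lambda> * ?h" by (simp add: \<Lambda>_def sum_distrib_right)
    finally have Q: "\<bar>?Q t - ?Q u\<bar> \<le> \<Lambda> * ?h" .
    \<comment> \<open>Monomers are total mass up to \<open>R\<close> minus the mass of clusters of
      size 2 to \<open>R\<close>. The first varies by at most \<open>\<epsilon>\<close> because of
      the tail, the second is a finite sum of asymptotically Lipschitz functions.\<close>
    have "?m t - ?m u = (?S t - ?S u) - (?Q t - ?Q u)"
      using split[of "approx n t"] split[of "approx n u"] by linarith
    then have "\<bar>?m t - ?m u\<bar> \<le> \<Lambda> * ?h + \<epsilon>" using S Q by linarith
    moreover have "?m t - ?m u
        = l 1 0 * (approx n t 1 0 - approx n u 1 0) + l 0 1 * (approx n t 0 1 - approx n u 0 1)"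
      by (simp add: algebra_simps)
    ultimately show "\<bar>l 1 0 * (approx n t 1 0 - approx n u 1 0) + l 0 1 * (approx n t 0 1 - approx n u 0 1)\<bar>
      \<le> \<Lambda> * ?h + \<epsilon>" by simp
  qed
qed

lemma approx_equicontinuous:
  assumes rs: "1 \<le> r + s" and \<epsilon>: "0 < \<epsilon>"
  shows "\<exists>\<Lambda>\<ge>0. \<forall>n\<ge>(1::nat). \<forall>t\<in>{0..T}. \<forall>u\<in>{0..T}.
    \<bar>approx n t r s - approx n u r s\<bar> \<le> \<Lambda> * (\<bar>t - u\<bar> + dt n) + \<epsilon>"
proof (cases "2 \<le> r + s")
  case True
  show ?thesis
  proof (intro exI conjI allI impI ballI, rule lip_const_nonneg[OF True])
    fix n :: nat and t u assume "1 \<le> n" "t \<in> {0..T}" "u \<in> {0..T}"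
    then have "\<bar>approx n t r s - approx n u r s\<bar> \<le> lip_const r s * (\<bar>t - u\<bar> + dt n)"
      by (intro approx_lipschitz True) auto
    then show "\<bar>approx n t r s - approx n u r s\<bar> \<le> lip_const r s * (\<bar>t - u\<bar> + dt n) + \<epsilon>"
      using \<epsilon> by linarith
  qed
next
  case False
  then have "(r, s) \<in> Omega_upto 1" using rs by simp
  then consider "r = 1" "s = 0" | "r = 0" "s = 1" unfolding Omega_upto_1 by auto
  then show ?thesis
  proof cases
    case 1
    then show ?thesis using approx_monomer_equicontinuous[of "\<lambda>r s. real r", OF _ \<epsilon>, of T] by simp
  next
    case 2
    then show ?thesis using approx_monomer_equicontinuous[of "\<lambda>r s. real s", OF _ \<epsilon>, of T] by simp
  qed
qed

section \<open>The limit of the scheme\<close>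

lemma cluster_solution_exists:
  obtains c where "\<And>T. 0 \<le> T \<Longrightarrow> bd_cluster_solution a adot b bdot C c0 c T M"
    and "\<And>t. 0 \<le> t \<Longrightarrow> (\<Sum>\<^sub>\<infinity>(r, s)\<in>Omega. real r * c t r s) = (\<Sum>\<^sub>\<infinity>(r, s)\<in>Omega. real r * c0 r s)"
    and "\<And>t. 0 \<le> t \<Longrightarrow> (\<Sum>\<^sub>\<infinity>(r, s)\<in>Omega. real s * c t r s) = (\<Sum>\<^sub>\<infinity>(r, s)\<in>Omega. real s * c0 r s)"
proof -
  \<comment> \<open>A diagonal subsequence converges for all clusters and all rational times, a
    countable set; equicontinuity supplies the remaining times.\<close>
  define X where "X = {(r :: nat, s :: nat, q :: real). 1 \<le> r + s \<and> q \<in> \<rat> \<and> 0 \<le> q}"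
  have "X \<subseteq> UNIV \<times> UNIV \<times> \<rat>" by (auto simp: X_def)
  then have X: "countable X" by (rule countable_subset) (auto simp: countable_rat)
  have "norm (case x of (r, s, q) \<Rightarrow> approx (Suc n) q r s) \<le> M" if "x \<in> X" for n x
    using that admissible_le[OF approx_admissible[of "Suc n"]] approx_nonneg[of "Suc n"]
    by (auto simp: X_def)
  then obtain \<rho> where \<rho>: "strict_mono (\<rho> :: nat \<Rightarrow> nat)"
    "\<And>x. x \<in> X \<Longrightarrow> \<exists>l. (\<lambda>i. case x of (r, s, q) \<Rightarrow> approx (Suc (\<rho> i)) q r s) \<longlonglongrightarrow> l"
    by (rule function_convergent_subsequence[OF X, where f = "\<lambda>n x. case x of (r, s, q) \<Rightarrow> approx (Suc n) q r s" and M = M]) blast+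
  \<comment> \<open>The successor keeps the truncation level positive, as the invariant of the
    scheme requires.\<close>
  define N where "N i = Suc (\<rho> i)" for i
  define u where "u i = approx (N i)" for i
  define c where "c t r s = lim (\<lambda>i. u i t r s)" for t r s
  have N1: "1 \<le> N i" for i by (simp add: N_def)
  have N_gt: "i < N i" for i using seq_suble[OF \<rho>(1), of i] by (simp add: N_def)
  have h: "(\<lambda>i. dt (N i)) \<longlonglongrightarrow> 0"
  proof (rule tendsto_sandwich[OF _ _ tendsto_const lim_inverse_n'])
    show "\<forall>\<^sub>F i in sequentially. 0 \<le> dt (N i)" using dt_pos by (auto intro!: always_eventually less_imp_le)
    show "\<forall>\<^sub>F i in sequentially. dt (N i) \<le> 1 / real i"
    proof (rule eventually_sequentiallyI[of 1])
      fix i :: nat assume i: "1 \<le> i"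
      have "dt (N i) \<le> 1 / (real (N i) + 1)" by (rule dt_le)
      also have "\<dots> \<le> 1 / real i" using N_gt[of i] i by (intro divide_left_mono) auto
      finally show "dt (N i) \<le> 1 / real i" .
    qed
  qed
  have equi: "\<exists>\<Lambda>\<ge>0. \<forall>i. \<forall>t\<in>{0..T}. \<forall>v\<in>{0..T}.
      \<bar>u i t r s - u i v r s\<bar> \<le> \<Lambda> * (\<bar>t - v\<bar> + dt (N i)) + \<epsilon>"
    if "1 \<le> r + s" "0 < \<epsilon>" for r s T \<epsilon>
    using approx_equicontinuous[OF that, of T] N1 unfolding u_def by blast
  have conv: "convergent (\<lambda>i. u i q r s)" if "1 \<le> r + s" "q \<in> \<rat>" "0 \<le> q" for q r s
    using \<rho>(2)[of "(r, s, q)"] that by (simp add: X_def convergent_def u_def N_def)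
  have lim: "(\<lambda>i. u i t r s) \<longlonglongrightarrow> c t r s" if "1 \<le> r + s" "0 \<le> t" for t r s
    using asymp_equicontinuous_convergent[OF h equi[OF that(1)] conv[OF that(1)] that(2)]
    by (simp add: c_def convergent_LIMSEQ_iff)
  have c_cont: "continuous_on {0..T} (\<lambda>t. c t r s)" if "1 \<le> r + s" for r s T
    unfolding c_def by (rule asymp_equicontinuous_lim_cont[OF h equi[OF that] conv[OF that]])
  have adm: "admissible (N i) (u i t)" for i t
    unfolding u_def by (rule approx_admissible[OF N1])
  have u_nonneg: "0 \<le> u i t r s" for i t r s using adm by (simp add: admissible_def)
  have u_le: "u i t r s \<le> M" if "1 \<le> r + s" for i t r s by (rule admissible_le[OF adm that])
  have c_nonneg: "0 \<le> c t r s" if "1 \<le> r + s" "0 \<le> t" for t r s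
    by (rule LIMSEQ_le_const[OF lim[OF that]]) (use u_nonneg in auto)
  have sum_lim: "(\<lambda>i. \<Sum>(r, s)\<in>Omega_upto k. l r s * u i t r s) \<longlonglongrightarrow> (\<Sum>(r, s)\<in>Omega_upto k. l r s * c t r s)"
    if "0 \<le> t" for l :: bd_seq and k t
  proof (rule tendsto_sum)
    fix p assume "p \<in> Omega_upto k"
    then show "(\<lambda>i. case p of (r, s) \<Rightarrow> l r s * u i t r s) \<longlonglongrightarrow> (case p of (r, s) \<Rightarrow> l r s * c t r s)"
      using that by (cases p) (auto intro!: tendsto_intros lim)
  qed
  have mass_upto: "(\<Sum>(r, s)\<in>Omega_upto k. real (r + s) * c t r s) \<le> M" if "0 \<le> t" for k t
    by (rule LIMSEQ_le_const2[OF sum_lim[OF that]]) (use admissible_mass_upto[OF adm] in auto)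
  have c_Xplus: "c t \<in> bd_Xplus" if t: "0 \<le> t" for t
  proof -
    have "(\<Sum>(r, s)\<in>Omega_upto k. real (r + s) * \<bar>c t r s\<bar>) \<le> M" for k
      by (rule order_trans[OF eq_refl mass_upto[OF t, of k]], rule sum.cong) (use c_nonneg t in auto)
    then have "(\<lambda>(r, s). real (r + s) * \<bar>c t r s\<bar>) summable_on Omega"
      by (intro summable_onI_Omega_upto) auto
    then show ?thesis using c_nonneg[OF _ t] by (auto simp: bd_Xplus_def bd_X_def)
  qed
  have c_norm: "bd_norm (c t) \<le> M" if t: "0 \<le> t" for t
    unfolding Xplus_norm[OF c_Xplus[OF t]]
    by (rule infsum_le_Omega_upto[OF Xplus_summable[OF c_Xplus[OF t], of _ 1] mass_upto[OF t]]) simp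
  have flux_cont: "continuous_on {0..T} (\<lambda>t. flux a b (c t) r s)"
    "continuous_on {0..T} (\<lambda>t. fluxdot adot bdot (c t) r s)"
    "continuous_on {0..T} (\<lambda>t. gross_rate (c t) r s)"
    if "1 \<le> r + s" for r s T
    using that unfolding flux_def fluxdot_def gross_rate_def by (auto intro!: continuous_intros c_cont)
  have flux_lim: "(\<lambda>i. flux a b (u i t) r s) \<longlonglongrightarrow> flux a b (c t) r s"
    "(\<lambda>i. fluxdot adot bdot (u i t) r s) \<longlonglongrightarrow> fluxdot adot bdot (c t) r s"
    "(\<lambda>i. gross_rate (u i t) r s) \<longlonglongrightarrow> gross_rate (c t) r s"
    if "1 \<le> r + s" "0 \<le> t" for r s t
    using that unfolding flux_def fluxdot_def gross_rate_def by (auto intro!: tendsto_intros lim)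
  have zero_ext_lim: "(\<lambda>i. zero_ext (flux a b (u i t)) r s) \<longlonglongrightarrow> zero_ext (flux a b (c t)) r s"
    "(\<lambda>i. zero_ext (fluxdot adot bdot (u i t)) r s) \<longlonglongrightarrow> zero_ext (fluxdot adot bdot (c t)) r s"
    if "0 \<le> t" for r s t
    using flux_lim(1,2)[OF _ that, of r s] by (auto simp: zero_ext_def)
  have grid_lim: "(\<lambda>i. grid (N i) t) \<longlonglongrightarrow> t" if "0 \<le> t" for t
  proof (rule tendsto_sandwich[OF _ _ _ tendsto_const])
    show "(\<lambda>i. t - dt (N i)) \<longlonglongrightarrow> t" using tendsto_diff[OF tendsto_const h, of t] by simp
    show "\<forall>\<^sub>F i in sequentially. t - dt (N i) \<le> grid (N i) t"
      using grid_bounds(3)[OF that] by (auto simp: algebra_simps)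
  qed (use grid_bounds(2)[OF that] in auto)
  have cluster_eq: "c t r s = c0 r s - (LBINT \<tau>:{0..t}.
      Delta_r (flux a b (c \<tau>)) r s + Delta_s (fluxdot adot bdot (c \<tau>)) r s)"
    if t: "0 \<le> t" and rs: "2 \<le> r + s" for t r s
  proof -
    let ?F = "\<lambda>\<tau>. - (Delta_r (flux a b (c \<tau>)) r s + Delta_s (fluxdot adot bdot (c \<tau>)) r s)"
    have tT: "t \<in> {0..t}" using t by simp
    have F_int: "set_integrable lborel {0..t} (\<lambda>\<tau>. Delta_r (flux a b (c \<tau>)) r s)"
      "set_integrable lborel {0..t} (\<lambda>\<tau>. Delta_s (fluxdot adot bdot (c \<tau>)) r s)"
      by (rule set_integrable_Delta_r set_integrable_Delta_s; rule cont_set_integrable[OF tT];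
          rule flux_cont; assumption)+
    have F_meas: "set_borel_measurable lborel {0..t} ?F"
      using borel_measurable_uminus[OF borel_measurable_integrable[OF
          set_integral_add(1)[OF F_int, unfolded set_integrable_def]]]
      unfolding set_borel_measurable_def scaleR_minus_right .
    have rhs_lim: "(\<lambda>i. trunc_rhs (N i) (u i \<tau>) r s) \<longlonglongrightarrow> ?F \<tau>" if \<tau>: "\<tau> \<in> {0..t}" for \<tau>
    proof -
      have "(\<lambda>i. - (Delta_r (flux a b (u i \<tau>)) r s + Delta_s (fluxdot adot bdot (u i \<tau>)) r s)) \<longlonglongrightarrow> ?F \<tau>"
        unfolding Delta_r_def Delta_s_def
        by (cases "r = 0"; cases "s = 0"; use \<tau> in \<open>auto intro!: tendsto_intros zero_ext_lim\<close>)
      \<comment> \<open>Once the truncation level exceeds r + s, the truncation no longer affects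
        the equation for (r, s).\<close>
      moreover have "\<forall>\<^sub>F i in sequentially. - (Delta_r (flux a b (u i \<tau>)) r s + Delta_s (fluxdot adot bdot (u i \<tau>)) r s)
          = trunc_rhs (N i) (u i \<tau>) r s"
      proof (rule eventually_sequentiallyI[of "r + s"])
        fix i assume "r + s \<le> i"
        then have "r + s < N i" using N_gt[of i] by simp
        then show "- (Delta_r (flux a b (u i \<tau>)) r s + Delta_s (fluxdot adot bdot (u i \<tau>)) r s)
          = trunc_rhs (N i) (u i \<tau>) r s"
          using rs by (auto simp: trunc_rhs_def Delta_r_def Delta_s_def zero_ext_def trunc_flux_def trunc_fluxdot_def)
      qed
      ultimately show ?thesis by (rule Lim_transform_eventually)
    qed
    have "(\<lambda>i. LBINT \<tau>:{0..grid (N i) t}. trunc_rhs (N i) (u i \<tau>) r s) \<longlonglongrightarrow> (LBINT \<tau>:{0..t}. ?F \<tau>)"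
    proof (rule LBINT_tendsto[where N = 0 and L = "lip_const r s", OF _ F_meas _ rhs_lim grid_lim[OF t] grid_bounds(2)[OF t]])
      show "(\<lambda>\<tau>. trunc_rhs (N i) (u i \<tau>) r s) \<in> borel_measurable borel" for i
        unfolding u_def approx_def by (rule step_measurable)
      show "\<bar>trunc_rhs (N i) (u i \<tau>) r s\<bar> \<le> lip_const r s" for i \<tau>
        unfolding u_def approx_def by (rule euler_rhs_bound[OF N1 rs])
    qed
    moreover have "(\<lambda>i. euler (N i) 0 r s) \<longlonglongrightarrow> c0 r s"
    proof (rule tendsto_eventually, rule eventually_sequentiallyI[of "r + s"])
      fix i assume "r + s \<le> i"
      then show "euler (N i) 0 r s = c0 r s" using N_gt[of i] rs by simp
    qed
    \<comment> \<open>At grid times the scheme is an exact integral equation, and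
      \<open>u i t\<close> is its value at the last grid time before \<open>t\<close>; convergence
      of the grid times then permits the limit.\<close>
    moreover have "u i t r s = euler (N i) 0 r s + (LBINT \<tau>:{0..grid (N i) t}. trunc_rhs (N i) (u i \<tau>) r s)" for i
      using step_LBINT[OF dt_pos, of "nat \<lfloor>t / dt (N i)\<rfloor>" "N i" "\<lambda>j. trunc_rhs (N i) (euler (N i) j) r s"]
        euler_eq_sum[of "N i" "nat \<lfloor>t / dt (N i)\<rfloor>" r s]
      unfolding u_def approx_def grid_def by (simp only:)
    ultimately have "(\<lambda>i. u i t r s) \<longlonglongrightarrow> c0 r s + (LBINT \<tau>:{0..t}. ?F \<tau>)"
      by (simp only: tendsto_add)
    moreover have "(\<lambda>i. u i t r s) \<longlonglongrightarrow> c t r s" using rs t by (intro lim) auto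
    ultimately have "c t r s = c0 r s + (LBINT \<tau>:{0..t}. ?F \<tau>)" by (rule LIMSEQ_unique[rotated])
    then show ?thesis
      unfolding set_lebesgue_integral_def scaleR_minus_right Bochner_Integration.integral_minus by simp
  qed
  have rate_finite: "(\<integral>\<^sup>+\<tau>\<in>{0..T}. (\<Sum>\<^sub>\<infinity>(r, s)\<in>Omega. ennreal (gross_rate (c \<tau>) r s)) \<partial>lborel) < \<infinity>"
    if T: "0 \<le> T" for T
  proof -
    let ?g = "\<lambda>p \<tau>. case p of (r, s) \<Rightarrow> gross_rate (c \<tau>) r s"
    have TT: "T \<in> {0..T}" using T by simp
    define K where "K = M + T * (C * M * M + C * M)"
    have le: "(\<Sum>p\<in>Omega_upto k. LBINT \<tau>:{0..T}. ?g p \<tau>) \<le> K" for k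
    proof -
      let ?G = "\<lambda>c. \<Sum>(r, s)\<in>Omega_upto k. gross_rate c r s"
      \<comment> \<open>\<open>?L\<close> depends on k and only justifies the limit in i for fixed
        k. The bound \<open>K\<close>, obtained by counting clusters, is uniform in k, so that
        monotone convergence applies afterwards.\<close>
      let ?L = "\<Sum>(r, s)\<in>Omega_upto k. (a r s + adot r s) * M + b (r + 1) s * M + bdot r (s + 1) * M"
      have G_cont: "continuous_on {0..T} (\<lambda>\<tau>. ?G (c \<tau>))"
        by (intro continuous_on_sum) (auto intro!: flux_cont(3))
      have "(\<lambda>i. LBINT \<tau>:{0..grid (N i) T}. ?G (u i \<tau>)) \<longlonglongrightarrow> (LBINT \<tau>:{0..T}. ?G (c \<tau>))"
      proof (rule LBINT_tendsto[where N = 0 and L = ?L, OF _ _ _ _ grid_lim[OF T] grid_bounds(2)[OF T]])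
        show "(\<lambda>\<tau>. ?G (u i \<tau>)) \<in> borel_measurable borel" for i
          unfolding u_def approx_def by (rule step_measurable)
        show "set_borel_measurable lborel {0..T} (\<lambda>\<tau>. ?G (c \<tau>))"
          using cont_set_integrable[OF TT G_cont]
          by (simp add: set_borel_measurable_def set_integrable_def borel_measurable_integrable)
        fix \<tau> assume \<tau>: "\<tau> \<in> {0..T}"
        show "(\<lambda>i. ?G (u i \<tau>)) \<longlonglongrightarrow> ?G (c \<tau>)"
          by (intro tendsto_sum) (use \<tau> in \<open>auto intro!: flux_lim(3)\<close>)
        fix i
        have g: "0 \<le> gross_rate (u i \<tau>) r s \<and> gross_rate (u i \<tau>) r s
            \<le> (a r s + adot r s) * M + b (r + 1) s * M + bdot r (s + 1) * M" if rs: "1 \<le> r + s" for r s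
          unfolding gross_rate_def
          using a_nonneg[OF rs] adot_nonneg[OF rs] b_nonneg[OF rs] bdot_nonneg[OF rs] u_nonneg rs
          by (auto intro!: add_nonneg_nonneg mult_nonneg_nonneg add_mono mult_left_mono u_le)
        have "0 \<le> ?G (u i \<tau>)" by (rule sum_nonneg) (use g in auto)
        moreover have "?G (u i \<tau>) \<le> ?L" by (rule sum_mono) (use g in auto)
        ultimately show "\<bar>?G (u i \<tau>)\<bar> \<le> ?L" by simp
      qed
      moreover have "(LBINT \<tau>:{0..grid (N i) T}. ?G (u i \<tau>)) \<le> K" if i: "k \<le> i" for i
      proof -
        have k: "k < N i" using N_gt[of i] i by simp
        have "(LBINT \<tau>:{0..grid (N i) T}. ?G (u i \<tau>))
            = dt (N i) * (\<Sum>j<nat \<lfloor>T / dt (N i)\<rfloor>. ?G (euler (N i) j))"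
          using step_LBINT[OF dt_pos, of "nat \<lfloor>T / dt (N i)\<rfloor>" "N i" "\<lambda>j. ?G (euler (N i) j)"]
          unfolding u_def approx_def grid_def .
        also have "\<dots> \<le> M + grid (N i) T * (C * M * M + C * M)"
          unfolding grid_def by (rule euler_gross_rate_le[OF k])
        also have "\<dots> \<le> K"
          unfolding K_def using grid_bounds(2)[OF T] C_nonneg M_nonneg
          by (intro add_left_mono mult_right_mono) auto
        finally show ?thesis .
      qed
      ultimately have "(LBINT \<tau>:{0..T}. ?G (c \<tau>)) \<le> K" by (intro LIMSEQ_le_const2) auto
      then show ?thesis
        using LBINT_sum[of "Omega_upto k" "{0..T}" ?g] cont_set_integrable[OF TT flux_cont(3)]
        by (auto simp: split_def)
    qed
    have g_nonneg: "0 \<le> gross_rate (c \<tau>) r s" if "1 \<le> r + s" "\<tau> \<in> {0..T}" for r s \<tau>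
      unfolding gross_rate_def using that
      by (intro add_nonneg_nonneg mult_nonneg_nonneg a_nonneg adot_nonneg b_nonneg bdot_nonneg c_nonneg) auto
    have "(\<integral>\<^sup>+\<tau>\<in>{0..T}. (\<Sum>\<^sub>\<infinity>p\<in>Omega. ennreal (?g p \<tau>)) \<partial>lborel)
        = (SUP k. ennreal (\<Sum>p\<in>Omega_upto k. LBINT x:{0..T}. ?g p x))"
      by (rule nn_integral_infsum_Omega) (auto intro!: cont_set_integrable[OF TT] flux_cont(3) g_nonneg)
    also have "\<dots> \<le> ennreal K" by (rule SUP_least) (rule ennreal_leI[OF le])
    also have "\<dots> < \<infinity>" by simp
    finally show ?thesis by (simp add: split_def)
  qed
  have mass: "(\<Sum>\<^sub>\<infinity>(r, s)\<in>Omega. l r s * c t r s) = (\<Sum>\<^sub>\<infinity>(r, s)\<in>Omega. l r s * c0 r s)"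
    if t: "0 \<le> t" and l: "l = (\<lambda>r s. real r) \<or> l = (\<lambda>r s. real s)" for t l
  proof -
    let ?now = "\<Sum>\<^sub>\<infinity>(r, s)\<in>Omega. l r s * c t r s" and ?init = "\<Sum>\<^sub>\<infinity>(r, s)\<in>Omega. l r s * c0 r s"
    have l_le: "\<bar>l r s\<bar> \<le> 1 * real (r + s)" for r s using l by auto
    have c0_lim: "(\<lambda>i. \<Sum>(r, s)\<in>Omega_upto (N i). l r s * c0 r s) \<longlonglongrightarrow> ?init"
    proof -
      have "strict_mono N" using \<rho>(1) by (simp add: strict_mono_def N_def)
      from LIMSEQ_subseq_LIMSEQ[OF sum_Omega_upto_tendsto[OF Xplus_summable[OF c0_Xplus l_le]] this]
      show ?thesis by (simp add: comp_def)
    qed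
    have m_lim: "(\<lambda>k. \<Sum>(r, s)\<in>Omega_upto k. l r s * c t r s) \<longlonglongrightarrow> ?now"
      by (rule sum_Omega_upto_tendsto[OF Xplus_summable[OF c_Xplus[OF t] l_le]])
    have diff_lim: "(\<lambda>i. (\<Sum>(r, s)\<in>Omega_upto (N i). l r s * c0 r s) - (\<Sum>(r, s)\<in>Omega_upto k. l r s * u i t r s))
        \<longlonglongrightarrow> ?init - (\<Sum>(r, s)\<in>Omega_upto k. l r s * c t r s)" for k
      by (intro tendsto_diff c0_lim sum_lim t)
    have ge: "0 \<le> ?init - (\<Sum>(r, s)\<in>Omega_upto k. l r s * c t r s)" for k
      by (rule LIMSEQ_le_const[OF diff_lim]) (use approx_mass_upto(1)[OF N1 l] in \<open>auto simp: u_def\<close>)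
    \<comment> \<open>The limits are taken in a fixed order: first the truncation level at a fixed
      size k, then k. Since the tail is small uniformly in the truncation level, no mass escapes to
      infinite size.\<close>
    have "?init - ?now \<le> \<epsilon>" if \<epsilon>: "0 < \<epsilon>" for \<epsilon>
    proof -
      obtain R where R: "\<And>(n::nat) v. 1 \<le> n \<Longrightarrow> v \<in> {0..t} \<Longrightarrow>
        (\<Sum>(r, s)\<in>Omega_upto n. if R < r + s then real (r + s) * approx n v r s else 0) \<le> \<epsilon>"
        using approx_tail[OF \<epsilon>] by blast
      have "?init - (\<Sum>(r, s)\<in>Omega_upto k. l r s * c t r s) \<le> \<epsilon>" if k: "R \<le> k" for k
      proof (rule LIMSEQ_le_const2[OF diff_lim], intro exI allI impI)
        fix i
        have "(\<Sum>(r, s)\<in>Omega_upto (N i). l r s * c0 r s) - (\<Sum>(r, s)\<in>Omega_upto k. l r s * u i t r s)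
            \<le> (\<Sum>(r, s)\<in>Omega_upto (N i). if k < r + s then real (r + s) * approx (N i) t r s else 0)"
          unfolding u_def by (rule approx_mass_upto(2)[OF N1 l])
        also have "\<dots> \<le> (\<Sum>(r, s)\<in>Omega_upto (N i). if R < r + s then real (r + s) * approx (N i) t r s else 0)"
          by (rule sum_mono) (use k approx_nonneg[OF N1] in auto)
        also have "\<dots> \<le> \<epsilon>" using t by (intro R N1) auto
        finally show "(\<Sum>(r, s)\<in>Omega_upto (N i). l r s * c0 r s) - (\<Sum>(r, s)\<in>Omega_upto k. l r s * u i t r s) \<le> \<epsilon>" .
      qed
      then show ?thesis by (intro LIMSEQ_le_const2[OF tendsto_diff[OF tendsto_const m_lim]]) auto
    qed
    then have "?init \<le> ?now + \<epsilon>" if "0 < \<epsilon>" for \<epsilon>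
      using that by (simp only: diff_le_eq add.commute)
    then have "?init \<le> ?now" by (rule field_le_epsilon)
    moreover have "?now \<le> ?init"
      by (rule LIMSEQ_le_const2[OF m_lim]) (use ge in auto)
    ultimately show ?thesis by simp
  qed
  show thesis
  proof (rule that)
    fix T :: real assume T: "0 \<le> T"
    show "bd_cluster_solution a adot b bdot C c0 c T M"
      by unfold_locales
        (use T c0_Xplus c_Xplus c_norm c_cont rate_finite cluster_eq in \<open>auto simp: M_def\<close>)
  next
    fix t :: real assume t: "0 \<le> t"
    show "(\<Sum>\<^sub>\<infinity>(r, s)\<in>Omega. real r * c t r s) = (\<Sum>\<^sub>\<infinity>(r, s)\<in>Omega. real r * c0 r s)"
      using mass[OF t, of "\<lambda>r s. real r"] by simp
    show "(\<Sum>\<^sub>\<infinity>(r, s)\<in>Omega. real s * c t r s) = (\<Sum>\<^sub>\<infinity>(r, s)\<in>Omega. real s * c0 r s)"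
      using mass[OF t, of "\<lambda>r s. real s"] by simp
  qed
qed

end

theorem theorem1p2:
  fixes a adot b bdot c0 :: "nat \<Rightarrow> nat \<Rightarrow> real"
  assumes "\<forall>(r, s)\<in>Omega. a r s \<ge> 0 \<and> adot r s \<ge> 0 \<and> b (r + 1) s \<ge> 0 \<and> bdot r (s + 1) \<ge> 0"
    and "\<exists>C::real. \<forall>(r, s)\<in>Omega. a r s + adot r s \<le> C * real (r + s)"
    and "c0 \<in> bd_Xplus"
  shows "(\<exists>c. bd_solution a adot b bdot c0 \<infinity> c) \<and>
    (\<forall>T c. 0 < T \<and> bd_solution a adot b bdot c0 T c \<longrightarrow>
       (\<forall>t\<in>time_interval T.
          (\<Sum>\<^sub>\<infinity>(r, s)\<in>Omega. real r * c t r s) = (\<Sum>\<^sub>\<infinity>(r, s)\<in>Omega. real r * c0 r s) \<and>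
          (\<Sum>\<^sub>\<infinity>(r, s)\<in>Omega. real s * c t r s) = (\<Sum>\<^sub>\<infinity>(r, s)\<in>Omega. real s * c0 r s))) \<and>
    ((\<lambda>(r, s). (real (r + s))\<^sup>2 * c0 r s) summable_on Omega \<longrightarrow>
       (\<forall>T c d. 0 < T \<and> bd_solution a adot b bdot c0 T c \<and> bd_solution a adot b bdot c0 T d \<longrightarrow>
          (\<forall>t\<in>time_interval T. \<forall>(r, s)\<in>Omega. c t r s = d t r s)))"
proof -
  obtain C where C: "\<forall>(r, s)\<in>Omega. a r s + adot r s \<le> C * real (r + s)"
    using assms(2) by blast
  interpret bd_euler a adot b bdot C c0
  proof
    fix r s :: nat assume "1 \<le> r + s"
    then have rs: "(r, s) \<in> Omega" by simp
    show "0 \<le> a r s" "0 \<le> adot r s" "0 \<le> b (r + 1) s" "0 \<le> bdot r (s + 1)"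
      using bspec[OF assms(1) rs] by simp_all
    show "a r s + adot r s \<le> C * real (r + s)" using bspec[OF C rs] by simp
  qed (rule assms(3))
  have "\<exists>c. bd_solution a adot b bdot c0 \<infinity> c"
    by (rule cluster_solution_exists, rule exI, rule bd_solution_globalI)
  moreover have "\<forall>(r, s)\<in>Omega. c t r s = d t r s"
    if "bd_solution a adot b bdot c0 T c" "bd_solution a adot b bdot c0 T d"
      "(\<lambda>(r, s). (real (r + s))\<^sup>2 * c0 r s) summable_on Omega" "t \<in> time_interval T" for T c d t
    using bd_solution_unique[OF that] by auto
  ultimately show ?thesis using bd_solution_mass by blast
qed

end
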